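(* Let $(A,\{\cdot,\cdots,\cdot\})$ be an $n$-pre-Lie algebra and $(V,l,r)$ a representation of it. Suppose that $T:V\to A$ is an $\mathcal O$-operator associated to $(V,l,r)$. Then there exists an $n$-L-dendriform algebra structure on $V$ given by $$\nwarrow(u_1,\dots,u_n)=l(Tu_1,\dots,Tu_{n-1})u_n,\qquad \nearrow(u_1,\dots,u_n)=r(Tu_2,\dots,Tu_n)u_1,\qquad u_i\in V,\ 1\le i\le n.$$ Therefore, there exist two associated $n$-pre-Lie algebra structures on $V$, and $T$ is a homomorphism of $n$-pre-Lie algebras. Moreover, $T(V)=\{T(v)\mid v\in V\}$ is an $n$-pre-Lie subalgebra of $(A,\{\cdot,\cdots,\cdot\})$, and there is an induced $n$-L-dendriform algebra structure on $T(V)$ given by $$\nwarrow(Tu_1,\dots,Tu_n)=T(\nwarrow(u_1,\dots,u_n)),\qquad \nearrow(Tu_1,\dots,Tu_n)=T(\nearrow(u_1,\dots,u_n)),\qquad u_i\in V,\ 1\le i\le n.$$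
   Context: $\mathbb K$ is a field of characteristic $0$; all vector spaces are finite dimensional over $\mathbb K$; $n\ge 2$ is an integer; a hat means omission. An $n$-Lie algebra is a vector space $A$ with a skew-symmetric $n$-linear bracket with $[x_1,\dots,x_{n-1},[y_1,\dots,y_n]]=\sum_{i=1}^n[y_1,\dots,y_{i-1},[x_1,\dots,x_{n-1},y_i],y_{i+1},\dots,y_n]$. A representation of it on $V$ is a linear map $\rho:\wedge^{n-1}A\to gl(V)$ with $\rho([x_1,\dots,x_n],y_1,\dots,y_{n-2})=\sum_{i=1}^n(-1)^{n-i}\rho(x_1,\dots,\widehat{x_i},\dots,x_n)\rho(x_i,y_1,\dots,y_{n-2})$ and $[\rho(x_1,\dots,x_{n-1}),\rho(y_1,\dots,y_{n-1})]=\sum_{i=1}^{n-1}\rho(y_1,\dots,y_{i-1},[x_1,\dots,x_{n-1},y_i],y_{i+1},\dots,y_{n-1})$. An $n$-pre-Lie algebra is a vector space $A$ with an $n$-linear map $\{\cdot,\cdots,\cdot\}:(\wedge^{n-1}A)\otimes A\to A$ such that $\{x_1,\dots,x_{n-1},\{y_1,\dots,y_n\}\}=\sum_{i=1}^{n-1}\{y_1,\dots,y_{i-1},[x_1,\dots,x_{n-1},y_i]^C,y_{i+1},\dots,y_n\}+\{y_1,\dots,y_{n-1},\{x_1,\dots,x_{n-1},y_n\}\}$ and $\{[x_1,\dots,x_n]^C,y_1,\dots,y_{n-1}\}=\sum_{i=1}^n(-1)^{n-i}\{x_1,\dots,\widehat{x_i},\dots,x_n,\{x_i,y_1,\dots,y_{n-1}\}\}$,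 where $[x_1,\dots,x_n]^C=\sum_{i=1}^n(-1)^{n-i}\{x_1,\dots,\widehat{x_i},\dots,x_n,x_i\}$; $A^c=(A,[\cdot,\cdots,\cdot]^C)$ is then an $n$-Lie algebra. A representation of an $n$-pre-Lie algebra $A$ on $V$ is $(V,l,r)$ with $l:\wedge^{n-1}A\to gl(V)$ a representation of $A^c$ and $r:(\wedge^{n-2}A)\otimes A\to gl(V)$ linear such that, for all $x_i,y_i\in A$, with $\mu(x_1,\dots,x_{n-1})=l(x_1,\dots,x_{n-1})+\sum_{i=1}^{n-1}(-1)^ir(x_1,\dots,\widehat{x_i},\dots,x_{n-1},x_i)$: (R1) $l(x_1,\dots,x_{n-1})r(y_1,\dots,y_{n-1})=r(y_1,\dots,y_{n-1})\mu(x_1,\dots,x_{n-1})+\sum_{i=1}^{n-2}r(y_1,\dots,y_{i-1},[x_1,\dots,x_{n-1},y_i]^C,y_{i+1},\dots,y_{n-1})+r(y_1,\dots,y_{n-2},\{x_1,\dots,x_{n-1},y_{n-1}\})$; (R2) $r([x_1,\dots,x_n]^C,y_1,\dots,y_{n-2})=\sum_{i=1}^n(-1)^{n-i}l(x_1,\dots,\widehat{x_i},\dots,x_n)r(x_i,y_1,\dots,y_{n-2})$; (R3) $r(x_1,\dots,x_{n-2},\{y_1,\dots,y_n\})=l(y_1,\dots,y_{n-1})r(x_1,\dots,x_{n-2},y_n)+\sum_{i=1}^{n-1}(-1)^{i+1}r(y_1,\dots,\widehat{y_i},\dots,y_n)\mu(x_1,\dots,x_{n-2},y_i)$; (R4)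 $r(y_1,\dots,y_{n-1})\mu(x_1,\dots,x_{n-1})=l(x_1,\dots,x_{n-1})r(y_1,\dots,y_{n-1})+\sum_{i=1}^{n-1}(-1)^ir(x_1,\dots,\widehat{x_i},\dots,x_{n-1},\{x_i,y_1,\dots,y_{n-1}\})$. A linear map $T:V\to A$ is an $\mathcal O$-operator associated to $(V,l,r)$ if for all $u_i\in V$ $$\{Tu_1,\dots,Tu_n\}=T\Big(l(Tu_1,\dots,Tu_{n-1})u_n+\sum_{i=1}^{n-1}(-1)^{i+1}r(Tu_1,\dots,\widehat{Tu_i},\dots,Tu_n)u_i\Big).$$ An $n$-L-dendriform algebra is a vector space $A$ with $n$-linear maps $\nwarrow:(\wedge^{n-1}A)\otimes A\to A$ and $\nearrow:A\otimes(\wedge^{n-2}A)\otimes A\to A$ such that, for all $x_i,y_i\in A$, with $\{x_1,\dots,x_n\}^h=\nwarrow(x_1,\dots,x_n)+\sum_{i=1}^{n-1}(-1)^{i+1}\nearrow(x_i,x_1,\dots,\widehat{x_i},\dots,x_n)$, $\{x_1,\dots,x_n\}^v=\nwarrow(x_1,\dots,x_n)+\sum_{i=1}^{n-1}(-1)^i\nearrow(x_n,x_1,\dots,\widehat{x_i},\dots,x_{n-1},x_i)$, $[x_1,\dots,x_n]^C=\sum_{i=1}^n(-1)^{n-i}\{x_1,\dots,\widehat{x_i},\dots,x_n,x_i\}^h=\sum_{i=1}^n(-1)^{n-i}\{x_1,\dots,\widehat{x_i},\dots,x_n,x_i\}^v$: (D1) $\nwarrow(x_1,\dots,x_{n-1},\nwarrow(y_1,\dots,y_n))-\nwarrow(y_1,\dots,y_{n-1},\nwarrow(x_1,\dots,x_{n-1},y_n))=\sum_{i=1}^{n-1}\nwarrow(y_1,\dots,y_{i-1},[x_1,\dots,x_{n-1},y_i]^C,y_{i+1},\dots,y_n)$;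 (D2) $\nwarrow([x_1,\dots,x_n]^C,y_1,\dots,y_{n-1})=\sum_{i=1}^n(-1)^{n-i}\nwarrow(x_1,\dots,\widehat{x_i},\dots,x_n,\nwarrow(x_i,y_1,\dots,y_{n-1}))$; (D3) $\nwarrow(x_1,\dots,x_{n-1},\nearrow(y_n,y_1,\dots,y_{n-1}))-\nearrow(y_n,y_1,\dots,y_{n-2},\{x_1,\dots,x_{n-1},y_{n-1}\}^h)=\nearrow(\{x_1,\dots,x_{n-1},y_n\}^v,y_1,\dots,y_{n-1})+\sum_{i=1}^{n-2}\nearrow(y_n,y_1,\dots,y_{i-1},[x_1,\dots,x_{n-1},y_i]^C,y_{i+1},\dots,y_{n-1})$; (D4) $\nearrow(y_{n-1},[x_1,\dots,x_n]^C,y_1,\dots,y_{n-2})=\sum_{i=1}^n(-1)^{n-i}\nwarrow(x_1,\dots,\widehat{x_i},\dots,x_n,\nearrow(y_{n-1},x_i,y_1,\dots,y_{n-2}))$; (D5) $\nearrow(x_{n-1},x_1,\dots,x_{n-2},\{y_1,\dots,y_n\}^h)-\nwarrow(y_1,\dots,y_{n-1},\nearrow(x_{n-1},x_1,\dots,x_{n-2},y_n))=\sum_{i=1}^{n-1}(-1)^{i+1}\nearrow(\{x_1,\dots,x_{n-2},y_i,x_{n-1}\}^v,y_1,\dots,\widehat{y_i},\dots,y_n)$; (D6) $\nearrow(\{x_1,\dots,x_{n-1},y_n\}^v,y_1,\dots,y_{n-1})-\nwarrow(x_1,\dots,x_{n-1},\nearrow(y_n,y_1,\dots,y_{n-1}))=\sum_{i=1}^{n-1}(-1)^i\nearrow(y_n,x_1,\dots,\widehat{x_i},\dots,x_{n-1},\{x_i,y_1,\dots,y_{n-1}\}^h)$.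 The two $n$-pre-Lie structures associated to an $n$-L-dendriform algebra are $\{\cdot,\cdots,\cdot\}^h$ (horizontal) and $\{\cdot,\cdots,\cdot\}^v$ (vertical). *)

theory Defs
  imports Complex_Main
begin

text \<open>
  A vector space is a carrier \<open>A\<close> which is a subspace of an ambient type \<open>'a\<close> with scalar
  multiplication \<open>s\<close>; carriers are needed because the image of a linear map has to carry
  structures of its own. A map of \<open>k\<close> arguments takes a list of length \<open>k\<close>, and only its
  values on lists over the carrier matter. List positions count from 0, so the \<open>i\<close>-th
  argument of the usual notation is \<open>xs ! (i - 1)\<close>; hence the sign \<open>(-1)\<^sup>i\<^sup>+\<^sup>1\<close> becomes
  \<open>(-1) ^ i\<close>, the sign \<open>(-1)\<^sup>i\<close> becomes \<open>(-1) ^ Suc i\<close>, and \<open>(-1)\<^sup>n\<^sup>-\<^sup>i\<close> becomes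
  \<open>(-1) ^ (n - Suc i)\<close>.
\<close>

definition fd_space :: "('k::field \<Rightarrow> 'a::ab_group_add \<Rightarrow> 'a) \<Rightarrow> 'a set \<Rightarrow> bool" where
  "fd_space s A \<longleftrightarrow> vector_space s \<and> module.subspace s A \<and>
     (\<exists>B. finite B \<and> B \<subseteq> A \<and> module.span s B = A)"

definition vecs :: "nat \<Rightarrow> 'a set \<Rightarrow> 'a list set" where
  "vecs k A = {xs. length xs = k \<and> set xs \<subseteq> A}"

definition omit :: "nat \<Rightarrow> 'a list \<Rightarrow> 'a list" where
  "omit i xs = take i xs @ drop (Suc i) xs"

definition linear_map ::
  "('k::field \<Rightarrow> 'a::ab_group_add \<Rightarrow> 'a) \<Rightarrow> 'a set \<Rightarrow> ('k \<Rightarrow> 'b::ab_group_add \<Rightarrow> 'b) \<Rightarrow> 'b set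
     \<Rightarrow> ('a \<Rightarrow> 'b) \<Rightarrow> bool" where
  "linear_map sA A sB B f \<longleftrightarrow>
     (\<forall>x\<in>A. f x \<in> B) \<and>
     (\<forall>x\<in>A. \<forall>y\<in>A. f (x + y) = f x + f y) \<and>
     (\<forall>c. \<forall>x\<in>A. f (sA c x) = sB c (f x))"

definition multilinear_map ::
  "nat \<Rightarrow> ('k::field \<Rightarrow> 'a::ab_group_add \<Rightarrow> 'a) \<Rightarrow> 'a set \<Rightarrow> ('k \<Rightarrow> 'b::ab_group_add \<Rightarrow> 'b) \<Rightarrow> 'b set
     \<Rightarrow> ('a list \<Rightarrow> 'b) \<Rightarrow> bool" where
  "multilinear_map k sA A sB B f \<longleftrightarrow>
     (\<forall>xs\<in>vecs k A. f xs \<in> B) \<and>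
     (\<forall>xs\<in>vecs k A. \<forall>i<k. linear_map sA A sB B (\<lambda>x. f (xs[i := x])))"

text \<open>
  A linear map out of a tensor product with a factor \<open>\<Lambda>\<^sup>m A\<close> is a multilinear map that is
  alternating in the positions \<open>P\<close> of that factor.
\<close>

definition alternating_in ::
  "nat set \<Rightarrow> nat \<Rightarrow> 'a set \<Rightarrow> ('a list \<Rightarrow> 'b::ab_group_add) \<Rightarrow> bool" where
  "alternating_in P k A f \<longleftrightarrow>
     (\<forall>xs\<in>vecs k A. \<forall>i\<in>P. \<forall>j\<in>P. i \<noteq> j \<and> xs ! i = xs ! j \<longrightarrow> f xs = 0)"

text \<open>
  Multilinear maps into \<open>gl(V)\<close>, alternating in the positions \<open>P\<close>. Operators are functions on
  the ambient type of \<open>V\<close> and are compared on \<open>V\<close> only.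
\<close>

definition gl_map ::
  "nat set \<Rightarrow> nat \<Rightarrow> ('k::field \<Rightarrow> 'a::ab_group_add \<Rightarrow> 'a) \<Rightarrow> 'a set
     \<Rightarrow> ('k \<Rightarrow> 'v::ab_group_add \<Rightarrow> 'v) \<Rightarrow> 'v set \<Rightarrow> ('a list \<Rightarrow> 'v \<Rightarrow> 'v) \<Rightarrow> bool" where
  "gl_map P k sA A sV V f \<longleftrightarrow>
     (\<forall>xs\<in>vecs k A. linear_map sV V sV V (f xs)) \<and>
     (\<forall>v\<in>V. multilinear_map k sA A sV V (\<lambda>xs. f xs v) \<and> alternating_in P k A (\<lambda>xs. f xs v))"

definition commutator ::
  "nat \<Rightarrow> ('k::field \<Rightarrow> 'a::ab_group_add \<Rightarrow> 'a) \<Rightarrow> ('a list \<Rightarrow> 'a) \<Rightarrow> 'a list \<Rightarrow> 'a" where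
  "commutator n s br xs = (\<Sum>i<n. s ((-1) ^ (n - Suc i)) (br (omit i xs @ [xs ! i])))"

definition n_pre_lie_algebra ::
  "nat \<Rightarrow> ('k::field \<Rightarrow> 'a::ab_group_add \<Rightarrow> 'a) \<Rightarrow> 'a set \<Rightarrow> ('a list \<Rightarrow> 'a) \<Rightarrow> bool" where
  "n_pre_lie_algebra n s A br \<longleftrightarrow>
     fd_space s A \<and> multilinear_map n s A s A br \<and> alternating_in {..<n - 1} n A br \<and>
     (\<forall>xs\<in>vecs (n - 1) A. \<forall>ys\<in>vecs n A.
        br (xs @ [br ys]) =
          (\<Sum>i<n - 1. br (ys[i := commutator n s br (xs @ [ys ! i])]))
          + br (butlast ys @ [br (xs @ [last ys])])) \<and>
     (\<forall>xs\<in>vecs n A. \<forall>ys\<in>vecs (n - 1) A.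
        br (commutator n s br xs # ys) =
          (\<Sum>i<n. s ((-1) ^ (n - Suc i)) (br (omit i xs @ [br (xs ! i # ys)]))))"

definition n_pre_lie_subalgebra ::
  "nat \<Rightarrow> ('k::field \<Rightarrow> 'a::ab_group_add \<Rightarrow> 'a) \<Rightarrow> 'a set \<Rightarrow> ('a list \<Rightarrow> 'a) \<Rightarrow> 'a set \<Rightarrow> bool" where
  "n_pre_lie_subalgebra n s A br B \<longleftrightarrow>
     module.subspace s B \<and> B \<subseteq> A \<and> (\<forall>xs\<in>vecs n B. br xs \<in> B)"

definition n_pre_lie_hom ::
  "nat \<Rightarrow> ('k::field \<Rightarrow> 'a::ab_group_add \<Rightarrow> 'a) \<Rightarrow> 'a set \<Rightarrow> ('a list \<Rightarrow> 'a)
     \<Rightarrow> ('k \<Rightarrow> 'b::ab_group_add \<Rightarrow> 'b) \<Rightarrow> 'b set \<Rightarrow> ('b list \<Rightarrow> 'b) \<Rightarrow> ('a \<Rightarrow> 'b) \<Rightarrow> bool" where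
  "n_pre_lie_hom n sA A brA sB B brB f \<longleftrightarrow>
     linear_map sA A sB B f \<and> (\<forall>xs\<in>vecs n A. f (brA xs) = brB (map f xs))"

text \<open>
  The conditions on a representation of the \<open>n\<close>-Lie algebra \<open>(A, brk)\<close>. It is used only with
  \<open>brk\<close> the commutator of an \<open>n\<close>-pre-Lie algebra, which is an \<open>n\<close>-Lie bracket.
\<close>

definition n_lie_rep ::
  "nat \<Rightarrow> ('k::field \<Rightarrow> 'a::ab_group_add \<Rightarrow> 'a) \<Rightarrow> 'a set \<Rightarrow> ('a list \<Rightarrow> 'a)
     \<Rightarrow> ('k \<Rightarrow> 'v::ab_group_add \<Rightarrow> 'v) \<Rightarrow> 'v set \<Rightarrow> ('a list \<Rightarrow> 'v \<Rightarrow> 'v) \<Rightarrow> bool" where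
  "n_lie_rep n sA A brk sV V \<rho> \<longleftrightarrow>
     gl_map {..<n - 1} (n - 1) sA A sV V \<rho> \<and>
     (\<forall>xs\<in>vecs n A. \<forall>ys\<in>vecs (n - 2) A. \<forall>v\<in>V.
        \<rho> (brk xs # ys) v =
          (\<Sum>i<n. sV ((-1) ^ (n - Suc i)) (\<rho> (omit i xs) (\<rho> (xs ! i # ys) v)))) \<and>
     (\<forall>xs\<in>vecs (n - 1) A. \<forall>ys\<in>vecs (n - 1) A. \<forall>v\<in>V.
        \<rho> xs (\<rho> ys v) - \<rho> ys (\<rho> xs v) = (\<Sum>i<n - 1. \<rho> (ys[i := brk (xs @ [ys ! i])]) v))"

definition rep_mu ::
  "nat \<Rightarrow> ('k::field \<Rightarrow> 'v::ab_group_add \<Rightarrow> 'v) \<Rightarrow> ('a list \<Rightarrow> 'v \<Rightarrow> 'v) \<Rightarrow> ('a list \<Rightarrow> 'v \<Rightarrow> 'v)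
     \<Rightarrow> 'a list \<Rightarrow> 'v \<Rightarrow> 'v" where
  "rep_mu n sV l r xs v =
     l xs v + (\<Sum>i<n - 1. sV ((-1) ^ Suc i) (r (omit i xs @ [xs ! i]) v))"

text \<open>
  In the conjunct for \<open>r (xs @ [br ys])\<close> the signs are \<open>(-1)\<^sup>i\<^sup>+\<^sup>1\<close> (counting from 1) for all
  \<open>n\<close>; the semidirect product on \<open>A \<oplus> V\<close> would give \<open>(-1)\<^sup>n\<^sup>+\<^sup>i\<close>, which differs for even \<open>n\<close>.
\<close>

definition n_pre_lie_rep ::
  "nat \<Rightarrow> ('k::field \<Rightarrow> 'a::ab_group_add \<Rightarrow> 'a) \<Rightarrow> 'a set \<Rightarrow> ('a list \<Rightarrow> 'a)
     \<Rightarrow> ('k \<Rightarrow> 'v::ab_group_add \<Rightarrow> 'v) \<Rightarrow> 'v set \<Rightarrow> ('a list \<Rightarrow> 'v \<Rightarrow> 'v) \<Rightarrow> ('a list \<Rightarrow> 'v \<Rightarrow> 'v)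
     \<Rightarrow> bool" where
  "n_pre_lie_rep n sA A br sV V l r \<longleftrightarrow>
     fd_space sV V \<and>
     n_lie_rep n sA A (commutator n sA br) sV V l \<and>
     gl_map {..<n - 2} (n - 1) sA A sV V r \<and>
     (\<forall>xs\<in>vecs (n - 1) A. \<forall>ys\<in>vecs (n - 1) A. \<forall>v\<in>V.
        l xs (r ys v) =
          r ys (rep_mu n sV l r xs v)
          + (\<Sum>i<n - 2. r (ys[i := commutator n sA br (xs @ [ys ! i])]) v)
          + r (butlast ys @ [br (xs @ [last ys])]) v) \<and>
     (\<forall>xs\<in>vecs n A. \<forall>ys\<in>vecs (n - 2) A. \<forall>v\<in>V.
        r (commutator n sA br xs # ys) v =
          (\<Sum>i<n. sV ((-1) ^ (n - Suc i)) (l (omit i xs) (r (xs ! i # ys) v)))) \<and>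
     (\<forall>xs\<in>vecs (n - 2) A. \<forall>ys\<in>vecs n A. \<forall>v\<in>V.
        r (xs @ [br ys]) v =
          l (butlast ys) (r (xs @ [last ys]) v)
          + (\<Sum>i<n - 1. sV ((-1) ^ i) (r (omit i ys) (rep_mu n sV l r (xs @ [ys ! i]) v)))) \<and>
     (\<forall>xs\<in>vecs (n - 1) A. \<forall>ys\<in>vecs (n - 1) A. \<forall>v\<in>V.
        r ys (rep_mu n sV l r xs v) =
          l xs (r ys v)
          + (\<Sum>i<n - 1. sV ((-1) ^ Suc i) (r (omit i xs @ [br (xs ! i # ys)]) v)))"

definition O_operator ::
  "nat \<Rightarrow> ('k::field \<Rightarrow> 'a::ab_group_add \<Rightarrow> 'a) \<Rightarrow> 'a set \<Rightarrow> ('a list \<Rightarrow> 'a)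
     \<Rightarrow> ('k \<Rightarrow> 'v::ab_group_add \<Rightarrow> 'v) \<Rightarrow> 'v set \<Rightarrow> ('a list \<Rightarrow> 'v \<Rightarrow> 'v) \<Rightarrow> ('a list \<Rightarrow> 'v \<Rightarrow> 'v)
     \<Rightarrow> ('v \<Rightarrow> 'a) \<Rightarrow> bool" where
  "O_operator n sA A br sV V l r T \<longleftrightarrow>
     linear_map sV V sA A T \<and>
     (\<forall>us\<in>vecs n V.
        br (map T us) =
          T (l (map T (butlast us)) (last us)
             + (\<Sum>i<n - 1. sV ((-1) ^ i) (r (map T (omit i us)) (us ! i)))))"

text \<open>
  \<open>nw\<close> and \<open>ne\<close> are the operations \<open>\<nwarrow>\<close> and \<open>\<nearrow>\<close>; the next two are the horizontal and the
  vertical bracket.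
\<close>

definition hor ::
  "nat \<Rightarrow> ('k::field \<Rightarrow> 'a::ab_group_add \<Rightarrow> 'a) \<Rightarrow> ('a list \<Rightarrow> 'a) \<Rightarrow> ('a list \<Rightarrow> 'a) \<Rightarrow> 'a list \<Rightarrow> 'a" where
  "hor n s nw ne xs =
     nw xs + (\<Sum>i<n - 1. s ((-1) ^ i) (ne (xs ! i # omit i xs)))"

definition ver ::
  "nat \<Rightarrow> ('k::field \<Rightarrow> 'a::ab_group_add \<Rightarrow> 'a) \<Rightarrow> ('a list \<Rightarrow> 'a) \<Rightarrow> ('a list \<Rightarrow> 'a) \<Rightarrow> 'a list \<Rightarrow> 'a" where
  "ver n s nw ne xs =
     nw xs + (\<Sum>i<n - 1. s ((-1) ^ Suc i) (ne (last xs # omit i (butlast xs) @ [xs ! i])))"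

text \<open>
  That the horizontal and the vertical bracket have the same commutator is part of the
  notation and holds for any \<open>nw\<close> and \<open>ne\<close>. The variable \<open>z\<close> is the element in the first
  slot of \<open>\<nearrow>\<close>; when it is counted among the \<open>x\<^sub>i\<close> or \<open>y\<^sub>i\<close>, it comes after the entries of
  \<open>xs\<close> or \<open>ys\<close>.
\<close>

definition n_L_dendriform_algebra ::
  "nat \<Rightarrow> ('k::field \<Rightarrow> 'a::ab_group_add \<Rightarrow> 'a) \<Rightarrow> 'a set \<Rightarrow> ('a list \<Rightarrow> 'a) \<Rightarrow> ('a list \<Rightarrow> 'a) \<Rightarrow> bool" where
  "n_L_dendriform_algebra n s A nw ne \<longleftrightarrow>
     fd_space s A \<and>
     multilinear_map n s A s A nw \<and> alternating_in {..<n - 1} n A nw \<and>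
     multilinear_map n s A s A ne \<and> alternating_in {1..<n - 1} n A ne \<and>
     (\<forall>xs\<in>vecs n A. commutator n s (hor n s nw ne) xs = commutator n s (ver n s nw ne) xs) \<and>
     (\<forall>xs\<in>vecs (n - 1) A. \<forall>ys\<in>vecs n A.
        nw (xs @ [nw ys]) - nw (butlast ys @ [nw (xs @ [last ys])]) =
          (\<Sum>i<n - 1. nw (ys[i := commutator n s (hor n s nw ne) (xs @ [ys ! i])]))) \<and>
     (\<forall>xs\<in>vecs n A. \<forall>ys\<in>vecs (n - 1) A.
        nw (commutator n s (hor n s nw ne) xs # ys) =
          (\<Sum>i<n. s ((-1) ^ (n - Suc i)) (nw (omit i xs @ [nw (xs ! i # ys)])))) \<and>
     (\<forall>xs\<in>vecs (n - 1) A. \<forall>ys\<in>vecs (n - 1) A. \<forall>z\<in>A.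
        nw (xs @ [ne (z # ys)]) - ne (z # butlast ys @ [hor n s nw ne (xs @ [last ys])]) =
          ne (ver n s nw ne (xs @ [z]) # ys)
          + (\<Sum>i<n - 2. ne (z # ys[i := commutator n s (hor n s nw ne) (xs @ [ys ! i])]))) \<and>
     (\<forall>xs\<in>vecs n A. \<forall>ys\<in>vecs (n - 2) A. \<forall>z\<in>A.
        ne (z # commutator n s (hor n s nw ne) xs # ys) =
          (\<Sum>i<n. s ((-1) ^ (n - Suc i)) (nw (omit i xs @ [ne (z # xs ! i # ys)])))) \<and>
     (\<forall>xs\<in>vecs (n - 2) A. \<forall>ys\<in>vecs n A. \<forall>z\<in>A.
        ne (z # xs @ [hor n s nw ne ys]) - nw (butlast ys @ [ne (z # xs @ [last ys])]) =
          (\<Sum>i<n - 1. s ((-1) ^ i) (ne (ver n s nw ne (xs @ [ys ! i, z]) # omit i ys)))) \<and>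
     (\<forall>xs\<in>vecs (n - 1) A. \<forall>ys\<in>vecs (n - 1) A. \<forall>z\<in>A.
        ne (ver n s nw ne (xs @ [z]) # ys) - nw (xs @ [ne (z # ys)]) =
          (\<Sum>i<n - 1. s ((-1) ^ Suc i) (ne (z # omit i xs @ [hor n s nw ne (xs ! i # ys)]))))"

end

theory Submission
  imports Defs "HOL-Library.Product_Plus"
begin

text \<open>
  On \<open>A \<oplus> V\<close> put the semidirect product of \<open>A\<close> and \<open>(V, l, r)\<close>, in which a product with two factors
  in \<open>V\<close> vanishes. It is an \<open>n\<close>-pre-Lie algebra, because its two identities are multilinear and, with
  exactly one argument in \<open>V\<close>, are the conditions on a representation. An O-operator \<open>T\<close> makes the
  graph \<open>{(T u, u)}\<close> a subalgebra, which is \<open>V\<close> with the horizontal bracket. The vertical bracket is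
  \<open>\<mu>(T u\<^sub>1, \<dots>, T u\<^sub>n\<^sub>-\<^sub>1) u\<^sub>n\<close>, and \<open>\<mu>\<close> is a representation of the commutator \<open>n\<close>-Lie algebra since
  \<open>(0, \<mu>(x\<^sub>1, \<dots>, x\<^sub>n\<^sub>-\<^sub>1) v)\<close> is a commutator in the semidirect product. The dendriform axioms are the
  conditions on a representation evaluated at \<open>T u\<^sub>i\<close>.

  For even \<open>n\<close> one condition on a representation has the opposite sign of what the semidirect
  product needs. There the remaining conditions imply \<open>r(y\<^sub>1, \<dots>, y\<^sub>n\<^sub>-\<^sub>1) \<mu>(x\<^sub>1, \<dots>, x\<^sub>n\<^sub>-\<^sub>1) = 0\<close>, so that the
  sign does not matter. This rests on the fact that the adjacency matrix of the odd graph has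
  eigenvalues \<open>(-1)\<^sup>i (n - 1 - i)\<close> with \<open>0 \<le> i < n - 1\<close>, hence neither \<open>0\<close> nor, for even \<open>n\<close>, \<open>-1\<close>.
\<close>

section \<open>Signed sums over lists and the fundamental identity\<close>

text \<open>The sign obstacle sits in the condition for \<open>r (xs @ [br ys])\<close>: an element
  of V among the first slots of the left identity of the semidirect product produces
  \<open>(-1)^(n - 1 + i)\<close> (positions from 0), while the definition has
  \<open>(-1)^i\<close>. For even n write \<open>b\<close> for values of \<open>r\<close> after
  \<open>\<mu>\<close>, \<open>q\<close> for values of \<open>l\<close> after \<open>r\<close>,
  \<open>t\<close> for values of \<open>r\<close> at a product, and \<open>A\<close> for the
  adjacency operator. The conditions then read \<open>b = q - A t\<close>,
  \<open>t = q + A b\<close> and \<open>b = 2 q - A\<^sup>2 q - t\<close>. Eliminating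
  \<open>q\<close> and \<open>t\<close> leaves \<open>A\<^sup>3 b = - A\<^sup>2 b\<close>, which is
  why just the eigenvalues 0 and -1 have to be excluded.

  Identities are checked for functions on whole types that are additive in every slot: there any
  argument list splits into lists with entries in A or in V, which leaves finitely many cases.
  Carriers are removed by composing with linear projections and restored by restriction.

  On T(V) the operations must not depend on the choice of preimages. One slot is not seen through T,
  and the O-operator equation at a vector of the kernel settles this slot.\<close>

lemma length_omit: "i < length xs \<Longrightarrow> length (omit i xs) = length xs - 1"
  by (simp add: omit_def)

lemma map_omit: "map f (omit i xs) = omit i (map f xs)"
  by (simp add: omit_def take_map drop_map)

lemma omit_append:
  "omit i (us @ vs) = (if i < length us then omit i us @ vs else us @ omit (i - length us) vs)"
  by (auto simp: omit_def Suc_diff_le not_less)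

lemma omit_Cons: "omit i (x # xs) = (case i of 0 \<Rightarrow> xs | Suc j \<Rightarrow> x # omit j xs)"
  by (simp add: omit_def split: nat.split)

lemma omit_snoc: "length xs = k \<Longrightarrow> omit k (xs @ [a]) = xs"
  by (simp add: omit_def)

lemma set_omit_subset: "set (omit i xs) \<subseteq> set xs"
  by (auto simp: omit_def dest: in_set_takeD in_set_dropD)

text \<open>The increasing enumeration of the positions other than \<open>k\<close>. Sums over these
  positions thereby match sums over the list with entry \<open>k\<close> removed.\<close>

definition skip :: "nat \<Rightarrow> nat \<Rightarrow> nat" where
  "skip k i = (if i < k then i else Suc i)"

lemma nth_omit:
  assumes "k < length xs" "i < length xs - 1"
  shows "omit k xs ! i = xs ! skip k i"
  using assms by (auto simp: omit_def skip_def nth_append min_def)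

lemma omit_update_skip:
  assumes "k < length xs" "i < length xs - 1"
  shows "omit k (xs[skip k i := a]) = (omit k xs)[i := a]"
  by (rule nth_equalityI)
     (use assms in \<open>auto simp: length_omit nth_omit nth_list_update skip_def\<close>)

lemma omit_update_same: "omit k (xs[k := a]) = omit k xs"
  by (simp add: omit_def)

lemma sum_skip:
  assumes "k < n"
  shows "(\<Sum>i<n - 1. g (skip k i)) = (\<Sum>i\<in>{..<n} - {k}. g i)"
proof (rule sum.reindex_bij_betw)
  have "skip k ` {..<n - 1} = {..<n} - {k}"
  proof (rule set_eqI, rule iffI)
    fix i assume "i \<in> {..<n} - {k}"
    then show "i \<in> skip k ` {..<n - 1}"
      by (intro image_eqI[of _ _ "if i < k then i else i - 1"]) (use assms in \<open>auto simp: skip_def\<close>)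
  qed (use assms in \<open>auto simp: skip_def\<close>)
  then show "bij_betw (skip k) {..<n - 1} ({..<n} - {k})"
    by (auto simp: bij_betw_def inj_on_def skip_def)
qed

text \<open>The factor \<open>(-1)^k\<close> on a plain abelian group. Signs are the only scalars in
  the identities, so additive maps carry them along; \<open>scale_minus_one_power\<close> gives the
  link to scalar multiplication.\<close>

definition sg :: "nat \<Rightarrow> 'a::ab_group_add \<Rightarrow> 'a" where
  "sg k x = (if even k then x else - x)"

lemma sg_0 [simp]: "sg 0 x = x" by (simp add: sg_def)
lemma sg_Suc [simp]: "sg (Suc k) x = - sg k x" by (simp add: sg_def)
lemma sg_zero [simp]: "sg k 0 = 0" by (simp add: sg_def)
lemma sg_minus: "sg k (- x) = - sg k x" by (simp add: sg_def)
lemma sg_add: "sg k (x + y) = sg k x + sg k y" by (simp add: sg_def)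
lemma sg_sg: "sg j (sg k x) = sg (j + k) x" by (simp add: sg_def)
lemma sg_self: "sg k (sg k x) = x" by (simp add: sg_def)
lemma sg_sum: "sg k (sum f I) = (\<Sum>i\<in>I. sg k (f i))" by (simp add: sg_def sum_negf)
lemma sg_cong: "even (j + k) \<Longrightarrow> sg j x = sg k x" by (auto simp: sg_def)
lemma sg_eq_0_iff [simp]: "sg k x = 0 \<longleftrightarrow> x = 0" by (simp add: sg_def)
lemma fst_sg: "fst (sg k z) = sg k (fst z)" by (simp add: sg_def)
lemma snd_sg: "snd (sg k z) = sg k (snd z)" by (simp add: sg_def)

text \<open>A slot is addressed by splitting the list around it, which turns the function of that
  slot into an ordinary additive map with the library facts on sums, negation and zero.\<close>

definition additive_in :: "nat \<Rightarrow> ('a::ab_group_add list \<Rightarrow> 'b::ab_group_add) \<Rightarrow> bool" where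
  "additive_in k f \<longleftrightarrow> (\<forall>us x y ws. Suc (length us + length ws) = k \<longrightarrow>
     f (us @ (x + y) # ws) = f (us @ x # ws) + f (us @ y # ws))"

lemma additive_inD:
  "additive_in k f \<Longrightarrow> Suc (length us + length ws) = k \<Longrightarrow>
     additive (\<lambda>x. f (us @ x # ws))"
  by (simp add: additive_in_def additive_def)

lemma additive_inI:
  "(\<And>us ws. Suc (length us + length ws) = k \<Longrightarrow> additive (\<lambda>x. f (us @ x # ws))) \<Longrightarrow>
     additive_in k f"
  by (simp add: additive_in_def additive_def)

lemma additive_sg:
  assumes "additive f" shows "f (sg k x) = sg k (f x)"
  using additive.minus[OF assms] by (simp add: sg_def)

lemma additive_add: "additive f \<Longrightarrow> additive g \<Longrightarrow> additive (\<lambda>x. f x + g x)"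
  by (simp add: additive_def)

lemma additive_diff: "additive f \<Longrightarrow> additive g \<Longrightarrow> additive (\<lambda>x. f x - g x)"
  by (simp add: additive_def)

lemma additive_sg_fun: "additive f \<Longrightarrow> additive (\<lambda>x. sg k (f x))"
  by (simp add: additive_def sg_add)

lemma additive_sum_fun: "(\<And>i. i \<in> I \<Longrightarrow> additive (f i)) \<Longrightarrow> additive (\<lambda>x. \<Sum>i\<in>I. f i x)"
  by (simp add: additive_def sum.distrib)

lemma additive_comp: "additive f \<Longrightarrow> additive g \<Longrightarrow> additive (\<lambda>x. f (g x))"
  by (simp add: additive_def)

lemma additive_snd: "additive f \<Longrightarrow> additive (\<lambda>x. snd (f x))"
  by (simp add: additive_def)

abbreviation alternating :: "nat \<Rightarrow> nat \<Rightarrow> ('a list \<Rightarrow> 'b::ab_group_add) \<Rightarrow> bool" where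
  "alternating m k f \<equiv> alternating_in {..<m} k UNIV f"

lemma alternatingD:
  assumes "alternating m k f" "length xs = k" "i < m" "j < m" "i \<noteq> j" "xs ! i = xs ! j"
  shows "f xs = 0"
  using assms by (auto simp: alternating_in_def vecs_def)

lemma alternatingI:
  assumes "\<And>us a vs ws. length us + length vs + 2 \<le> m \<Longrightarrow>
     length us + length vs + length ws + 2 = k \<Longrightarrow> f (us @ a # vs @ a # ws) = 0"
    and "m \<le> k"
  shows "alternating m k f"
proof -
  have *: "f xs = 0" if "length xs = k" "i < j" "j < m" "xs ! i = xs ! j" for xs i j
  proof -
    define vs where "vs = drop (Suc i) (take j xs)"
    have j: "j < length xs" using that assms(2) by simp
    have "xs = take j xs @ xs ! j # drop (Suc j) xs"
      using j by (simp add: id_take_nth_drop)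
    also have "take j xs = take i xs @ xs ! i # vs"
      using that j id_take_nth_drop[of i "take j xs"] by (simp add: vs_def min_def)
    finally have "xs = take i xs @ xs ! j # vs @ xs ! j # drop (Suc j) xs"
      using that by simp
    moreover have "length (take i xs) + length vs + 2 \<le> m"
      and "length (take i xs) + length vs + length (drop (Suc j) xs) + 2 = k"
      using that j by (auto simp: vs_def min_def)
    ultimately show ?thesis using assms(1) by metis
  qed
  show ?thesis
    unfolding alternating_in_def vecs_def
  proof (intro ballI impI)
    fix xs :: "'a list" and i j
    assume "xs \<in> {xs. length xs = k \<and> set xs \<subseteq> UNIV}" "i \<in> {..<m}" "j \<in> {..<m}"
      and "i \<noteq> j \<and> xs ! i = xs ! j"
    then show "f xs = 0" using *[of xs i j] *[of xs j i] by (cases "i < j") auto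
  qed
qed

text \<open>Polarisation: the value with \<open>a + b\<close> in both slots vanishes, and so do the
  two summands with equal entries.\<close>

lemma alternating_swap:
  assumes "additive_in k f" "alternating m k f" "length us + 2 \<le> m" "length us + length ws + 2 = k"
  shows "f (us @ a # b # ws) = - f (us @ b # a # ws)"
proof -
  have zero: "f (us @ c # c # ws) = 0" for c
    by (rule alternatingD[OF assms(2), of _ "length us" "Suc (length us)"])
       (use assms in \<open>auto simp: nth_append\<close>)
  have 1: "f (us @ (x + y) # c # ws) = f (us @ x # c # ws) + f (us @ y # c # ws)" for x y c
    using additive.add[OF additive_inD[OF assms(1), of us "c # ws"]] assms by simp
  have 2: "f (us @ c # (x + y) # ws) = f (us @ c # x # ws) + f (us @ c # y # ws)" for x y c
    using additive.add[OF additive_inD[OF assms(1), of "us @ [c]" ws]] assms by simp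
  have "f (us @ (a + b) # (a + b) # ws) =
      f (us @ a # a # ws) + f (us @ a # b # ws) + (f (us @ b # a # ws) + f (us @ b # b # ws))"
    by (simp add: 1 2 add_ac)
  then show ?thesis by (simp add: zero eq_neg_iff_add_eq_0)
qed

text \<open>The entry passes \<open>vs\<close> one neighbour at a time. The bound
  \<open>length us + length vs < m\<close> keeps every transposition inside the alternating
  positions, including the place where \<open>a\<close> ends up.\<close>

lemma alternating_move:
  assumes "additive_in k f" "alternating m k f" "length us + length vs < m"
    "length us + length vs + length ws + 1 = k"
  shows "f (us @ a # vs @ ws) = sg (length vs) (f (us @ vs @ a # ws))"
  using assms(3,4)
proof (induction vs arbitrary: us)
  case (Cons b vs)
  have "f (us @ a # b # vs @ ws) = - f ((us @ [b]) @ a # vs @ ws)"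
    using alternating_swap[OF assms(1,2), of us "vs @ ws" a b] Cons.prems by simp
  also have "\<dots> = - sg (length vs) (f ((us @ [b]) @ vs @ a # ws))"
    using Cons.IH[of "us @ [b]"] Cons.prems by simp
  finally show ?case by simp
qed simp

text \<open>The commutator, the sum over \<open>r\<close> in \<open>mu\<close> and the one in the
  semidirect bracket all have this shape up to a sign, so their additivity and alternation are
  proved here once.\<close>

definition skew :: "nat \<Rightarrow> ('a list \<Rightarrow> 'a \<Rightarrow> 'b::ab_group_add) \<Rightarrow> 'a list \<Rightarrow> 'b" where
  "skew k H xs = (\<Sum>i<k. sg i (H (omit i xs) (xs ! i)))"

lemma additive_in_skew:
  assumes 1: "\<And>a. additive_in (k - 1) (\<lambda>ys. H ys a)"
    and 2: "\<And>ys. length ys = k - 1 \<Longrightarrow> additive (H ys)"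
  shows "additive_in k (skew k H)"
proof (rule additive_inI)
  fix us ws :: "'a list" assume k: "Suc (length us + length ws) = k"
  have "additive (\<lambda>x. H (omit i (us @ x # ws)) ((us @ x # ws) ! i))" if "i < k" for i
  proof -
    consider "i < length us" | "i = length us" | j where "i = Suc (length us + j)" "j < length ws"
      using \<open>i < k\<close> k less_iff_Suc_add[of "length us" i] by force
    then show ?thesis
    proof cases
      case 1
      then show ?thesis
        using additive_inD[OF assms(1), of "omit i us" ws] k
        by (simp add: omit_append nth_append length_omit)
    next
      case 2
      then show ?thesis using assms(2)[of "us @ ws"] k by (simp add: omit_append omit_Cons)
    next
      case 3
      then show ?thesis
        using additive_inD[OF assms(1), of us "omit j ws"] k
        by (simp add: omit_append omit_Cons nth_append length_omit)
    qed
  qed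
  then show "additive (\<lambda>x. skew k H (us @ x # ws))"
    unfolding skew_def by (intro additive_sum_fun additive_sg_fun) auto
qed

lemma alternating_skew:
  assumes add: "\<And>a. additive_in (k - 1) (\<lambda>ys. H ys a)"
    and alt: "\<And>a. alternating (k - 1) (k - 1) (\<lambda>ys. H ys a)"
  shows "alternating k k (skew k H)"
proof (rule alternatingI)
  fix us vs ws :: "'a list" and a
  assume k: "length us + length vs + length ws + 2 = k"
  define xs where "xs = us @ a # vs @ a # ws"
  define i j where "i = length us" and "j = Suc (length us + length vs)"
  have len: "length xs = k" and ij: "i < j" "j < k" and nth: "xs ! i = a" "xs ! j = a"
    using k by (auto simp: xs_def i_def j_def nth_append)
  \<comment> \<open>When another entry is singled out, both copies of \<open>a\<close> stay in the
    shorter list.\<close>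
  have "H (omit t xs) (xs ! t) = 0" if "t < k" "t \<noteq> i" "t \<noteq> j" for t
  proof -
    define i' j' where "i' = (if i < t then i else i - 1)" and "j' = (if j < t then j else j - 1)"
    have *: "i' < k - 1" "j' < k - 1" "i' \<noteq> j'" "skip t i' = i" "skip t j' = j"
      using that ij by (auto simp: i'_def j'_def skip_def)
    show ?thesis
      by (rule alternatingD[OF alt, of _ i' j'])
         (use * that len nth in \<open>auto simp: length_omit nth_omit\<close>)
  qed
  then have "skew k H xs = sum (\<lambda>t. sg t (H (omit t xs) (xs ! t))) {i, j}"
    unfolding skew_def by (intro sum.mono_neutral_right) (use ij in auto)
  also have "\<dots> = sg i (H (us @ vs @ a # ws) a) + sg j (H (us @ a # vs @ ws) a)"
    using ij nth by (simp add: xs_def omit_append omit_Cons i_def j_def)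
  \<comment> \<open>The two surviving lists differ by moving \<open>a\<close> past
    \<open>vs\<close>. Since \<open>j = i + length vs + 1\<close>, the terms have opposite
    signs.\<close>
  also have "H (us @ a # vs @ ws) a = sg (length vs) (H (us @ vs @ a # ws) a)"
    by (rule alternating_move[OF add alt]) (use k in auto)
  also have "sg i (H (us @ vs @ a # ws) a) + sg j (sg (length vs) (H (us @ vs @ a # ws) a)) = 0"
    by (simp add: sg_sg i_def j_def) (simp add: sg_def)
  finally show "skew k H (us @ a # vs @ a # ws) = 0" by (simp add: xs_def)
qed simp

definition cm :: "nat \<Rightarrow> ('a::ab_group_add list \<Rightarrow> 'a) \<Rightarrow> 'a list \<Rightarrow> 'a" where
  "cm n br xs = (\<Sum>i<n. sg (n - Suc i) (br (omit i xs @ [xs ! i])))"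

text \<open>For \<open>i < n\<close> the exponents \<open>n - 1 - i\<close> and
  \<open>n - 1 + i\<close> have the same parity, so the two sign conventions differ by a global
  factor.\<close>

lemma sum_sg_eq_skew:
  "(\<Sum>i<n. sg (n - Suc i) (H (omit i xs) (xs ! i))) = sg (n - 1) (skew n H xs)"
  by (auto simp: skew_def sg_sum sg_sg intro!: sum.cong sg_cong)

lemma cm_eq_skew: "cm n br xs = sg (n - 1) (skew n (\<lambda>ys a. br (ys @ [a])) xs)"
  unfolding cm_def by (rule sum_sg_eq_skew)

section \<open>Brackets, their commutators and the n-Lie identity\<close>

locale n_ary =
  fixes n :: nat and br :: "'a::ab_group_add list \<Rightarrow> 'a"
  assumes n: "n \<ge> 2"
    and br_additive: "additive_in n br"
    and br_alternating: "alternating (n - 1) n br"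
begin

lemma additive_in_snoc:
  "additive_in (n - 1) (\<lambda>ys. br (ys @ [a]))"
  by (rule additive_inI) (use n additive_inD[OF br_additive, of _ "_ @ [a]"] in simp)

lemma additive_last: "length ys = n - 1 \<Longrightarrow> additive (\<lambda>a. br (ys @ [a]))"
  using n additive_inD[OF br_additive, of ys "[]"] by simp

lemma additive_first: "length ys = n - 1 \<Longrightarrow> additive (\<lambda>a. br (a # ys))"
  using n additive_inD[OF br_additive, of "[]" ys] by simp

lemma alternating_snoc: "alternating (n - 1) (n - 1) (\<lambda>ys. br (ys @ [a]))"
proof (rule alternatingI)
  fix us vs ws :: "'a list" and b
  assume "length us + length vs + length ws + 2 = n - 1"
  then show "br ((us @ b # vs @ b # ws) @ [a]) = 0"
    by (intro alternatingD[OF br_alternating, of _ "length us" "length us + Suc (length vs)"])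
       (use n in \<open>auto simp: nth_append\<close>)
qed simp

lemma cm_additive: "additive_in n (cm n br)"
proof -
  have "additive_in n (skew n (\<lambda>ys a. br (ys @ [a])))"
    by (intro additive_in_skew additive_in_snoc additive_last)
  then show ?thesis
    by (intro additive_inI) (auto simp: cm_eq_skew intro!: additive_sg_fun dest: additive_inD)
qed

lemma cm_alternating: "alternating n n (cm n br)"
proof -
  have "alternating n n (skew n (\<lambda>ys a. br (ys @ [a])))"
    by (intro alternating_skew additive_in_snoc alternating_snoc)
  then show ?thesis by (auto simp: alternating_in_def cm_eq_skew)
qed

lemma cm_snoc:
  assumes "length xs = n - 1"
  shows "cm n br (xs @ [w]) =
    br (xs @ [w]) + (\<Sum>j<n - 1. sg (n - Suc j) (br (omit j xs @ [w, xs ! j])))"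
proof -
  obtain m where m: "n = Suc m" using n by (cases n) auto
  show ?thesis unfolding cm_def m
    using assms by (simp add: m omit_append omit_Cons nth_append add.commute)
qed

end

locale pre_lie = n_ary +
  assumes left: "\<And>xs ys. length xs = n - 1 \<Longrightarrow> length ys = n \<Longrightarrow>
      br (xs @ [br ys]) = (\<Sum>i<n - 1. br (ys[i := cm n br (xs @ [ys ! i])]))
        + br (butlast ys @ [br (xs @ [last ys])])"
    and right: "\<And>xs ys. length xs = n \<Longrightarrow> length ys = n - 1 \<Longrightarrow>
      br (cm n br xs # ys) = (\<Sum>i<n. sg (n - Suc i) (br (omit i xs @ [br (xs ! i # ys)])))"
begin

text \<open>This is the statement that the commutator is an n-Lie bracket. Expand the outer
  commutator on the left by its last entry: where the inner commutator stays last, the left identity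
  applies; where it stands before a singled-out entry of \<open>xs\<close>, the right identity does.
  The leftovers of both recombine to brackets ending in
  \<open>cm n br (xs @ [ys ! i])\<close>.\<close>

lemma fundamental_identity:
  assumes xs: "length xs = n - 1" and ys: "length ys = n"
  shows "cm n br (xs @ [cm n br ys]) = (\<Sum>i<n. cm n br (ys[i := cm n br (xs @ [ys ! i])]))"
proof -
  define z where "z i = cm n br (xs @ [ys ! i])" for i
  \<comment> \<open>The summand with \<open>ys ! k\<close> singled out and \<open>ys ! i\<close>
    replaced. It occurs on both sides, summed over the pairs of distinct indices in the two possible
    orders.\<close>
  define t where "t k i = sg (n - Suc k) (br (omit k (ys[i := z i]) @ [ys ! k]))" for k i
  define b where "b i = (\<Sum>j<n - 1. sg (n - Suc j) (br (omit j xs @ [ys ! i, xs ! j])))" for i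
  have z: "z i = br (xs @ [ys ! i]) + b i" for i
    unfolding z_def b_def by (rule cm_snoc[OF xs])
  have rhs: "cm n br (ys[i := z i]) = sg (n - Suc i) (br (omit i ys @ [z i])) + (\<Sum>k\<in>{..<n} - {i}. t k i)"
    if "i < n" for i
  proof -
    have "cm n br (ys[i := z i]) = sg (n - Suc i) (br (omit i ys @ [z i])) +
       (\<Sum>k\<in>{..<n} - {i}. sg (n - Suc k) (br (omit k (ys[i := z i]) @ [ys[i := z i] ! k])))"
      unfolding cm_def
      by (subst sum.remove[of _ i]) (use that ys in \<open>simp_all add: omit_update_same\<close>)
    then show ?thesis unfolding t_def by (auto intro!: sum.cong)
  qed
  have len: "length (omit k ys) = n - 1" if "k < n" for k
    using that ys by (simp add: length_omit)
  have "br (xs @ [br (omit k ys @ [ys ! k])]) =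
      (\<Sum>i\<in>{..<n} - {k}. br (omit k (ys[i := z i]) @ [ys ! k])) + br (omit k ys @ [br (xs @ [ys ! k])])"
    if "k < n" for k
  proof -
    have "br (xs @ [br (omit k ys @ [ys ! k])]) =
      (\<Sum>i<n - 1. br ((omit k ys @ [ys ! k])[i := cm n br (xs @ [(omit k ys @ [ys ! k]) ! i])]))
       + br (omit k ys @ [br (xs @ [ys ! k])])"
      using left[OF xs, of "omit k ys @ [ys ! k]"] len[OF that] n by simp
    also have "(\<Sum>i<n - 1. br ((omit k ys @ [ys ! k])[i := cm n br (xs @ [(omit k ys @ [ys ! k]) ! i])]))
      = (\<Sum>i<n - 1. br (omit k (ys[skip k i := z (skip k i)]) @ [ys ! k]))"
      using that len[OF that] ys
      by (intro sum.cong) (auto simp: z_def list_update_append nth_append omit_update_skip nth_omit)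
    also have "\<dots> = (\<Sum>i\<in>{..<n} - {k}. br (omit k (ys[i := z i]) @ [ys ! k]))"
      by (rule sum_skip[OF that])
    finally show ?thesis .
  qed
  then have 1: "br (xs @ [cm n br ys]) =
      (\<Sum>k<n. (\<Sum>i\<in>{..<n} - {k}. t k i) + sg (n - Suc k) (br (omit k ys @ [br (xs @ [ys ! k])])))"
    unfolding cm_def t_def
    by (simp add: additive.sum[OF additive_last[OF xs]] additive_sg[OF additive_last[OF xs]]
        sg_add sg_sum)
  \<comment> \<open>The right identity wants the inner commutator in the first slot. The sign of
    this move appears on both sides of the identity and cancels.\<close>
  have shift: "br (us @ [a, c]) = sg (n - 2) (br (a # us @ [c]))" if "length us = n - 2" for us a c
    using alternating_move[OF br_additive br_alternating, of "[]" us "[c]" a] that n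
    by (simp add: sg_self)
  have 2: "br (omit j xs @ [cm n br ys, xs ! j]) =
      (\<Sum>i<n. sg (n - Suc i) (br (omit i ys @ [br (omit j xs @ [ys ! i, xs ! j])])))"
    if "j < n - 1" for j
  proof -
    have l: "length (omit j xs) = n - 2" using that xs by (simp add: length_omit)
    have "br (cm n br ys # omit j xs @ [xs ! j]) =
      (\<Sum>i<n. sg (n - Suc i) (br (omit i ys @ [br (ys ! i # omit j xs @ [xs ! j])])))"
      by (rule right) (use ys l n in auto)
    then show ?thesis
      by (auto simp: shift[OF l] sg_sum additive_sg[OF additive_last[OF len]] sg_sg add.commute
          intro!: sum.cong)
  qed
  have "(\<Sum>j<n - 1. sg (n - Suc j) (br (omit j xs @ [cm n br ys, xs ! j]))) =
     (\<Sum>j<n - 1. \<Sum>i<n. sg (n - Suc i) (br (omit i ys @ [sg (n - Suc j) (br (omit j xs @ [ys ! i, xs ! j]))])))"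
    by (auto simp: 2 sg_sum additive_sg[OF additive_last[OF len]] sg_sg add.commute
          intro!: sum.cong)
  also have "\<dots> = (\<Sum>i<n. sg (n - Suc i) (br (omit i ys @ [b i])))"
    by (subst sum.swap) (simp add: b_def additive.sum[OF additive_last[OF len]] sg_sum)
  finally have "cm n br (xs @ [cm n br ys]) =
     (\<Sum>k<n. (\<Sum>i\<in>{..<n} - {k}. t k i)) + (\<Sum>k<n. sg (n - Suc k) (br (omit k ys @ [z k])))"
    by (simp add: cm_snoc[OF xs] 1 z additive.add[OF additive_last[OF len]] sum.distrib sg_add)
  also have "(\<Sum>k<n. (\<Sum>i\<in>{..<n} - {k}. t k i)) = (\<Sum>i<n. (\<Sum>k\<in>{..<n} - {i}. t k i))"
  proof -
    have "(\<Sum>k<n. \<Sum>i\<in>{i \<in> {..<n}. i \<noteq> k}. t k i) = (\<Sum>i<n. \<Sum>k\<in>{k \<in> {..<n}. i \<noteq> k}. t k i)"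
      by (rule sum.swap_restrict) auto
    moreover have "{i \<in> {..<n}. i \<noteq> k} = {..<n} - {k}" "{i \<in> {..<n}. k \<noteq> i} = {..<n} - {k}" for k
      by auto
    ultimately show ?thesis by simp
  qed
  finally show ?thesis
    using rhs by (simp add: z_def sum.distrib add.commute)
qed

end

section \<open>The odd graph\<close>

definition subsets_of_card :: "'i set \<Rightarrow> nat \<Rightarrow> 'i set set" where
  "subsets_of_card U k = {S. S \<subseteq> U \<and> card S = k}"

text \<open>
  If \<open>card U = 2 * p - 1\<close>, the subsets of \<open>U\<close> of size \<open>p - 1\<close> are the vertices of the odd graph, and
  the sets \<open>U - S - {c}\<close> with \<open>c \<in> U - S\<close> are the neighbours of \<open>S\<close>.
\<close>

definition odd_graph_sum :: "'i set \<Rightarrow> ('i set \<Rightarrow> 'v::ab_group_add) \<Rightarrow> 'i set \<Rightarrow> 'v" where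
  "odd_graph_sum U f S = (\<Sum>c\<in>U - S. f (U - S - {c}))"

lemma finite_subsets_of_card: "finite U \<Longrightarrow> finite (subsets_of_card U k)"
  by (auto simp: subsets_of_card_def)

context
  fixes U :: "'i set" and p :: nat
  assumes finite_U: "finite U" and card_U: "card U + 1 = 2 * p" and p: "p \<ge> 1"
begin

lemma flip_in_subsets_of_card:
  assumes "S \<in> subsets_of_card U (p - 1)" "c \<in> U - S"
  shows "U - S - {c} \<in> subsets_of_card U (p - 1)"
proof -
  have "finite S" using assms finite_U by (auto simp: subsets_of_card_def intro: finite_subset)
  then have "card (U - S) = p"
    using assms card_U p by (auto simp: subsets_of_card_def card_Diff_subset)
  then show ?thesis using assms finite_U by (auto simp: subsets_of_card_def)
qed

text \<open>A walk of length two from \<open>S\<close> either exchanges some \<open>d\<close> in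
  \<open>S\<close> for some \<open>c\<close> outside or returns to \<open>S\<close>. There are
  \<open>p\<close> returns: one is the separate \<open>f S\<close>, the other \<open>p - 1\<close>
  are distributed over the elements \<open>d\<close> of \<open>S\<close> as the terms
  \<open>c = d\<close>. In this form the inner sum runs over \<open>p + 1\<close> elements, which
  later are the arguments of a commutator.\<close>

lemma odd_graph_sum_twice:
  assumes "S \<in> subsets_of_card U (p - 1)"
  shows "odd_graph_sum U (odd_graph_sum U f) S =
    f S + (\<Sum>d\<in>S. \<Sum>c\<in>insert d (U - S). f (insert c (S - {d})))"
proof -
  have S: "S \<subseteq> U" "finite S" "card S = p - 1"
    using assms finite_U by (auto simp: subsets_of_card_def intro: finite_subset)
  have "card (U - S) = p" using S card_U p by (simp add: card_Diff_subset)
  then have "U - S \<noteq> {}" using p by (metis card.empty not_one_le_zero)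
  have inner: "odd_graph_sum U f (U - S - {c}) = f S + (\<Sum>d\<in>S. f (insert c (S - {d})))"
    if "c \<in> U - S" for c
  proof -
    have *: "U - (U - S - {c}) = insert c S" using that S by auto
    show ?thesis
      unfolding odd_graph_sum_def *
    proof (subst sum.insert)
      have 1: "insert c S - {c} = S" using that by auto
      have 2: "insert c S - {d} = insert c (S - {d})" if "d \<in> S" for d
        using that \<open>c \<in> U - S\<close> by auto
      show "f (insert c S - {c}) + (\<Sum>d\<in>S. f (insert c S - {d})) = f S + (\<Sum>d\<in>S. f (insert c (S - {d})))"
        by (simp add: 1 2)
    qed (use that S in auto)
  qed
  have outer: "(\<Sum>c\<in>insert d (U - S). f (insert c (S - {d}))) = f S + (\<Sum>c\<in>U - S. f (insert c (S - {d})))"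
    if "d \<in> S" for d
  proof -
    have "insert d (S - {d}) = S" using that by auto
    then show ?thesis using that S finite_U by (subst sum.insert) auto
  qed
  have const: "(\<Sum>c\<in>U - S. f S) = f S + (\<Sum>d\<in>S. f S)"
  proof -
    obtain c where c: "c \<in> U - S" using \<open>U - S \<noteq> {}\<close> by auto
    have "card (U - S - {c}) = card S"
      using c S \<open>card (U - S) = p\<close> finite_U by simp
    then obtain h where h: "bij_betw h (U - S - {c}) S"
      using finite_same_card_bij[of "U - S - {c}" S] S finite_U by auto
    have "(\<Sum>c\<in>U - S. f S) = f S + (\<Sum>c\<in>U - S - {c}. f S)"
      using c finite_U by (intro sum.remove) auto
    also have "(\<Sum>c\<in>U - S - {c}. f S) = (\<Sum>d\<in>S. f S)"
      using sum.reindex_bij_betw[OF h, of "\<lambda>_. f S"] by simp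
    finally show ?thesis .
  qed
  have "odd_graph_sum U (odd_graph_sum U f) S =
      (\<Sum>c\<in>U - S. f S) + (\<Sum>c\<in>U - S. \<Sum>d\<in>S. f (insert c (S - {d})))"
    unfolding odd_graph_sum_def[of U "odd_graph_sum U f"] by (simp add: inner sum.distrib)
  also have "\<dots> = f S + (\<Sum>d\<in>S. f S + (\<Sum>c\<in>U - S. f (insert c (S - {d}))))"
    unfolding const sum.distrib by (subst sum.swap) (simp add: add.assoc)
  finally show ?thesis by (simp add: outer)
qed

text \<open>
  Let \<open>F I\<close> and \<open>G I\<close> be the sums of \<open>f S\<close> over all \<open>S \<supseteq> I\<close> and over all \<open>S\<close> disjoint from \<open>I\<close>. Then
  \<open>lam * F I = (p - card I) * G I\<close>, and \<open>G I = (-1) ^ card I * F I\<close> by inclusion and exclusion if \<open>F\<close> vanishes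
  on the smaller sets. So \<open>F\<close> vanishes, in particular \<open>F S = f S\<close> for \<open>card S = p - 1\<close>.
\<close>

lemma odd_graph_eigenvector_eq_0:
  fixes s :: "'k::field_char_0 \<Rightarrow> 'v::ab_group_add \<Rightarrow> 'v"
  assumes vs: "vector_space s"
    and eig: "\<And>S. S \<in> subsets_of_card U (p - 1) \<Longrightarrow> odd_graph_sum U f S = s lam (f S)"
    and lam: "\<And>i. i < p \<Longrightarrow> lam \<noteq> (- 1) ^ i * of_nat (p - i)"
    and S: "S \<in> subsets_of_card U (p - 1)"
  shows "f S = 0"
proof -
  interpret vector_space s by (rule vs)
  define X where "X = subsets_of_card U (p - 1)"
  define F where "F I = (\<Sum>S | S \<in> X \<and> I \<subseteq> S. f S)" for I
  define H where "H J I = (\<Sum>S | S \<in> X \<and> J \<subseteq> S \<and> S \<inter> I = {}. f S)" for J I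
  have finX: "finite X" using finite_U by (simp add: X_def finite_subsets_of_card)
  have H_insert: "H J (insert a I) = H J I - H (insert a J) I" if "a \<notin> I" for J I a
  proof -
    have "{S. S \<in> X \<and> J \<subseteq> S \<and> S \<inter> I = {}} = {S. S \<in> X \<and> J \<subseteq> S \<and> S \<inter> insert a I = {}}
        \<union> {S. S \<in> X \<and> insert a J \<subseteq> S \<and> S \<inter> I = {}}" by auto
    then have "H J I = H J (insert a I) + H (insert a J) I"
      unfolding H_def by (simp only:) (rule sum.union_disjoint, use finX in auto)
    then show ?thesis by simp
  qed
  have "F I = 0" if "I \<subseteq> U" "card I < p" for I
    using that
  proof (induction "card I" arbitrary: I rule: less_induct)
    case less
    have finI: "finite I" using less.prems finite_U finite_subset by blast
    \<comment> \<open>Inclusion and exclusion one element at a time: in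
      \<open>H J (insert a K) = H J K - H (insert a J) K\<close> the first term is, up to sign, the
      value of \<open>F\<close> at a proper subset of \<open>I\<close> and hence 0.\<close>
    have H_eq: "J \<union> K \<subseteq> I \<longrightarrow> J \<inter> K = {} \<longrightarrow> H J K = sg (card K) (F (J \<union> K))"
      if "finite K" for J K
      using that
    proof (induction K arbitrary: J rule: finite_induct)
      case empty
      then show ?case by (simp add: H_def F_def)
    next
      case (insert a K)
      show ?case
      proof (intro impI)
        assume J: "J \<union> insert a K \<subseteq> I" "J \<inter> insert a K = {}"
        then have "J \<union> K \<subset> I" using insert by auto
        then have "F (J \<union> K) = 0"
          using less.prems psubset_card_mono[OF finI, of "J \<union> K"]
          by (intro less.hyps) auto
        then have "H J K = 0" using insert.IH[of J] J by auto
        moreover have "H (insert a J) K = sg (card K) (F (insert a J \<union> K))"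
          using insert.IH[of "insert a J"] J insert.hyps by auto
        ultimately show "H J (insert a K) = sg (card (insert a K)) (F (J \<union> insert a K))"
          using insert.hyps by (simp add: H_insert)
      qed
    qed
    \<comment> \<open>Double counting of edges: \<open>(S, c)\<close> is exchanged with
      \<open>(U - S - {c}, c)\<close>, which turns sets containing \<open>I\<close> into sets
      disjoint from \<open>I\<close>. For the latter, \<open>p - card I\<close> choices of
      \<open>c\<close> remain outside of \<open>S\<close> and \<open>I\<close>.\<close>
    have count: "(\<Sum>S | S \<in> X \<and> I \<subseteq> S. odd_graph_sum U f S) = s (of_nat (p - card I)) (H {} I)"
    proof -
      have "(\<Sum>S | S \<in> X \<and> I \<subseteq> S. odd_graph_sum U f S) =
         (\<Sum>(S, c)\<in>(SIGMA S:{S. S \<in> X \<and> I \<subseteq> S}. U - S). f (U - S - {c}))"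
        unfolding odd_graph_sum_def by (rule sum.Sigma) (use finX finite_U in auto)
      also have "\<dots> = (\<Sum>(S, c)\<in>(SIGMA S:{S. S \<in> X \<and> {} \<subseteq> S \<and> S \<inter> I = {}}. U - S - I). f S)"
      proof -
        have flip: "U - (U - S - {c}) - {c} = S" if "S \<in> X" "c \<in> U - S" for S c
          using that by (auto simp: X_def subsets_of_card_def)
        have X: "U - S - {c} \<in> X" if "S \<in> X" "c \<in> U - S" for S c
          using that flip_in_subsets_of_card by (simp add: X_def)
        have disj: "(U - S - {c}) \<inter> I = {}" "c \<in> U - (U - S - {c}) - I"
          if "I \<subseteq> S" "c \<in> U - S" for S c using that by blast+
        have sub: "I \<subseteq> U - S - {c}" if "S \<inter> I = {}" "c \<in> U - S - I" for S c
          using that less.prems by blast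
        show ?thesis
        proof (rule sum.reindex_bij_witness[of _ "\<lambda>(S, c). (U - S - {c}, c)" "\<lambda>(S, c). (U - S - {c}, c)"], goal_cases)
          case (1 a)
          then show ?case by (cases a) (simp only: mem_Sigma_iff mem_Collect_eq prod.case flip)
        next
          case (2 a)
          then show ?case
            using X disj by (cases a) (simp only: mem_Sigma_iff mem_Collect_eq prod.case, simp)
        next
          case (3 b)
          then show ?case
            by (cases b) (simp only: mem_Sigma_iff mem_Collect_eq prod.case, simp add: flip)
        next
          case (4 b)
          then show ?case
            using X sub by (cases b) (simp only: mem_Sigma_iff mem_Collect_eq prod.case, simp)
        next
          case (5 a)
          then show ?case by (cases a) simp
        qed
      qed
      also have "\<dots> = (\<Sum>S | S \<in> X \<and> {} \<subseteq> S \<and> S \<inter> I = {}. \<Sum>c\<in>U - S - I. f S)"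
        by (rule sum.Sigma[symmetric]) (use finX finite_U in auto)
      also have "\<dots> = (\<Sum>S | S \<in> X \<and> {} \<subseteq> S \<and> S \<inter> I = {}. s (of_nat (p - card I)) (f S))"
      proof (rule sum.cong[OF refl])
        fix S assume "S \<in> {S. S \<in> X \<and> {} \<subseteq> S \<and> S \<inter> I = {}}"
        then have "S \<subseteq> U" "card S = p - 1" "S \<inter> I = {}" by (auto simp: X_def subsets_of_card_def)
        then have "card (U - (S \<union> I)) = p - card I"
          using less.prems finite_U finI card_U p finite_subset[OF \<open>S \<subseteq> U\<close>]
          by (subst card_Diff_subset) (auto simp: card_Un_disjoint)
        then show "(\<Sum>c\<in>U - S - I. f S) = s (of_nat (p - card I)) (f S)"
          by (simp add: sum_constant_scale Diff_eq Int_assoc)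
      qed
      finally show ?thesis unfolding H_def by (simp add: scale_sum_right)
    qed
    have "s lam (F I) = (\<Sum>S | S \<in> X \<and> I \<subseteq> S. odd_graph_sum U f S)"
      unfolding F_def scale_sum_right by (rule sum.cong) (auto simp: X_def eig)
    also have "\<dots> = s (of_nat (p - card I)) (sg (card I) (F I))"
      using H_eq[OF finI, of "{}"] by (simp add: count)
    finally have "s lam (F I) = s (of_nat (p - card I)) (sg (card I) (F I))" .
    then have "s (lam - (- 1) ^ card I * of_nat (p - card I)) (F I) = 0"
      by (cases "even (card I)")
         (simp_all add: sg_def scale_left_diff_distrib scale_left_distrib)
    then show ?case using lam[of "card I"] less.prems by auto
  qed
  moreover have "F S = f S"
  proof -
    have "{S'. S' \<in> X \<and> S \<subseteq> S'} = {S}"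
    proof -
      have "S' = S" if "S' \<in> X" "S \<subseteq> S'" for S'
        using that S card_subset_eq[of S' S] finite_subset[OF _ finite_U, of S']
        by (simp add: X_def subsets_of_card_def)
      then show ?thesis using S by (auto simp: X_def)
    qed
    then show ?thesis by (simp add: F_def)
  qed
  moreover have "S \<subseteq> U" "card S < p" using S p by (auto simp: subsets_of_card_def)
  ultimately show ?thesis by metis
qed

text \<open>With \<open>A\<close> the adjacency operator, the first two relations give
  \<open>A\<^sup>2 b = q - b - A q\<close>, the last two \<open>A\<^sup>2 q = q - b - A b\<close>.
  Applying \<open>A\<close> to the former and inserting the latter yields
  \<open>A (A\<^sup>2 b) = - A\<^sup>2 b\<close>. Now -1 is not an eigenvalue for odd
  \<open>p\<close>, so \<open>A\<^sup>2 b = 0\<close>, and \<open>A\<close> is injective.\<close>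

lemma odd_graph_system_eq_0:
  fixes s :: "'k::field_char_0 \<Rightarrow> 'v::ab_group_add \<Rightarrow> 'v" and b q t :: "'i set \<Rightarrow> 'v"
  assumes vs: "vector_space s" and "odd p"
    and 1: "\<And>S. S \<in> subsets_of_card U (p - 1) \<Longrightarrow> b S = q S - odd_graph_sum U t S"
    and 2: "\<And>S. S \<in> subsets_of_card U (p - 1) \<Longrightarrow> t S = q S + odd_graph_sum U b S"
    and 3: "\<And>S. S \<in> subsets_of_card U (p - 1) \<Longrightarrow>
      b S = q S - (odd_graph_sum U (odd_graph_sum U q) S - q S) - t S"
    and S: "S \<in> subsets_of_card U (p - 1)"
  shows "b S = 0"
proof -
  interpret vector_space s by (rule vs)
  define A where "A = (odd_graph_sum U :: ('i set \<Rightarrow> 'v) \<Rightarrow> _)"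
  have cong: "A f S = A g S" if "\<And>S. S \<in> subsets_of_card U (p - 1) \<Longrightarrow> f S = g S"
    "S \<in> subsets_of_card U (p - 1)" for f g :: "'i set \<Rightarrow> 'v" and S
    unfolding A_def odd_graph_sum_def using that flip_in_subsets_of_card by (intro sum.cong) auto
  have diff: "A (\<lambda>S. f S - g S) S = A f S - A g S" for f g :: "'i set \<Rightarrow> 'v" and S
    by (simp add: A_def odd_graph_sum_def sum_subtractf)
  have injective: "f S = 0" if "\<And>S. S \<in> subsets_of_card U (p - 1) \<Longrightarrow> A f S = 0"
    "S \<in> subsets_of_card U (p - 1)" for f :: "'i set \<Rightarrow> 'v" and S
  proof (rule odd_graph_eigenvector_eq_0[OF vs, where lam = 0])
    fix i assume "i < p"
    then have "of_nat (p - i) \<noteq> (0::'k)" by simp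
    then show "0 \<noteq> (- 1) ^ i * (of_nat (p - i) :: 'k)" by simp
  qed (use that in \<open>auto simp: A_def\<close>)
  have AAb: "A (A b) S = q S - b S - A q S" if "S \<in> subsets_of_card U (p - 1)" for S
  proof -
    have "A (A b) S = A (\<lambda>S. t S - q S) S" using that by (intro cong) (simp_all add: 2 A_def)
    then show ?thesis using 1[OF that] diff[of t q S] by (simp add: A_def)
  qed
  have AAAb: "A (A (A b)) S = - A (A b) S" if "S \<in> subsets_of_card U (p - 1)" for S
  proof -
    have "A (A (A b)) S = A (\<lambda>S. q S - b S - A q S) S" using that by (intro cong) (simp_all add: AAb)
    also have "\<dots> = A q S - A b S - A (A q) S"
      using diff[of "\<lambda>S. q S - b S" "A q" S] diff[of q b S] by simp
    also have "\<dots> = - A (A b) S"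
    proof -
      have "b S + (A q S + A (A b) S) = b S + (A b S + A (A q) S)"
        using 2[OF that] 3[OF that] AAb[OF that] by (simp add: A_def algebra_simps)
      then show ?thesis by (simp add: algebra_simps)
    qed
    finally show ?thesis .
  qed
  have "A (A b) S = 0" if "S \<in> subsets_of_card U (p - 1)" for S
  proof (rule odd_graph_eigenvector_eq_0[OF vs, where lam = "- 1"])
    fix i assume "i < p"
    show "- 1 \<noteq> (- 1) ^ i * (of_nat (p - i) :: 'k)"
    proof (cases "even i")
      case True
      have "of_nat (Suc (p - i)) \<noteq> (0::'k)" by (simp only: of_nat_eq_0_iff)
      then have "1 + of_nat (p - i) \<noteq> (0::'k)" by simp
      then show ?thesis using True by (metis add.right_inverse mult_1 power_minus_even power_one)
    next
      case False
      \<comment> \<open>For odd \<open>i\<close> equality would force \<open>i = p - 1\<close>,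
        which is even.\<close>
      then have "p - i \<noteq> 1" using \<open>odd p\<close> \<open>i < p\<close> by presburger
      then have "of_nat (p - i) \<noteq> (1::'k)" by (metis of_nat_1 of_nat_eq_iff)
      then show ?thesis using False by auto
    qed
  qed (use that AAAb in \<open>auto simp: A_def\<close>)
  then show ?thesis using injective S by blast
qed

end

section \<open>Representations without carriers; even arity\<close>

text \<open>An alternating function of lists becomes a function of index sets once the entries are
  put in the increasing order of their indices.\<close>

definition slist :: "(nat \<Rightarrow> 'a) \<Rightarrow> nat set \<Rightarrow> 'a list" where
  "slist z S = map z (sorted_list_of_set S)"

text \<open>The position that \<open>c\<close> takes in the sorted list, hence the exponent of the
  sign for moving it there from the front.\<close>

definition below :: "nat \<Rightarrow> nat set \<Rightarrow> nat" where
  "below c S = card {s \<in> S. s < c}"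

lemma length_slist [simp]: "length (slist z S) = card S"
  by (simp add: slist_def)

lemma sorted_list_of_set_insert_split:
  fixes c :: nat
  assumes "finite S" "c \<notin> S"
  obtains us ws where "sorted_list_of_set (insert c S) = us @ c # ws"
    "sorted_list_of_set S = us @ ws" "length us = below c S"
proof -
  define us ws where "us = sorted_list_of_set {s \<in> S. s < c}" and "ws = sorted_list_of_set {s \<in> S. c < s}"
  have fin: "finite {s \<in> S. s < c}" "finite {s \<in> S. c < s}" using assms by auto
  have us: "set us = {s \<in> S. s < c}" and ws: "set ws = {s \<in> S. c < s}"
    and sorted: "sorted us" "distinct us" "sorted ws" "distinct ws"
    using fin by (simp_all add: us_def ws_def)
  have S: "S = {s \<in> S. s < c} \<union> {s \<in> S. c < s}"
    using assms(2) by (auto simp: not_less_iff_gr_or_eq)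
  have "insert c S = set (us @ c # ws)" "S = set (us @ ws)"
    using S by (auto simp: us ws)
  moreover have "sorted (us @ c # ws)" "distinct (us @ c # ws)" "sorted (us @ ws)" "distinct (us @ ws)"
    using sorted by (auto simp: us ws sorted_append less_imp_le intro: less_imp_le order.trans)
  ultimately have "sorted_list_of_set (insert c S) = us @ c # ws" "sorted_list_of_set S = us @ ws"
    by (metis sorted_list_of_set.idem_if_sorted_distinct)+
  moreover have "length us = below c S" by (simp add: us_def below_def)
  ultimately show ?thesis using that by blast
qed

lemma slist_move:
  assumes "additive_in k f" "alternating m k f" "finite S" "c \<notin> S"
    and "length us + card S < m" "length us + card S + length ws + 1 = k"
  shows "f (us @ z c # slist z S @ ws) = sg (below c S) (f (us @ slist z (insert c S) @ ws))"
proof -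
  obtain as bs where *: "sorted_list_of_set (insert c S) = as @ c # bs"
    "sorted_list_of_set S = as @ bs" "length as = below c S"
    using sorted_list_of_set_insert_split[OF assms(3,4)] .
  have "card S = length as + length bs"
    using arg_cong[OF *(2), of length] by simp
  then show ?thesis
    using alternating_move[OF assms(1,2), of us "map z as" "map z bs @ ws" "z c"] assms(5,6) *
    by (simp add: slist_def)
qed

text \<open>Positions in the sorted list are exchanged for the elements themselves;
  \<open>below\<close> recovers the position, on which the signs depend.\<close>

lemma sum_slist:
  assumes "finite X" "card X = k"
  shows "(\<Sum>i<k. g i (slist z X ! i) (omit i (slist z X))) =
    (\<Sum>c\<in>X. g (below c X) (z c) (slist z (X - {c})))"
proof -
  define xs where "xs = sorted_list_of_set X"
  have xs: "set xs = X" "distinct xs" "length xs = k" using assms by (auto simp: xs_def)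
  have "(\<Sum>c\<in>X. g (below c X) (z c) (slist z (X - {c}))) =
      (\<Sum>i<k. g (below (xs ! i) X) (z (xs ! i)) (slist z (X - {xs ! i})))"
    using bij_betw_nth[of xs "{..<k}" X] xs
    by (intro sum.reindex_bij_betw[symmetric]) auto
  also have "\<dots> = (\<Sum>i<k. g i (slist z X ! i) (omit i (slist z X)))"
  proof (rule sum.cong[OF refl])
    fix i assume "i \<in> {..<k}"
    then have i: "i < length xs" using xs by simp
    define c where "c = xs ! i"
    have c: "c \<in> X" using i xs by (auto simp: c_def)
    obtain as bs where *: "sorted_list_of_set (insert c (X - {c})) = as @ c # bs"
      "sorted_list_of_set (X - {c}) = as @ bs" "length as = below c (X - {c})"
      using sorted_list_of_set_insert_split[of "X - {c}" c] assms by auto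
    have "below c (X - {c}) = below c X"
      unfolding below_def by (rule arg_cong[where f = card]) auto
    moreover have abs: "xs = as @ c # bs" using *(1) c by (simp add: xs_def insert_absorb)
    then have "xs ! length as = xs ! i" by (metis c_def nth_append_length)
    then have "length as = i" using xs i abs by (metis nth_eq_iff_index_eq length_append
          length_Cons less_add_Suc1 add_Suc_right)
    ultimately show "g (below (xs ! i) X) (z (xs ! i)) (slist z (X - {xs ! i})) =
        g i (slist z X ! i) (omit i (slist z X))"
      using * i by (simp add: slist_def flip: map_omit xs_def c_def)
         (simp add: c_def[symmetric] abs omit_append omit_Cons)
  qed
  finally show ?thesis ..
qed

lemma below_Un: "finite S \<Longrightarrow> finite T \<Longrightarrow> S \<inter> T = {} \<Longrightarrow> below c (S \<union> T) = below c S + below c T"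
  unfolding below_def by (subst card_Un_disjoint[symmetric]) (auto intro!: arg_cong[where f = card])

lemma below_lessThan: "c \<le> k \<Longrightarrow> below c {..<k} = c"
proof -
  assume "c \<le> k"
  then have "{s \<in> {..<k}. s < c} = {..<c}" by auto
  then show ?thesis by (simp add: below_def)
qed

text \<open>The conditions on a representation for total maps, with \<open>sg\<close> for the signs;
  \<open>rep1\<close> to \<open>rep4\<close> are the four that involve \<open>r\<close>. The scalars
  \<open>s\<close> serve the eigenvalue argument for even \<open>n\<close>.\<close>

locale pre_lie_rep = pre_lie n br for n and br :: "'a::ab_group_add list \<Rightarrow> 'a" +
  fixes s :: "'k::field_char_0 \<Rightarrow> 'v::ab_group_add \<Rightarrow> 'v"
    and l r :: "'a list \<Rightarrow> 'v \<Rightarrow> 'v"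
    and mu :: "'a list \<Rightarrow> 'v \<Rightarrow> 'v"
  assumes mu_def: "mu xs v = l xs v + (\<Sum>i<n - 1. sg (Suc i) (r (omit i xs @ [xs ! i]) v))"
    and vector_space_s: "vector_space s"
    and l_additive_in: "additive_in (n - 1) (\<lambda>xs. l xs v)"
    and r_additive_in: "additive_in (n - 1) (\<lambda>xs. r xs v)"
    and l_additive: "length xs = n - 1 \<Longrightarrow> additive (l xs)"
    and r_additive: "length xs = n - 1 \<Longrightarrow> additive (r xs)"
    and l_alternating: "alternating (n - 1) (n - 1) (\<lambda>xs. l xs v)"
    and r_alternating: "alternating (n - 2) (n - 1) (\<lambda>xs. r xs v)"
    and l_cm: "\<And>xs ys v. length xs = n \<Longrightarrow> length ys = n - 2 \<Longrightarrow>
      l (cm n br xs # ys) v = (\<Sum>i<n. sg (n - Suc i) (l (omit i xs) (l (xs ! i # ys) v)))"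
    and l_commutator: "\<And>xs ys v. length xs = n - 1 \<Longrightarrow> length ys = n - 1 \<Longrightarrow>
      l xs (l ys v) - l ys (l xs v) = (\<Sum>i<n - 1. l (ys[i := cm n br (xs @ [ys ! i])]) v)"
    and rep1: "\<And>xs ys v. length xs = n - 1 \<Longrightarrow> length ys = n - 1 \<Longrightarrow>
      l xs (r ys v) = r ys (mu xs v) + (\<Sum>i<n - 2. r (ys[i := cm n br (xs @ [ys ! i])]) v)
        + r (butlast ys @ [br (xs @ [last ys])]) v"
    and rep2: "\<And>xs ys v. length xs = n \<Longrightarrow> length ys = n - 2 \<Longrightarrow>
      r (cm n br xs # ys) v = (\<Sum>i<n. sg (n - Suc i) (l (omit i xs) (r (xs ! i # ys) v)))"
    and rep3: "\<And>xs ys v. length xs = n - 2 \<Longrightarrow> length ys = n \<Longrightarrow>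
      r (xs @ [br ys]) v = l (butlast ys) (r (xs @ [last ys]) v)
        + (\<Sum>i<n - 1. sg i (r (omit i ys) (mu (xs @ [ys ! i]) v)))"
    and rep4: "\<And>xs ys v. length xs = n - 1 \<Longrightarrow> length ys = n - 1 \<Longrightarrow>
      r ys (mu xs v) = l xs (r ys v)
        + (\<Sum>i<n - 1. sg (Suc i) (r (omit i xs @ [br (xs ! i # ys)]) v))"
begin

lemma r_snoc_additive_in: "additive_in (n - 2) (\<lambda>xs. r (xs @ [a]) v)"
  by (rule additive_inI) (use n additive_inD[OF r_additive_in, of _ "_ @ [a]"] in simp)

lemma r_snoc_alternating: "alternating (n - 2) (n - 2) (\<lambda>xs. r (xs @ [a]) v)"
proof (rule alternatingI)
  fix us vs ws :: "'a list" and b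
  assume "length us + length vs + length ws + 2 = n - 2"
  then show "r ((us @ b # vs @ b # ws) @ [a]) v = 0"
    by (intro alternatingD[OF r_alternating, of _ "length us" "length us + Suc (length vs)"])
       (use n in \<open>auto simp: nth_append\<close>)
qed simp

lemma r_last_additive: "length xs = n - 2 \<Longrightarrow> additive (\<lambda>a. r (xs @ [a]) v)"
  using n additive_inD[OF r_additive_in, of xs "[]"] by simp

lemma mu_eq_skew: "mu xs v = l xs v - skew (n - 1) (\<lambda>ys a. r (ys @ [a]) v) xs"
  by (simp add: mu_def skew_def sum_negf)

lemma mu_additive_in: "additive_in (n - 1) (\<lambda>xs. mu xs v)"
proof -
  have "additive_in (n - 1) (skew (n - 1) (\<lambda>ys a. r (ys @ [a]) v))"
    using r_snoc_additive_in r_last_additive by (intro additive_in_skew) (simp_all add: numeral_2_eq_2)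
  then show ?thesis
    unfolding mu_eq_skew by (intro additive_inI additive_diff) (auto dest: additive_inD intro: additive_inD[OF l_additive_in])
qed

lemma mu_alternating: "alternating (n - 1) (n - 1) (\<lambda>xs. mu xs v)"
proof -
  have "alternating (n - 1) (n - 1) (skew (n - 1) (\<lambda>ys a. r (ys @ [a]) v))"
    using r_snoc_additive_in r_snoc_alternating by (intro alternating_skew) (simp_all add: numeral_2_eq_2)
  then show ?thesis
    using l_alternating[of v] unfolding alternating_in_def mu_eq_skew by auto
qed

lemma mu_additive:
  assumes "length xs = n - 1" shows "additive (mu xs)"
  unfolding mu_def[abs_def]
  by (intro additive_add additive_sum_fun additive_sg_fun l_additive r_additive)
     (use assms in \<open>auto simp: length_omit\<close>)

text \<open>
  For even \<open>n\<close> the sign in \<open>rep3\<close> is opposite to the one of the semidirect product. The other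
  conditions then force both sides to vanish: fixing \<open>v\<close>, the last argument \<open>w\<close> and
  \<open>2n - 3\<close> further elements, they become linear relations between functions on the vertices of
  the odd graph, whose vertices are the sets of \<open>n - 2\<close> of these elements.
\<close>

lemma r_mu_eq_0:
  assumes "even n" and len: "length xs = n - 1" "length ys = n - 1"
  shows "r ys (mu xs v) = 0"
proof -
  define p where "p = n - 1"
  have p: "p \<ge> 1" "odd p" "p - 1 = n - 2" using n \<open>even n\<close> by (auto simp: p_def)
  define U where "U = {..<2 * p - 1}"
  have U: "finite U" "card U + 1 = 2 * p" using p by (auto simp: U_def)
  \<comment> \<open>The last slot of \<open>r\<close> is outside its alternating slots, so its entry
    is kept apart from the indexed elements.\<close>
  define w where "w = last ys"
  define z where "z i = (butlast ys @ xs) ! i" for i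
  \<comment> \<open>With the sign \<open>(-1)\<^bsup>\<Sum>S\<^esup>\<close>, moving \<open>z c\<close> from one of the two sorted lists to the other costs \<open>(-1)\<^sup>c\<close>.\<close>
  define b where "b S = sg (\<Sum>S) (r (slist z S @ [w]) (mu (slist z (U - S)) v))" for S
  define q where "q S = sg (\<Sum>S) (l (slist z (U - S)) (r (slist z S @ [w]) v))" for S
  define t where "t S = sg (\<Sum>S) (r (slist z S @ [br (slist z (U - S) @ [w])]) v)" for S
  \<comment> \<open>The sum is \<open>(p - 1) (2 p - 1)\<close>, even because \<open>p\<close> is
    odd. For \<open>p = 2 k + 1\<close> the set \<open>U\<close> has \<open>4 k + 1\<close>
    elements.\<close>
  have sumU: "even (\<Sum>U)"
  proof -
    have gauss: "2 * \<Sum>{..<Suc m} = m * Suc m" for m :: nat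
      by (induction m) simp_all
    have "even (\<Sum>{..<4 * k + 1})" for k :: nat
    proof -
      define x where "x = \<Sum>{..<Suc (4 * k)}"
      have "2 * x = 4 * k * Suc (4 * k)" unfolding x_def by (rule gauss)
      then have "x = 2 * (k * Suc (4 * k))" by simp
      then have "even x" by simp
      then show ?thesis unfolding x_def by simp
    qed
    moreover obtain k where "p = 2 * k + 1" using \<open>odd p\<close> by (elim oddE)
    ultimately show ?thesis by (simp add: U_def)
  qed
  have facts: "finite S" "finite (U - S)" "card S = n - 2" "card (U - S) = n - 1" "S \<subseteq> U"
    if "S \<in> subsets_of_card U (p - 1)" for S
    using that U p n finite_subset[of S U]
    by (auto simp: subsets_of_card_def card_Diff_subset p_def)
  \<comment> \<open>So the signs attached to \<open>S\<close> and to its neighbour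
    \<open>U - S - {c}\<close> differ by \<open>(-1)^c\<close>, which is just the cost of moving
    \<open>z c\<close> between the lists. The relations below therefore become unsigned sums over
    neighbours.\<close>
  have sum_flip: "even (\<Sum>S + c + \<Sum>(U - S - {c}))" if "S \<subseteq> U" "c \<in> U - S" for S c
  proof -
    have "\<Sum>U = \<Sum>(U - S) + \<Sum>S" using that U by (intro sum.subset_diff) auto
    also have "\<Sum>(U - S) = c + \<Sum>(U - S - {c})" using that U by (intro sum.remove) auto
    finally show ?thesis using sumU by (simp add: add_ac)
  qed
  have below_sum: "below c (U - S) + below c S = c" if "S \<subseteq> U" "c \<in> U" for S c
  proof -
    have "below c (U - S \<union> S) = below c (U - S) + below c S"
      by (rule below_Un) (use that U finite_subset in auto)
    moreover have "U - S \<union> S = U" using that by auto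
    moreover have "below c U = c" using that by (auto simp: U_def intro: below_lessThan)
    ultimately show ?thesis by simp
  qed
  have flip: "U - (U - S - {c}) = insert c S" if "S \<subseteq> U" "c \<in> U - S" for S c
    using that by auto
  \<comment> \<open>From \<open>rep4\<close>: the product there takes \<open>c\<close> out of
    \<open>U - S\<close> and joins it to \<open>S\<close>, which is the passage to the neighbour
    \<open>U - S - {c}\<close>.\<close>
  have eq1: "b S = q S - odd_graph_sum U t S" if S: "S \<in> subsets_of_card U (p - 1)" for S
  proof -
    note f = facts[OF S]
    have "(\<Sum>i<n - 1. sg (Suc i) (r (omit i (slist z (U - S)) @
          [br (slist z (U - S) ! i # slist z S @ [w])]) v)) =
        (\<Sum>c\<in>U - S. sg (Suc (below c (U - S))) (r (slist z (U - S - {c}) @ [br (z c # slist z S @ [w])]) v))"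
      by (rule sum_slist[OF f(2,4)])
    also have "sg (\<Sum>S) \<dots> = - odd_graph_sum U t S"
      unfolding odd_graph_sum_def sg_sum sum_negf[symmetric]
    proof (rule sum.cong[OF refl])
      fix c assume c: "c \<in> U - S"
      have "br (z c # slist z S @ [w]) = sg (below c S) (br (slist z (insert c S) @ [w]))"
        using slist_move[OF br_additive br_alternating f(1), of c "[]" "[w]" z] c f n by simp
      moreover have "length (slist z (U - S - {c})) = n - 2" using c f by simp
      ultimately have "sg (\<Sum>S) (sg (Suc (below c (U - S)))
            (r (slist z (U - S - {c}) @ [br (z c # slist z S @ [w])]) v)) =
          - sg (\<Sum>S + (below c (U - S) + below c S)) (r (slist z (U - S - {c}) @ [br (slist z (insert c S) @ [w])]) v)"
        by (simp add: additive_sg[OF r_last_additive] sg_minus sg_sg add_ac)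
      also have "below c (U - S) + below c S = c" using c f below_sum by blast
      also have "sg (\<Sum>S + c) (r (slist z (U - S - {c}) @ [br (slist z (insert c S) @ [w])]) v) = t (U - S - {c})"
        unfolding t_def flip[OF f(5) c] by (rule sg_cong[OF sum_flip[OF f(5) c]])
      finally show "sg (\<Sum>S) (sg (Suc (below c (U - S)))
            (r (slist z (U - S - {c}) @ [br (z c # slist z S @ [w])]) v)) = - t (U - S - {c})" .
    qed
    finally show ?thesis
      using rep4[of "slist z (U - S)" "slist z S @ [w]" v] f n
      by (simp add: b_def q_def sg_add Suc_diff_le numeral_2_eq_2)
  qed
  \<comment> \<open>From \<open>rep3\<close> with its sign \<open>(-1)^i\<close>. Bringing
    \<open>z c\<close> to the front inside \<open>mu\<close> passes \<open>n - 2\<close> entries and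
    is free of sign, as \<open>n\<close> is even.\<close>
  have eq2: "t S = q S + odd_graph_sum U b S" if S: "S \<in> subsets_of_card U (p - 1)" for S
  proof -
    note f = facts[OF S]
    have "(\<Sum>i<n - 1. sg i (r (omit i (slist z (U - S)) @ [w]) (mu (slist z S @ [slist z (U - S) ! i]) v))) =
        (\<Sum>c\<in>U - S. sg (below c (U - S)) (r (slist z (U - S - {c}) @ [w]) (mu (slist z S @ [z c]) v)))"
      by (rule sum_slist[OF f(2,4)])
    also have "sg (\<Sum>S) \<dots> = odd_graph_sum U b S"
      unfolding odd_graph_sum_def sg_sum
    proof (rule sum.cong[OF refl])
      fix c assume c: "c \<in> U - S"
      have "mu (slist z S @ [z c]) v = sg (card S) (mu (z c # slist z S) v)"
        using alternating_move[OF mu_additive_in mu_alternating, of "[]" "slist z S" "[]" "z c" v] f n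
        by (simp add: sg_self)
      also have "\<dots> = mu (z c # slist z S) v"
        using f \<open>even n\<close> by (simp add: sg_def)
      also have "\<dots> = sg (below c S) (mu (slist z (insert c S)) v)"
        using slist_move[OF mu_additive_in mu_alternating f(1), of c "[]" "[]" z v] c f n by simp
      finally have "sg (\<Sum>S) (sg (below c (U - S)) (r (slist z (U - S - {c}) @ [w]) (mu (slist z S @ [z c]) v))) =
          sg (\<Sum>S + (below c (U - S) + below c S)) (r (slist z (U - S - {c}) @ [w]) (mu (slist z (insert c S)) v))"
        using c f n by (simp add: additive_sg[OF r_additive] sg_sg add_ac)
      also have "below c (U - S) + below c S = c" using c f below_sum by blast
      also have "sg (\<Sum>S + c) (r (slist z (U - S - {c}) @ [w]) (mu (slist z (insert c S)) v)) = b (U - S - {c})"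
        unfolding b_def flip[OF f(5) c] by (rule sg_cong[OF sum_flip[OF f(5) c]])
      finally show "sg (\<Sum>S) (sg (below c (U - S)) (r (slist z (U - S - {c}) @ [w]) (mu (slist z S @ [z c]) v)))
          = b (U - S - {c})" .
    qed
    also have "(\<Sum>i<n - 1. sg i (r (omit i (slist z (U - S)) @ [w]) (mu (slist z S @ [slist z (U - S) ! i]) v))) =
      (\<Sum>i<n - 1. sg i (r (omit i (slist z (U - S) @ [w])) (mu (slist z S @ [(slist z (U - S) @ [w]) ! i]) v)))"
      using f by (intro sum.cong) (auto simp: omit_append nth_append)
    finally show ?thesis
      using rep3[of "slist z S" "slist z (U - S) @ [w]" v] f n
      by (simp add: t_def q_def sg_add Suc_diff_le)
  qed
  \<comment> \<open>From \<open>rep1\<close>, with every commutator inside \<open>r\<close> expanded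
    by \<open>rep2\<close>. The commutator that replaces \<open>z d\<close> has the \<open>n\<close>
    elements of \<open>D d\<close> as arguments, and its expansion at \<open>c\<close> is the value
    of \<open>q\<close> at \<open>S\<close> with \<open>d\<close> exchanged for \<open>c\<close>.
    The result is the double sum of \<open>odd_graph_sum_twice\<close>.\<close>
  have eq3: "b S = q S - (odd_graph_sum U (odd_graph_sum U q) S - q S) - t S"
    if S: "S \<in> subsets_of_card U (p - 1)" for S
  proof -
    note f = facts[OF S]
    define D where "D d = U - (S - {d})" for d
    have D: "D d = insert d (U - S)" "finite (D d)" "card (D d) = n" if "d \<in> S" for d
    proof -
      show *: "D d = insert d (U - S)" using that f by (auto simp: D_def)
      show "finite (D d)" "card (D d) = n" unfolding * using that f n by auto
    qed
    define g where "g i d L = sg i (r (cm n br (slist z (U - S) @ [d]) # L @ [w]) v)" for i d L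
    have "(\<Sum>i<n - 2. r ((slist z S @ [w])[i := cm n br (slist z (U - S) @ [(slist z S @ [w]) ! i])]) v)
        = (\<Sum>i<n - 2. g i (slist z S ! i) (omit i (slist z S)))"
    proof (rule sum.cong[OF refl])
      fix i assume "i \<in> {..<n - 2}"
      then have i: "i < card S" using f by simp
      let ?y = "cm n br (slist z (U - S) @ [slist z S ! i])"
      have "(slist z S @ [w])[i := ?y] = take i (slist z S) @ ?y # drop (Suc i) (slist z S) @ [w]"
        using i by (simp add: list_update_append upd_conv_take_nth_drop)
      moreover have "r (take i (slist z S) @ ?y # drop (Suc i) (slist z S) @ [w]) v =
          sg i (r (?y # omit i (slist z S) @ [w]) v)"
        using alternating_move[OF r_additive_in r_alternating, of "[]" "take i (slist z S)" "drop (Suc i) (slist z S) @ [w]" ?y v]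
          i f n by (simp add: sg_self omit_def)
      ultimately show "r ((slist z S @ [w])[i := cm n br (slist z (U - S) @ [(slist z S @ [w]) ! i])]) v
          = g i (slist z S ! i) (omit i (slist z S))"
        using i by (simp add: g_def nth_append)
    qed
    also have "\<dots> = (\<Sum>d\<in>S. g (below d S) (z d) (slist z (S - {d})))"
      by (rule sum_slist[OF f(1,3)])
    also have "sg (\<Sum>S) \<dots> = (\<Sum>d\<in>S. \<Sum>c\<in>insert d (U - S). q (insert c (S - {d})))"
      unfolding sg_sum
    proof (rule sum.cong[OF refl])
      fix d assume d: "d \<in> S"
      have dU: "d \<in> U" using d f by auto
      have n3: "n \<ge> 3" using d f card_gt_0_iff[of S] by (cases "card S") auto
      have 1: "cm n br (slist z (U - S) @ [z d]) = sg (n - 1 + below d (U - S)) (cm n br (slist z (D d)))"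
      proof -
        have "cm n br (slist z (U - S) @ [z d]) = sg (n - 1) (cm n br (z d # slist z (U - S)))"
          using alternating_move[OF cm_additive cm_alternating, of "[]" "slist z (U - S)" "[]" "z d"] f n
          by (simp add: sg_self)
        also have "cm n br (z d # slist z (U - S)) = sg (below d (U - S)) (cm n br (slist z (D d)))"
          using slist_move[OF cm_additive cm_alternating f(2), of d "[]" "[]" z] d f n by (simp add: D)
        finally show ?thesis by (simp add: sg_sg)
      qed
      have "r (cm n br (slist z (D d)) # slist z (S - {d}) @ [w]) v =
          (\<Sum>i<n. sg (n - Suc i) (l (omit i (slist z (D d))) (r (slist z (D d) ! i # slist z (S - {d}) @ [w]) v)))"
        by (rule rep2) (use d f n3 D in auto)
      also have "\<dots> = (\<Sum>c\<in>D d. sg (n - Suc (below c (D d)))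
          (l (slist z (D d - {c})) (r (z c # slist z (S - {d}) @ [w]) v)))"
        by (rule sum_slist[OF D(2,3)[OF d]])
      also have "sg (\<Sum>S + below d S + (n - 1) + below d (U - S)) \<dots> = (\<Sum>c\<in>D d. q (insert c (S - {d})))"
        unfolding sg_sum
      proof (rule sum.cong[OF refl])
        fix c assume c: "c \<in> D d"
        have cU: "c \<in> U" "c \<notin> S - {d}" using c by (auto simp: D_def)
        have "below c (D d) < n"
          using c D[OF d] unfolding below_def by (metis (no_types, lifting) mem_Collect_eq less_irrefl psubset_card_mono psubsetI subsetI)
        have 2: "r (z c # slist z (S - {d}) @ [w]) v = sg (below c (S - {d})) (r (slist z (insert c (S - {d})) @ [w]) v)"
          using slist_move[OF r_additive_in r_alternating, of "S - {d}" c "[]" "[w]" z v] cU f d n3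
          by simp
        have Dc: "D d - {c} = U - insert c (S - {d})" by (auto simp: D_def)
        have len: "length (slist z (D d - {c})) = n - 1" using D[OF d] c by simp
        have S': "\<Sum>(insert c (S - {d})) + d = \<Sum>S + c"
          using cU f d sum.remove[of S d "\<lambda>x. x"] by simp
        have b1: "below d (U - S) + below d S = d" using below_sum[OF f(5) dU] .
        have b2: "below c (D d) + below c (S - {d}) = c"
          unfolding D_def using f(5) cU by (intro below_sum) auto
        \<comment> \<open>The term \<open>n - 1\<close> from moving \<open>z d\<close> to the front
          of the commutator is matched by the \<open>n - 1\<close> in the exponent of
          \<open>rep2\<close>; the remaining exponents pair up by \<open>S'\<close>,
          \<open>b1\<close> and \<open>b2\<close>.\<close>
        have parity: "even (\<Sum>S + below d S + (n - 1) + below d (U - S) + (n - Suc (below c (D d)) + below c (S - {d}))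
            + \<Sum>(insert c (S - {d})))"
          using S' b1 b2 \<open>below c (D d) < n\<close> by presburger
        show "sg (\<Sum>S + below d S + (n - 1) + below d (U - S)) (sg (n - Suc (below c (D d)))
          (l (slist z (D d - {c})) (r (z c # slist z (S - {d}) @ [w]) v))) = q (insert c (S - {d}))"
          unfolding 2 additive_sg[OF l_additive[OF len]] sg_sg q_def Dc[symmetric] by (rule sg_cong[OF parity])
      qed
      finally have 3: "sg (\<Sum>S + below d S + (n - 1) + below d (U - S))
          (r (cm n br (slist z (D d)) # slist z (S - {d}) @ [w]) v) = (\<Sum>c\<in>D d. q (insert c (S - {d})))" .
      show "sg (\<Sum>S) (g (below d S) (z d) (slist z (S - {d}))) =
          (\<Sum>c\<in>insert d (U - S). q (insert c (S - {d})))"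
      proof -
        have len: "length (slist z (S - {d}) @ [w]) = n - 2"
          using d f n3 by simp
        have "g (below d S) (z d) (slist z (S - {d})) = sg (below d S) (sg (n - 1 + below d (U - S))
            (r (cm n br (slist z (D d)) # slist z (S - {d}) @ [w]) v))"
          using additive_sg[OF additive_inD[OF r_additive_in, of "[]" "slist z (S - {d}) @ [w]"]] len n
          by (simp add: g_def 1)
        then show ?thesis using 3 d by (simp add: sg_sg add_ac D)
      qed
    qed
    finally have *: "sg (\<Sum>S) (\<Sum>i<n - 2. r ((slist z S @ [w])[i := cm n br (slist z (U - S) @ [(slist z S @ [w]) ! i])]) v)
        = odd_graph_sum U (odd_graph_sum U q) S - q S"
      using odd_graph_sum_twice[OF U p(1) S, of q] by simp
    have "sg (\<Sum>S) (l (slist z (U - S)) (r (slist z S @ [w]) v)) =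
        sg (\<Sum>S) (r (slist z S @ [w]) (mu (slist z (U - S)) v)) +
        sg (\<Sum>S) (\<Sum>i<n - 2. r ((slist z S @ [w])[i := cm n br (slist z (U - S) @ [(slist z S @ [w]) ! i])]) v) +
        sg (\<Sum>S) (r (slist z S @ [br (slist z (U - S) @ [w])]) v)"
      using rep1[of "slist z (U - S)" "slist z S @ [w]" v] f n by (simp add: sg_add)
    then show ?thesis unfolding * by (simp add: b_def q_def t_def algebra_simps)
  qed
  \<comment> \<open>At the set of the first \<open>n - 2\<close> indices the sorted lists are
    \<open>butlast ys\<close> and \<open>xs\<close>, so that \<open>b\<close> is the claimed value
    up to sign.\<close>
  have S: "{..<n - 2} \<in> subsets_of_card U (p - 1)"
    by (auto simp: subsets_of_card_def U_def p_def)
  have "b {..<n - 2} = 0"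
    by (rule odd_graph_system_eq_0[OF U p(1) vector_space_s p(2) eq1 eq2 eq3 S])
  moreover have "slist z {..<n - 2} = butlast ys"
    by (rule nth_equalityI)
       (use len in \<open>auto simp: slist_def z_def nth_append lessThan_atLeast0\<close>)
  moreover have "slist z (U - {..<n - 2}) = xs"
  proof -
    have "U - {..<n - 2} = {n - 2..<2 * p - 1}" by (auto simp: U_def)
    then have "slist z (U - {..<n - 2}) = map z [n - 2..<2 * p - 1]" by (simp add: slist_def)
    moreover have "z (n - 2 + i) = xs ! i" for i
      using len by (simp add: z_def nth_append numeral_2_eq_2)
    ultimately show ?thesis
      by (intro nth_equalityI) (use len n in \<open>auto simp: p_def\<close>)
  qed
  moreover have "ys = butlast ys @ [w]" using len n by (cases ys rule: rev_cases) (auto simp: w_def)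
  ultimately show ?thesis by (simp add: b_def)
qed

text \<open>The form that the semidirect product requires. For even \<open>n\<close> every value of
  \<open>r\<close> after \<open>mu\<close> vanishes, so either sign is right; for odd
  \<open>n\<close> the exponents \<open>i\<close> and \<open>n - 1 + i\<close> have equal
  parity.\<close>

lemma rep3':
  assumes "length xs = n - 2" "length ys = n"
  shows "r (xs @ [br ys]) v = l (butlast ys) (r (xs @ [last ys]) v)
        + (\<Sum>i<n - 1. sg (n - 1 + i) (r (omit i ys) (mu (xs @ [ys ! i]) v)))"
proof (cases "even n")
  case True
  have "r (omit i ys) (mu (xs @ [ys ! i]) v) = 0" if "i < n - 1" for i
    by (rule r_mu_eq_0[OF True]) (use that assms n in \<open>auto simp: length_omit\<close>)
  then show ?thesis by (simp add: rep3[OF assms])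
next
  case False
  have "sg (n - 1 + i) x = sg i x" for i and x :: 'v by (rule sg_cong) (use False in auto)
  then show ?thesis by (simp only: rep3[OF assms])
qed

end

section \<open>The semidirect product\<close>

lemma additive_in_zero:
  assumes "additive_in k f" "length xs = k" "0 \<in> set xs"
  shows "f xs = 0"
proof -
  obtain us ws where "xs = us @ 0 # ws" using split_list[OF assms(3)] by blast
  then show ?thesis using additive.zero[OF additive_inD[OF assms(1), of us ws]] assms(2) by simp
qed

lemma additive_in_map_fst:
  assumes "additive_in k f"
  shows "additive_in k (\<lambda>zs. f (map fst zs))"
  by (rule additive_inI) (use additive_inD[OF assms] in \<open>simp add: additive_def\<close>)

lemma alternating_map_fst:
  fixes f :: "'a list \<Rightarrow> 'b::ab_group_add"
  assumes "alternating m k f" "m \<le> k"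
  shows "alternating m k (\<lambda>zs :: ('a \<times> 'c) list. f (map fst zs))"
proof (rule alternatingI)
  fix us vs ws :: "('a \<times> 'c) list" and a
  assume "length us + length vs + 2 \<le> m" "length us + length vs + length ws + 2 = k"
  then show "f (map fst (us @ a # vs @ a # ws)) = 0"
    by (intro alternatingD[OF assms(1), of _ "length us" "Suc (length us + length vs)"])
       (auto simp: nth_append)
qed (rule assms)

section \<open>Homogeneous elements of the direct sum\<close>

definition embed :: "'a \<Rightarrow> 'a \<times> 'v::zero" where
  "embed a = (a, 0)"

definition pure :: "'a::zero \<times> 'v::zero \<Rightarrow> bool" where
  "pure z \<longleftrightarrow> fst z = 0 \<or> snd z = 0"

text \<open>For a list of pure elements, the number of entries from the second factor (or zero).\<close>

definition vdeg :: "('a::zero \<times> 'v) list \<Rightarrow> nat" where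
  "vdeg zs = length (filter (\<lambda>z. fst z = 0) zs)"

lemma fst_embed [simp]: "fst (embed a) = a" and snd_embed [simp]: "snd (embed a) = 0"
  by (simp_all add: embed_def)

lemma map_fst_embed [simp]: "map (fst \<circ> embed) xs = xs"
  by (induction xs) auto

lemma vdeg_simps [simp]:
  "vdeg [] = 0" "vdeg (z # zs) = (if fst z = 0 then 1 else 0) + vdeg zs"
  "vdeg (us @ ws) = vdeg us + vdeg ws"
  by (simp_all add: vdeg_def)

lemma vdeg_omit: "i < length zs \<Longrightarrow> vdeg (omit i zs) + vdeg [zs ! i] = vdeg zs"
  using arg_cong[OF id_take_nth_drop[of i zs], of vdeg] by (simp add: omit_def)

lemma vdeg_pos: "vdeg zs \<ge> 1 \<Longrightarrow> 0 \<in> set (map fst zs)"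
  by (induction zs) (auto split: if_splits)

lemma vdeg_eq_0:
  assumes "list_all pure zs" "vdeg zs = 0"
  shows "zs = map embed (map fst zs)"
  using assms by (induction zs) (auto simp: pure_def embed_def split: if_splits)

lemma vdeg_eq_1:
  assumes "list_all pure zs" "vdeg zs = 1"
  obtains us v ws where "zs = map embed us @ (0, v) # map embed ws"
proof -
  have "\<exists>us v ws. zs = map embed us @ (0, v) # map embed ws"
    using assms
  proof (induction zs)
    case (Cons z zs)
    show ?case
    proof (cases "fst z = 0")
      case True
      then have "zs = map embed (map fst zs)" using Cons.prems by (intro vdeg_eq_0) auto
      then have "z # zs = map embed [] @ (0, snd z) # map embed (map fst zs)"
        using True by (simp add: prod_eq_iff)
      then show ?thesis by blast
    next
      case False
      then obtain us v ws where "zs = map embed us @ (0, v) # map embed ws"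
        using Cons by auto
      moreover have "z = embed (fst z)" using False Cons.prems by (auto simp: pure_def embed_def prod_eq_iff)
      ultimately have "z # zs = map embed (fst z # us) @ (0, v) # map embed ws" by simp
      then show ?thesis by blast
    qed
  qed simp
  then show ?thesis using that by blast
qed

text \<open>Each entry is the sum of its two components. Splitting the entries from left to right,
  with \<open>us\<close> the part already pure, additivity reduces everything to pure lists.\<close>

lemma additive_in_eq_0_of_pure:
  fixes f :: "('a::ab_group_add \<times> 'v::ab_group_add) list \<Rightarrow> 'b::ab_group_add"
  assumes add: "additive_in k f"
    and pure: "\<And>zs. length zs = k \<Longrightarrow> list_all pure zs \<Longrightarrow> f zs = 0"
    and "length zs = k"
  shows "f zs = 0"
proof -
  have "f (us @ ws) = 0" if "list_all pure us" "length us + length ws = k" for us ws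
    using that
  proof (induction ws arbitrary: us)
    case Nil
    then show ?case using pure[of us] by simp
  next
    case (Cons z ws)
    have "f (us @ (embed (fst z) + (0, snd z)) # ws) = f (us @ embed (fst z) # ws) + f (us @ (0, snd z) # ws)"
      by (rule additive.add[OF additive_inD[OF add]]) (use Cons.prems in simp)
    also have "\<dots> = 0"
      using Cons.IH[of "us @ [embed (fst z)]"] Cons.IH[of "us @ [(0, snd z)]"] Cons.prems
      by (simp add: pure_def)
    also have "embed (fst z) + (0, snd z) = z" by (simp add: embed_def)
    finally show ?case .
  qed
  from this[of "[]" zs] show ?thesis using assms(3) by simp
qed

section \<open>The semidirect bracket, its commutator and their degrees\<close>

context pre_lie_rep
begin

text \<open>The sign \<open>(-1)^i\<close> is the cost of moving an element of \<open>V\<close> from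
  position \<open>i\<close> to the front, where \<open>r\<close> acts on it without sign; in the
  last slot \<open>l\<close> acts instead.\<close>

definition sd :: "('a \<times> 'v) list \<Rightarrow> 'a \<times> 'v" where
  "sd zs = (br (map fst zs), l (map fst (butlast zs)) (snd (last zs))
     + (\<Sum>i<n - 1. sg i (r (map fst (omit i zs)) (snd (zs ! i)))))"

lemma fst_sd: "fst (sd zs) = br (map fst zs)"
  by (simp add: sd_def)

text \<open>Fixing the last entry exhibits the sum over \<open>r\<close> as a \<open>skew\<close>
  sum in the alternating slots.\<close>

lemma snd_sd_snoc:
  assumes "length zs = n - 1"
  shows "snd (sd (zs @ [z])) = l (map fst zs) (snd z)
    + skew (n - 1) (\<lambda>L a. r (map fst L @ [fst z]) (snd a)) zs"
  unfolding sd_def skew_def using assms by (auto simp: omit_append nth_append intro!: sum.cong)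

lemma sd_skew_additive:
  "additive_in (n - 2) (\<lambda>L. r (map fst L @ [fst z]) v)"
  "length L = n - 2 \<Longrightarrow> additive (\<lambda>a. r (map fst L @ [fst z]) (snd a))"
  "alternating (n - 2) (n - 2) (\<lambda>L. r (map fst L @ [fst z]) v)"
proof -
  show "additive (\<lambda>a. r (map fst L @ [fst z]) (snd a))" if "length L = n - 2"
    using r_additive[of "map fst L @ [fst z]"] that n by (simp add: additive_def Suc_diff_le)
qed (use additive_in_map_fst[OF r_snoc_additive_in] alternating_map_fst[OF r_snoc_alternating] in auto)

lemma sd_additive_in: "additive_in n sd"
proof (rule additive_inI)
  fix us ws :: "('a \<times> 'v) list" assume len: "Suc (length us + length ws) = n"
  have 1: "additive (\<lambda>x. br (map fst us @ fst x # map fst ws))"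
    using additive_inD[OF br_additive, of "map fst us" "map fst ws"] len by (simp add: additive_def)
  have 2: "additive (\<lambda>x. snd (sd (us @ x # ws)))"
  proof (cases ws rule: rev_cases)
    case Nil
    then have us: "length us = n - 1" using len by simp
    have "additive (\<lambda>x. r (map fst (omit i us) @ [fst x]) (snd (us ! i)))" if "i < n - 1" for i
      using r_last_additive[of "map fst (omit i us)"] that us by (simp add: length_omit additive_def numeral_2_eq_2)
    moreover have "additive (\<lambda>x. l (map fst us) (snd x))"
      using l_additive[of "map fst us"] us by (simp add: additive_def)
    ultimately show ?thesis
      unfolding Nil snd_sd_snoc[OF us] skew_def
      by (intro additive_add additive_sum_fun additive_sg_fun) auto
  next
    case (snoc ws' z)
    then have *: "length (us @ x # ws') = n - 1" for x using len by simp
    have "additive_in (n - 1) (skew (n - 1) (\<lambda>L a. r (map fst L @ [fst z]) (snd a)))"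
      using sd_skew_additive by (intro additive_in_skew) (simp_all add: numeral_2_eq_2)
    from additive_inD[OF this, of us ws'] additive_inD[OF additive_in_map_fst[OF l_additive_in], of us ws' "snd z"]
    show ?thesis
      using snd_sd_snoc[OF *] * unfolding snoc by (simp add: additive_add)
  qed
  show "additive (\<lambda>x. sd (us @ x # ws))"
    using 1 2 by (simp add: additive_def prod_eq_iff fst_sd)
qed

lemma sd_alternating: "alternating (n - 1) n sd"
proof (rule alternatingI)
  fix us vs ws :: "('a \<times> 'v) list" and a
  assume len: "length us + length vs + 2 \<le> n - 1" "length us + length vs + length ws + 2 = n"
  then obtain ws' z where ws: "ws = ws' @ [z]" by (cases ws rule: rev_cases) auto
  define L where "L = us @ a # vs @ a # ws'"
  have L: "length L = n - 1" using len ws by (simp add: L_def)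
  have ij: "L ! length us = a" "L ! Suc (length us + length vs) = a"
    by (auto simp: L_def nth_append)
  have "br (map fst (L @ [z])) = 0"
    by (rule alternatingD[OF br_alternating, of _ "length us" "Suc (length us + length vs)"])
       (use L ij len n in \<open>auto simp: nth_append\<close>)
  moreover have "l (map fst L) (snd z) = 0"
    by (rule alternatingD[OF l_alternating, of _ "length us" "Suc (length us + length vs)"])
       (use L ij len n in \<open>auto simp: nth_append\<close>)
  moreover have "alternating (n - 1) (n - 1) (skew (n - 1) (\<lambda>L a. r (map fst L @ [fst z]) (snd a)))"
    using sd_skew_additive by (intro alternating_skew) (simp_all add: numeral_2_eq_2)
  then have "skew (n - 1) (\<lambda>L a. r (map fst L @ [fst z]) (snd a)) L = 0"
    by (rule alternatingD[of _ _ _ _ "length us" "Suc (length us + length vs)"])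
       (use L ij len n in auto)
  ultimately have "sd (L @ [z]) = 0"
    using L by (simp add: prod_eq_iff fst_sd snd_sd_snoc)
  then show "sd (us @ a # vs @ a # ws) = 0" by (simp add: L_def ws)
qed simp

sublocale sd: n_ary n sd
  by unfold_locales (use n sd_additive_in sd_alternating in auto)

abbreviation csd :: "('a \<times> 'v) list \<Rightarrow> 'a \<times> 'v" where "csd \<equiv> cm n sd"

lemma fst_csd: "length zs = n \<Longrightarrow> fst (csd zs) = cm n br (map fst zs)"
  unfolding cm_def by (simp add: fst_sum fst_sg fst_sd map_omit)

lemma l_0: "length xs = n - 1 \<Longrightarrow> l xs 0 = 0"
  by (rule additive.zero[OF l_additive])

lemma r_0: "length xs = n - 1 \<Longrightarrow> r xs 0 = 0"
  by (rule additive.zero[OF r_additive])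

lemma sd_embed:
  assumes "length xs = n" shows "sd (map embed xs) = embed (br xs)"
proof -
  have "xs \<noteq> []" using assms n by auto
  then have "snd (last (map embed xs) :: 'a \<times> 'v) = 0" by (simp add: last_map)
  then show ?thesis
    using assms n
    by (auto simp: sd_def prod_eq_iff l_0 r_0 map_omit length_omit intro!: sum.neutral)
qed

lemma sd_last:
  assumes "length xs = n - 1" shows "sd (map embed xs @ [(0, v)]) = (0, l xs v)"
proof -
  have len: "length (map embed xs :: ('a \<times> 'v) list) = n - 1" using assms by simp
  have "r (map fst (omit i (map embed xs :: ('a \<times> 'v) list)) @ [0]) (snd (map embed xs ! i :: 'a \<times> 'v)) = 0"
    if "i < n - 1" for i
    using that assms n by (simp add: r_0 length_omit)
  then have "skew (n - 1) (\<lambda>L a. r (map fst L @ [0]) (snd a)) (map embed xs :: ('a \<times> 'v) list) = 0"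
    by (simp add: skew_def)
  then show ?thesis
    using additive.zero[OF additive_last[OF assms]] by (simp add: prod_eq_iff fst_sd snd_sd_snoc[OF len])
qed

lemma sd_first:
  assumes "length xs = n - 1" shows "sd ((0, v) # map embed xs) = (0, r xs v)"
proof -
  define m where "m = n - 2"
  have m: "n = Suc (Suc m)" using n by (simp add: m_def)
  obtain ys y where xs: "xs = ys @ [y]" using assms m by (cases xs rule: rev_cases) simp_all
  have nm: "n - 1 = Suc m" and ys: "length ys = m" using m assms xs by simp_all
  have len: "length (((0, v) # map embed ys) :: ('a \<times> 'v) list) = n - 1" using assms xs m by simp
  have "r (map fst (omit (Suc i) ((0, v) # map embed ys)) @ [y]) (snd (((0, v) # map embed ys) ! Suc i)) = 0"
    if "i < m" for i
    using that assms xs m by (simp add: omit_Cons r_0 length_omit)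
  then have "snd (sd (((0, v) # map embed ys) @ [embed y])) = r xs v"
    unfolding snd_sd_snoc[OF len] skew_def nm sum.lessThan_Suc_shift
    using ys l_0[of "0 # ys"] nm by (simp add: omit_Cons xs del: sum.lessThan_Suc)
  then show ?thesis
    using additive.zero[OF additive_first[OF assms]] by (simp add: prod_eq_iff fst_sd xs)
qed

lemma sd_mid:
  assumes "length us + length ws = n - 1" "ws \<noteq> []"
  shows "sd (map embed us @ (0, v) # map embed ws) = (0, sg (length us) (r (us @ ws) v))"
proof -
  have "sd ([] @ (0, v) # map embed us @ map embed ws) =
      sg (length (map embed us :: ('a \<times> 'v) list)) (sd ([] @ map embed us @ (0, v) # map embed ws))"
    by (rule alternating_move[OF sd_additive_in sd_alternating])
       (use assms n in \<open>auto simp: neq_Nil_conv\<close>)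
  then have "sd (map embed us @ (0, v) # map embed ws) = sg (length us) (sd ((0, v) # map embed (us @ ws)))"
    by (simp add: sg_self)
  then show ?thesis using sd_first[of "us @ ws" v] assms by (simp add: prod_eq_iff fst_sg snd_sg)
qed

lemma csd_embed:
  assumes "length xs = n" shows "csd (map embed xs) = embed (cm n br xs)"
proof -
  have "sd (omit i (map embed xs) @ [map embed xs ! i]) = embed (br (omit i xs @ [xs ! i]))" if "i < n" for i
    using sd_embed[of "omit i xs @ [xs ! i]"] that assms by (simp add: map_omit length_omit)
  then show ?thesis by (auto simp: cm_def prod_eq_iff fst_sum snd_sum fst_sg snd_sg)
qed

text \<open>This is the origin of \<open>mu\<close>. The summand singling out \<open>(0, v)\<close>
  gives \<open>l\<close>. In the others \<open>v\<close> stands at position \<open>n - 2\<close>,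
  and the exponents \<open>n - 1 - j\<close> and \<open>n - 2\<close> add up to the parity of
  \<open>j + 1\<close>.\<close>

lemma csd_last:
  assumes "length xs = n - 1" shows "csd (map embed xs @ [(0, v)]) = (0, mu xs v)"
proof -
  have "sg (n - Suc j) (sd (omit j (map embed xs) @ [(0, v), map embed xs ! j])) =
      (0, sg (Suc j) (r (omit j xs @ [xs ! j]) v))" if "j < n - 1" for j
  proof -
    have "sd (map embed (omit j xs) @ (0, v) # map embed [xs ! j]) = (0, sg (n - 2) (r (omit j xs @ [xs ! j]) v))"
      using that assms sd_mid[of "omit j xs" "[xs ! j]" v] n by (simp add: length_omit numeral_2_eq_2)
    moreover have "sg (n - Suc j) (sg (n - 2) y) = sg (Suc j) y" for y :: 'v
      unfolding sg_sg by (rule sg_cong) (use that n in presburger)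
    ultimately show ?thesis using that assms by (simp add: map_omit prod_eq_iff fst_sg snd_sg del: sg_Suc)
  qed
  then show ?thesis
    using sd.cm_snoc[of "map embed xs" "(0, v)"] assms
    by (simp add: sd_last mu_def prod_eq_iff fst_sum snd_sum del: sg_Suc)
qed

lemma csd_mid:
  assumes "length us + length ws = n - 1"
  shows "csd (map embed us @ (0, v) # map embed ws) = (0, sg (length ws) (mu (us @ ws) v))"
proof -
  have "csd (map embed us @ (0, v) # map embed ws @ []) =
      sg (length (map embed ws :: ('a \<times> 'v) list)) (csd (map embed us @ map embed ws @ [(0, v)]))"
    by (rule alternating_move[OF sd.cm_additive sd.cm_alternating]) (use assms n in auto)
  then show ?thesis using csd_last[of "us @ ws" v] assms by (simp add: prod_eq_iff fst_sg snd_sg)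
qed

text \<open>The two degree rules that dispose of all nested products with at least two entries from
  \<open>V\<close>. A zero entry counts as well, so that the vanishing of a first component alone
  decides.\<close>

definition graded :: "(('a \<times> 'v) list \<Rightarrow> 'a \<times> 'v) \<Rightarrow> bool" where
  "graded f \<longleftrightarrow> (\<forall>zs. length zs = n \<longrightarrow>
     (vdeg zs \<ge> 1 \<longrightarrow> fst (f zs) = 0) \<and> (vdeg zs \<ge> 2 \<longrightarrow> f zs = 0))"

lemma graded_sd: "graded sd"
  unfolding graded_def
proof (intro allI impI conjI)
  fix zs :: "('a \<times> 'v) list" assume len: "length zs = n"
  show br0: "fst (sd zs) = 0" if "vdeg zs \<ge> 1"
    unfolding fst_sd by (rule additive_in_zero[OF br_additive _ vdeg_pos]) (use len that in auto)
  assume v: "vdeg zs \<ge> 2"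
  have omit: "0 \<in> set (map fst (omit i zs))" if "i < n" for i
    using vdeg_omit[of i zs] that len v by (intro vdeg_pos) (auto split: if_splits)
  have "butlast zs = omit (n - 1) zs"
    using len n by (cases zs rule: rev_cases) (auto simp: omit_snoc)
  then have "l (map fst (butlast zs)) (snd (last zs)) = 0"
    using len n omit[of "n - 1"] by (intro additive_in_zero[OF l_additive_in]) (simp_all add: length_omit)
  moreover have "r (map fst (omit i zs)) (snd (zs ! i)) = 0" if "i < n - 1" for i
    using len that omit[of i] by (intro additive_in_zero[OF r_additive_in]) (simp_all add: length_omit)
  ultimately show "sd zs = 0"
    using br0 v by (simp add: prod_eq_iff) (simp add: sd_def)
qed

lemma graded_csd: "graded csd"
  unfolding graded_def
proof (intro allI impI conjI)
  fix zs :: "('a \<times> 'v) list" assume len: "length zs = n"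
  have v: "vdeg (omit i zs @ [zs ! i]) = vdeg zs" "length (omit i zs @ [zs ! i]) = n" if "i < n" for i
    using vdeg_omit[of i zs] that len by (auto simp: length_omit)
  show "fst (csd zs) = 0" if "vdeg zs \<ge> 1"
    unfolding cm_def fst_sum fst_sg using graded_sd v that
    by (intro sum.neutral) (auto simp only: graded_def sg_eq_0_iff lessThan_iff)
  show "csd zs = 0" if "vdeg zs \<ge> 2"
    unfolding cm_def using graded_sd v that
    by (intro sum.neutral) (auto simp only: graded_def sg_eq_0_iff lessThan_iff)
qed

text \<open>An inner product with one entry from \<open>V\<close> has first component 0 and so
  passes its degree on to the outer list; with two such entries it is 0 already.\<close>

lemma sd_nested_eq_0:
  assumes "graded f" "length zs = n" "Suc (length us + length ws) = n"
    and "vdeg us + vdeg zs + vdeg ws \<ge> 2"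
  shows "sd (us @ f zs # ws) = 0"
proof (cases "vdeg zs \<ge> 2")
  case True
  then have "f zs = 0" using assms by (auto simp: graded_def)
  then show ?thesis using additive_in_zero[OF sd_additive_in] assms by auto
next
  case False
  then have "vdeg (us @ f zs # ws) \<ge> 2" using assms by (auto simp: graded_def)
  moreover have "length (us @ f zs # ws) = n" using assms by simp
  ultimately show ?thesis using graded_sd by (auto simp only: graded_def)
qed

end

section \<open>The two identities of the semidirect product on pure lists\<close>

lemma omit_skip_middle:
  assumes "j < length us + length ws"
  shows "omit (skip (length us) j) (us @ v # ws) =
    (if j < length us then omit j us @ v # ws else us @ v # omit (j - length us) ws)"
    and "(us @ v # ws) ! skip (length us) j = (us @ ws) ! j"
  using assms by (auto simp: skip_def omit_append omit_Cons nth_append Suc_diff_le)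

lemma list_update_skip_middle:
  assumes "j < length us + length ws"
  shows "(us @ v # ws)[skip (length us) j := a] =
    (if j < length us then us[j := a] @ v # ws else us @ v # ws[j - length us := a])"
  using assms by (auto simp: skip_def list_update_append Suc_diff_le)

lemma sum_split_skip:
  assumes "k < n"
  shows "(\<Sum>i<n. g i) = g k + (\<Sum>i<n - 1. g (skip k i))"
  unfolding sum_skip[OF assms] using assms by (intro sum.remove) auto

context pre_lie_rep
begin

text \<open>Taking the difference of both sides turns the identity into the vanishing of a map that
  is additive in every slot. In the lemma names below, the digits count the entries from
  \<open>V\<close> in \<open>xs\<close> and in \<open>ys\<close>, and \<open>last\<close> marks an
  entry in the last slot, where \<open>l\<close> acts instead of \<open>r\<close>.\<close>

definition left_defect :: "('a \<times> 'v) list \<Rightarrow> ('a \<times> 'v) list \<Rightarrow> 'a \<times> 'v" where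
  "left_defect xs ys = sd (xs @ [sd ys]) - ((\<Sum>i<n - 1. sd (ys[i := csd (xs @ [ys ! i])]))
     + sd (butlast ys @ [sd (xs @ [last ys])]))"

definition right_defect :: "('a \<times> 'v) list \<Rightarrow> ('a \<times> 'v) list \<Rightarrow> 'a \<times> 'v" where
  "right_defect xs ys = sd (csd xs # ys) - (\<Sum>i<n. sg (n - Suc i) (sd (omit i xs @ [sd (xs ! i # ys)])))"

lemma left_defect_pure_00:
  assumes "length xs = n - 1" "length ys = n"
  shows "left_defect (map embed xs) (map embed ys) = 0"
proof -
  have 1: "sd (map embed xs @ [sd (map embed ys)]) = embed (br (xs @ [br ys]))"
    using sd_embed[of "xs @ [br ys]"] assms n by (simp add: sd_embed)
  have 2: "sd ((map embed ys)[i := csd (map embed xs @ [map embed ys ! i])]) =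
      embed (br (ys[i := cm n br (xs @ [ys ! i])]))" if "i < n - 1" for i
    using sd_embed[of "ys[i := cm n br (xs @ [ys ! i])]"] csd_embed[of "xs @ [ys ! i]"] that assms n
    by (simp add: map_update)
  have "ys \<noteq> []" using assms n by auto
  then have 3: "sd (butlast (map embed ys) @ [sd (map embed xs @ [last (map embed ys)])]) =
      embed (br (butlast ys @ [br (xs @ [last ys])]))"
    using sd_embed[of "butlast ys @ [br (xs @ [last ys])]"] sd_embed[of "xs @ [last ys]"] assms n
    by (simp add: last_map map_butlast)
  have "left_defect (map embed xs) (map embed ys) = embed (br (xs @ [br ys])) -
     ((\<Sum>i<n - 1. embed (br (ys[i := cm n br (xs @ [ys ! i])]))) + embed (br (butlast ys @ [br (xs @ [last ys])])))"
    unfolding left_defect_def 1 3 using 2 by simp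
  also have "\<dots> = 0"
    using left[OF assms] by (simp add: prod_eq_iff fst_sum snd_sum)
  finally show ?thesis .
qed

lemma left_defect_pure_01_last:
  assumes "length xs = n - 1" "length ys = n - 1"
  shows "left_defect (map embed xs) (map embed ys @ [(0, v)]) = 0"
proof -
  have 2: "sd ((map embed ys @ [(0, v)])[i := csd (map embed xs @ [(map embed ys @ [(0, v)]) ! i])]) =
      (0, l (ys[i := cm n br (xs @ [ys ! i])]) v)" if "i < n - 1" for i
    using sd_last[of "ys[i := cm n br (xs @ [ys ! i])]" v] csd_embed[of "xs @ [ys ! i]"] that assms n
    by (simp add: map_update list_update_append nth_append)
  have "left_defect (map embed xs) (map embed ys @ [(0, v)]) = (0, l xs (l ys v)) -
      ((\<Sum>i<n - 1. (0, l (ys[i := cm n br (xs @ [ys ! i])]) v)) + (0, l ys (l xs v)))"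
    unfolding left_defect_def using 2 assms by (simp add: sd_last)
  also have "\<dots> = 0"
    using l_commutator[OF assms, of v] by (simp add: prod_eq_iff fst_sum snd_sum algebra_simps)
  finally show ?thesis .
qed

text \<open>The summand that hits position \<open>k\<close> gives \<open>r\<close> after
  \<open>mu\<close>, the other positions give the sum and the last term of \<open>rep1\<close>. All
  terms share the sign \<open>(-1)^k\<close>.\<close>

lemma left_defect_pure_01:
  assumes "length xs = n - 1" "length us + length ws = n - 1" "ws \<noteq> []"
  shows "left_defect (map embed xs) (map embed us @ (0, v) # map embed ws) = 0"
proof -
  define k where "k = length us"
  define zs where "zs = map embed us @ (0, v) # map embed ws"
  have k: "k < n - 1" using assms by (cases ws) (auto simp: k_def)
  have zs: "length zs = n" "zs ! k = (0, v)" "map embed us = take k zs" using assms n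
    by (auto simp: zs_def k_def nth_append)
  have len: "length (us @ ws) = n - 1" using assms by simp
  obtain ws' y where ws: "ws = ws' @ [y]" using assms(3) by (cases ws rule: rev_cases) auto
  have 1: "sd (map embed xs @ [sd zs]) = (0, sg k (l xs (r (us @ ws) v)))"
    unfolding zs_def sd_mid[OF assms(2,3)] sd_last[OF assms(1)]
    by (simp add: additive_sg[OF l_additive[OF assms(1)]] k_def)
  have 2: "sd (zs[k := csd (map embed xs @ [zs ! k])]) = (0, sg k (r (us @ ws) (mu xs v)))"
    unfolding zs(2) csd_last[OF assms(1)]
    using sd_mid[OF assms(2,3)] by (simp add: zs_def k_def list_update_append)
  have 3: "sd (zs[skip k i := csd (map embed xs @ [zs ! skip k i])]) =
      (0, sg k (r ((us @ ws)[i := cm n br (xs @ [(us @ ws) ! i])]) v))" if "i < n - 2" for i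
  proof -
    have i: "i < length us + length ws" using that assms by simp
    have nth: "zs ! skip k i = embed ((us @ ws) ! i)"
      using omit_skip_middle(2)[of i "map embed us" "map embed ws" "(0, v)"] i
      by (simp add: zs_def k_def nth_append)
    have csd: "csd (map embed xs @ [zs ! skip k i]) = embed (cm n br (xs @ [(us @ ws) ! i]))" (is "_ = embed ?a")
      using csd_embed[of "xs @ [(us @ ws) ! i]"] assms n by (simp add: nth)
    have "zs[skip k i := embed ?a] = (if i < k then map embed (us[i := ?a]) @ (0, v) # map embed ws
        else map embed us @ (0, v) # map embed (ws[i - k := ?a]))"
      using list_update_skip_middle[of i "map embed us" "map embed ws" "(0, v)"] i
      by (simp add: zs_def k_def map_update)
    then show ?thesis
      unfolding csd using assms sd_mid[of "us[i := ?a]" ws v] sd_mid[of us "ws[i - k := ?a]" v]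
      by (simp add: k_def list_update_append)
  qed
  have last: "last zs = embed y" "butlast zs = map embed us @ (0, v) # map embed ws'"
    by (simp_all add: zs_def ws butlast_append)
  have 4: "sd (butlast zs @ [sd (map embed xs @ [last zs])]) =
      (0, sg k (r (butlast (us @ ws) @ [br (xs @ [last (us @ ws)])]) v))"
    using sd_embed[of "xs @ [y]"] sd_mid[of us "ws' @ [br (xs @ [y])]" v] assms n
    by (simp add: last k_def ws butlast_append)
  have "left_defect (map embed xs) zs = (0, sg k (l xs (r (us @ ws) v))) -
      ((0, sg k (r (us @ ws) (mu xs v))) + (\<Sum>i<n - 2. (0, sg k (r ((us @ ws)[i := cm n br (xs @ [(us @ ws) ! i])]) v)))
       + (0, sg k (r (butlast (us @ ws) @ [br (xs @ [last (us @ ws)])]) v)))"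
    unfolding left_defect_def 1 4 sum_split_skip[OF k] 2 using 3 by (simp add: numeral_2_eq_2)
  also have "\<dots> = 0"
    using rep1[OF assms(1) len, of v] by (simp add: prod_eq_iff fst_sum snd_sum sg_add sg_sum)
  finally show ?thesis by (simp add: zs_def)
qed

text \<open>With \<open>v\<close> at position \<open>j\<close> of \<open>xs\<close>, the commutator
  places \<open>mu\<close> with sign \<open>(-1)^(n - 1 - j)\<close> into position \<open>i\<close>
  of \<open>ys\<close>, and extracting it from there costs \<open>(-1)^i\<close>. Relative to the
  common factor \<open>(-1)^j\<close> this is \<open>(-1)^(n - 1 + i)\<close>, the sign of
  \<open>rep3'\<close>.\<close>

lemma left_defect_pure_10:
  assumes "length us + length ws = n - 2" "length ys = n"
  shows "left_defect (map embed us @ (0, v) # map embed ws) (map embed ys) = 0"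
proof -
  define j where "j = length us"
  define x where "x = us @ ws"
  have x: "length x = n - 2" "length ws = n - 2 - j" "j \<le> n - 2" using assms by (auto simp: x_def j_def)
  have ysne: "ys \<noteq> []" using assms n by auto
  have sd: "sd ((map embed us @ (0, v) # map embed ws) @ [embed a]) = (0, sg j (r (x @ [a]) v))" for a
    using sd_mid[of us "ws @ [a]" v] assms n by (simp add: x_def j_def)
  have csd: "csd ((map embed us @ (0, v) # map embed ws) @ [embed a]) = (0, sg (n - 1 - j) (mu (x @ [a]) v))" for a
  proof -
    have "length us + length (ws @ [a]) = n - 1" "Suc (length ws) = n - 1 - j" using assms n x by simp_all
    then show ?thesis
      using csd_mid[of us "ws @ [a]" v] by (simp add: x_def del: sg_Suc)
  qed
  have 1: "sd ((map embed us @ (0, v) # map embed ws) @ [sd (map embed ys)]) = (0, sg j (r (x @ [br ys]) v))"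
    unfolding sd_embed[OF assms(2)] by (rule sd)
  have 2: "sd ((map embed ys)[i := csd ((map embed us @ (0, v) # map embed ws) @ [map embed ys ! i])]) =
      (0, sg j (sg (n - 1 + i) (r (omit i ys) (mu (x @ [ys ! i]) v))))" if "i < n - 1" for i
  proof -
    have nth: "map embed ys ! i = embed (ys ! i)" using that assms by simp
    have ys: "take i ys @ drop (Suc i) ys = omit i ys" by (simp add: omit_def)
    have "(map embed ys)[i := (0, m)] = map embed (take i ys) @ (0, m) # map embed (drop (Suc i) ys)" for m :: 'v
      using that assms by (simp add: upd_conv_take_nth_drop take_map drop_map)
    then have "sd ((map embed ys)[i := (0, m)]) = (0, sg i (r (omit i ys) m))" for m
      using sd_mid[of "take i ys" "drop (Suc i) ys" m] that assms n by (simp add: ys min_def)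
    moreover have "sg (i + (n - 1 - j)) y = sg (j + (n - 1 + i)) y" for y :: 'v
    proof (rule sg_cong)
      have "i + (n - 1 - j) + (j + (n - 1 + i)) = 2 * (i + (n - 1))" using x(3) n by simp
      then show "even (i + (n - 1 - j) + (j + (n - 1 + i)))" by (metis dvd_triv_left)
    qed
    ultimately show ?thesis
      unfolding nth csd using that assms by (simp add: sg_sg additive_sg[OF r_additive] length_omit)
  qed
  have l1: "length (butlast ys) = n - 1" using assms by simp
  have 3: "sd (butlast (map embed ys) @ [sd ((map embed us @ (0, v) # map embed ws) @ [last (map embed ys)])]) =
      (0, sg j (l (butlast ys) (r (x @ [last ys]) v)))"
    unfolding last_map[OF ysne] sd
    using sd_last[OF l1] by (simp add: map_butlast[symmetric] additive_sg[OF l_additive[OF l1]])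
  have "left_defect (map embed us @ (0, v) # map embed ws) (map embed ys) =
     (0, sg j (r (x @ [br ys]) v)) -
     ((\<Sum>i<n - 1. (0, sg j (sg (n - 1 + i) (r (omit i ys) (mu (x @ [ys ! i]) v)))))
      + (0, sg j (l (butlast ys) (r (x @ [last ys]) v))))"
    unfolding left_defect_def 1 3 using 2 by simp
  also have "\<dots> = 0"
    using rep3'[OF x(1) assms(2), of v] by (simp add: prod_eq_iff fst_sum snd_sum sg_add sg_sum)
  finally show ?thesis .
qed

lemma right_defect_pure_00:
  assumes "length xs = n" "length ys = n - 1"
  shows "right_defect (map embed xs) (map embed ys) = 0"
proof -
  have 1: "sd (csd (map embed xs) # map embed ys) = embed (br (cm n br xs # ys))"
    using sd_embed[of "cm n br xs # ys"] assms n by (simp add: csd_embed)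
  have 2: "sd (omit i (map embed xs) @ [sd (map embed xs ! i # map embed ys)]) =
      embed (br (omit i xs @ [br (xs ! i # ys)]))" if "i < n" for i
    using sd_embed[of "xs ! i # ys"] sd_embed[of "omit i xs @ [br (xs ! i # ys)]"] that assms n
    by (simp add: length_omit map_omit)
  have "right_defect (map embed xs) (map embed ys) = embed (br (cm n br xs # ys)) -
     (\<Sum>i<n. sg (n - Suc i) (embed (br (omit i xs @ [br (xs ! i # ys)]))))"
    unfolding right_defect_def 1 using 2 by simp
  also have "\<dots> = 0"
    using right[OF assms] by (simp add: prod_eq_iff fst_sum snd_sum fst_sg snd_sg)
  finally show ?thesis .
qed

lemma right_defect_pure_01_last:
  assumes "length xs = n" "length ys = n - 2"
  shows "right_defect (map embed xs) (map embed ys @ [(0, v)]) = 0"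
proof -
  have 1: "sd (csd (map embed xs) # map embed ys @ [(0, v)]) = (0, l (cm n br xs # ys) v)"
    using sd_last[of "cm n br xs # ys" v] assms n by (simp add: csd_embed)
  have 2: "sd (omit i (map embed xs) @ [sd (map embed xs ! i # map embed ys @ [(0, v)])]) =
      (0, l (omit i xs) (l (xs ! i # ys) v))" if "i < n" for i
    using sd_last[of "xs ! i # ys" v] sd_last[of "omit i xs" "l (xs ! i # ys) v"] that assms n
    by (simp add: length_omit map_omit)
  have "right_defect (map embed xs) (map embed ys @ [(0, v)]) = (0, l (cm n br xs # ys) v) -
     (\<Sum>i<n. sg (n - Suc i) (0, l (omit i xs) (l (xs ! i # ys) v)))"
    unfolding right_defect_def 1 using 2 by simp
  also have "\<dots> = 0"
    using l_cm[OF assms] by (simp add: prod_eq_iff fst_sum snd_sum fst_sg snd_sg)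
  finally show ?thesis .
qed

lemma right_defect_pure_01:
  assumes "length xs = n" "length us + length ws = n - 2" "ws \<noteq> []"
  shows "right_defect (map embed xs) (map embed us @ (0, v) # map embed ws) = 0"
proof -
  define k where "k = Suc (length us)"
  have sd: "sd (embed a # map embed us @ (0, v) # map embed ws) = (0, sg k (r (a # us @ ws) v))" for a
    using sd_mid[of "a # us" ws v] assms n by (simp add: k_def)
  have 2: "sd (omit i (map embed xs) @ [sd (map embed xs ! i # map embed us @ (0, v) # map embed ws)]) =
      (0, sg k (l (omit i xs) (r (xs ! i # us @ ws) v)))" if "i < n" for i
    using sd_last[of "omit i xs"] that assms n
    by (simp add: length_omit map_omit sd additive_sg[OF l_additive])
  have "right_defect (map embed xs) (map embed us @ (0, v) # map embed ws) = (0, sg k (r (cm n br xs # us @ ws) v)) -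
     (\<Sum>i<n. sg (n - Suc i) (0, sg k (l (omit i xs) (r (xs ! i # us @ ws) v))))"
    unfolding right_defect_def csd_embed[OF assms(1)] sd using 2 by simp
  also have "\<dots> = 0"
    using rep2[OF assms(1), of "us @ ws" v] assms(2)
    by (simp add: prod_eq_iff fst_sum snd_sum fst_sg snd_sg sg_sum sg_sg add.commute)
  finally show ?thesis .
qed

text \<open>This is \<open>rep4\<close>. The summand singling out \<open>v\<close> gives
  \<open>l\<close> after \<open>r\<close>. In the others \<open>v\<close> moves one place to the
  left exactly if the omitted position precedes it; the omitted index jumps over \<open>j\<close>
  otherwise, and in both cases the exponent is \<open>n - 2 - i + j\<close>.\<close>

lemma right_defect_pure_10:
  assumes "length us + length ws = n - 1" "length ys = n - 1"
  shows "right_defect (map embed us @ (0, v) # map embed ws) (map embed ys) = 0"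
proof -
  define j where "j = length us"
  define x where "x = us @ ws"
  define zs where "zs = map embed us @ (0, v) # map embed ws"
  have x: "length x = n - 1" "length ws = n - 1 - j" "j \<le> n - 1" "j < n"
    using assms n by (auto simp: x_def j_def)
  have 1: "sd (csd zs # map embed ys) = (0, sg (n - 1 - j) (r ys (mu x v)))"
    unfolding zs_def csd_mid[OF assms(1)] sd_first[OF assms(2)]
    by (simp add: additive_sg[OF r_additive[OF assms(2)]] x_def x)
  have 2: "sg (n - Suc j) (sd (omit j zs @ [sd (zs ! j # map embed ys)])) = (0, sg (n - 1 - j) (l x (r ys v)))"
  proof -
    have "omit j zs = map embed x" "zs ! j = (0, v)"
      by (simp_all add: zs_def j_def x_def omit_append omit_Cons nth_append)
    then show ?thesis
      by (simp only: sd_first[OF assms(2)] sd_last[OF x(1)]) (simp add: prod_eq_iff fst_sg snd_sg)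
  qed
  have 3: "sg (n - Suc (skip j i)) (sd (omit (skip j i) zs @ [sd (zs ! skip j i # map embed ys)])) =
      (0, sg (n - 1 - j) (sg (Suc i) (r (omit i x @ [br (x ! i # ys)]) v)))" if "i < n - 1" for i
  proof -
    define a where "a = br (x ! i # ys)"
    have i: "i < length us + length ws" using that assms by simp
    have "zs ! skip j i = embed (x ! i)"
      using omit_skip_middle(2)[of i "map embed us" "map embed ws" "(0, v)"] i
      by (simp add: zs_def j_def x_def nth_append)
    then have a: "sd (zs ! skip j i # map embed ys) = embed a"
      using sd_embed[of "x ! i # ys"] assms n by (simp add: a_def)
    have omit: "omit (skip j i) zs @ [embed a] = (if i < j then map embed (omit i us) @ (0, v) # map embed (ws @ [a])
        else map embed us @ (0, v) # map embed (omit (i - j) ws @ [a]))"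
      using omit_skip_middle(1)[of i "map embed us" "map embed ws" "(0, v)"] i
      by (simp add: zs_def j_def map_omit)
    show ?thesis
    proof (cases "i < j")
      case True
      have "sd (omit (skip j i) zs @ [embed a]) = (0, sg (j - 1) (r (omit i x @ [a]) v))"
      proof -
        have "length (omit i us) + length (ws @ [a]) = n - 1"
          using True assms(1) by (simp add: length_omit j_def)
        then show ?thesis
          using sd_mid[of "omit i us" "ws @ [a]" v] True
          by (simp add: omit[unfolded j_def] x_def j_def length_omit omit_append)
      qed
      moreover have "sg (n - Suc i) (sg (j - 1) y) = sg (n - 1 - j) (sg (Suc i) y)" for y :: 'v
        unfolding sg_sg
      proof (rule sg_cong)
        have "n - Suc i + (j - 1) + (n - 1 - j + Suc i) = 2 * (n - 1)" using True x(3) n by simp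
        then show "even (n - Suc i + (j - 1) + (n - 1 - j + Suc i))" by (metis dvd_triv_left)
      qed
      ultimately show ?thesis
        unfolding a using True by (simp add: a_def skip_def prod_eq_iff fst_sg snd_sg del: sg_Suc)
    next
      case False
      have "sd (omit (skip j i) zs @ [embed a]) = (0, sg j (r (omit i x @ [a]) v))"
      proof -
        have "length us + length (omit (i - j) ws @ [a]) = n - 1"
          using False assms(1) i by (simp add: length_omit j_def)
        then show ?thesis
          using sd_mid[of us "omit (i - j) ws @ [a]" v] False
          by (simp add: omit[unfolded j_def] x_def j_def omit_append)
      qed
      moreover have "sg (n - Suc (Suc i)) (sg j y) = sg (n - 1 - j) (sg (Suc i) y)" for y :: 'v
        unfolding sg_sg
      proof (rule sg_cong)
        have "n - Suc (Suc i) + j + (n - 1 - j + Suc i) = 2 * (n - 1)" using that x(3) n by simp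
        then show "even (n - Suc (Suc i) + j + (n - 1 - j + Suc i))" by (metis dvd_triv_left)
      qed
      ultimately show ?thesis
        unfolding a using False by (simp add: a_def skip_def prod_eq_iff fst_sg snd_sg del: sg_Suc)
    qed
  qed
  have "right_defect zs (map embed ys) = (0, sg (n - 1 - j) (r ys (mu x v))) -
     ((0, sg (n - 1 - j) (l x (r ys v))) +
      (\<Sum>i<n - 1. (0, sg (n - 1 - j) (sg (Suc i) (r (omit i x @ [br (x ! i # ys)]) v)))))"
    unfolding right_defect_def 1 sum_split_skip[OF x(4)] 2 using 3 by simp
  also have "\<dots> = 0"
    using rep4[OF x(1) assms(2), of v]
    by (simp add: prod_eq_iff fst_sum snd_sum sg_add sg_sum del: sg_Suc)
  finally show ?thesis by (simp add: zs_def)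
qed

lemma left_defect_eq_0_of_pure:
  assumes xs: "length xs = n - 1" "list_all pure xs" and ys: "length ys = n" "list_all pure ys"
  shows "left_defect xs ys = 0"
proof -
  consider "vdeg xs + vdeg ys \<ge> 2" | "vdeg xs = 0" "vdeg ys = 0" | "vdeg xs = 0" "vdeg ys = 1"
    | "vdeg xs = 1" "vdeg ys = 0" by linarith
  then show ?thesis
  proof cases
    \<comment> \<open>With two entries from \<open>V\<close> each nested product vanishes
      separately.\<close>
    case 1
    have ysne: "ys \<noteq> []" using ys n by auto
    have vb: "vdeg (butlast ys) + vdeg [last ys] = vdeg ys"
      using ysne by (cases ys rule: rev_cases) simp_all
    have "sd (xs @ [sd ys]) = 0"
      using sd_nested_eq_0[OF graded_sd ys(1), of xs "[]"] xs n 1 by simp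
    moreover have "sd (ys[i := csd (xs @ [ys ! i])]) = 0" if "i < n - 1" for i
    proof -
      have "vdeg (take i ys) + vdeg [ys ! i] + vdeg (drop (Suc i) ys) = vdeg ys"
        using that ys arg_cong[OF id_take_nth_drop[of i ys], of vdeg] by simp
      then show ?thesis
        using sd_nested_eq_0[OF graded_csd, of "xs @ [ys ! i]" "take i ys" "drop (Suc i) ys"] that xs ys n 1
        by (simp add: upd_conv_take_nth_drop min_def)
    qed
    moreover have "sd (butlast ys @ [sd (xs @ [last ys])]) = 0"
      using sd_nested_eq_0[OF graded_sd, of "xs @ [last ys]" "butlast ys" "[]"] xs ys n 1 vb by simp
    ultimately show ?thesis by (simp add: left_defect_def)
  next
    case 2
    then show ?thesis
      using left_defect_pure_00[of "map fst xs" "map fst ys"] vdeg_eq_0[OF xs(2)] vdeg_eq_0[OF ys(2)] xs ys by simp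
  next
    case 3
    then obtain us v ws where *: "ys = map embed us @ (0, v) # map embed ws" using vdeg_eq_1[OF ys(2)] by metis
    have "length us + length ws = n - 1" using ys * by simp
    then have "left_defect (map embed (map fst xs)) ys = 0"
      using left_defect_pure_01[of "map fst xs" us ws v] left_defect_pure_01_last[of "map fst xs" us v] xs *
      by (cases "ws = []") simp_all
    then show ?thesis using vdeg_eq_0[OF xs(2)] 3 by simp
  next
    case 4
    then obtain us v ws where *: "xs = map embed us @ (0, v) # map embed ws" using vdeg_eq_1[OF xs(2)] by metis
    have "length us + length ws = n - 2" using xs * n by simp
    then have "left_defect xs (map embed (map fst ys)) = 0"
      using left_defect_pure_10[of us ws "map fst ys" v] ys * by simp
    then show ?thesis using vdeg_eq_0[OF ys(2)] 4 by simp
  qed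
qed

lemma right_defect_eq_0_of_pure:
  assumes xs: "length xs = n" "list_all pure xs" and ys: "length ys = n - 1" "list_all pure ys"
  shows "right_defect xs ys = 0"
proof -
  consider "vdeg xs + vdeg ys \<ge> 2" | "vdeg xs = 0" "vdeg ys = 0" | "vdeg xs = 0" "vdeg ys = 1"
    | "vdeg xs = 1" "vdeg ys = 0" by linarith
  then show ?thesis
  proof cases
    case 1
    have "sd (csd xs # ys) = 0"
      using sd_nested_eq_0[OF graded_csd xs(1), of "[]" ys] ys n 1 by simp
    moreover have "sd (omit i xs @ [sd (xs ! i # ys)]) = 0" if "i < n" for i
      using sd_nested_eq_0[OF graded_sd, of "xs ! i # ys" "omit i xs" "[]"] that xs ys n 1 vdeg_omit[of i xs]
      by (simp add: length_omit)
    ultimately show ?thesis by (simp add: right_defect_def)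
  next
    case 2
    then show ?thesis
      using right_defect_pure_00[of "map fst xs" "map fst ys"] vdeg_eq_0[OF xs(2)] vdeg_eq_0[OF ys(2)] xs ys by simp
  next
    case 3
    then obtain us v ws where *: "ys = map embed us @ (0, v) # map embed ws" using vdeg_eq_1[OF ys(2)] by metis
    have "length us + length ws = n - 2" using ys * n by simp
    then have "right_defect (map embed (map fst xs)) ys = 0"
      using right_defect_pure_01[of "map fst xs" us ws v] right_defect_pure_01_last[of "map fst xs" us v] xs *
      by (cases "ws = []") simp_all
    then show ?thesis using vdeg_eq_0[OF xs(2)] 3 by simp
  next
    case 4
    then obtain us v ws where *: "xs = map embed us @ (0, v) # map embed ws" using vdeg_eq_1[OF xs(2)] by metis
    have "length us + length ws = n - 1" using xs * n by simp
    then have "right_defect xs (map embed (map fst ys)) = 0"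
      using right_defect_pure_10[of us ws "map fst ys" v] ys * by simp
    then show ?thesis using vdeg_eq_0[OF ys(2)] 4 by simp
  qed
qed

section \<open>Extension from pure lists to all lists\<close>

lemma left_defect_additive_left:
  assumes ys: "length ys = n"
  shows "additive_in (n - 1) (\<lambda>xs. left_defect xs ys)"
proof (rule additive_inI)
  fix us ws :: "('a \<times> 'v) list" assume len: "Suc (length us + length ws) = n - 1"
  have 1: "additive (\<lambda>x. sd ((us @ x # ws) @ [a]))" for a
    using additive_inD[OF sd_additive_in, of us "ws @ [a]"] len by simp
  have 2: "additive (\<lambda>x. csd ((us @ x # ws) @ [a]))" for a
    using additive_inD[OF sd.cm_additive, of us "ws @ [a]"] len by simp
  have 3: "additive (\<lambda>y. sd (ys[i := y]))" if "i < n - 1" for i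
  proof -
    have "i < length ys" using that ys by simp
    then show ?thesis
      using additive_inD[OF sd_additive_in, of "take i ys" "drop (Suc i) ys"] ys
      by (simp add: upd_conv_take_nth_drop)
  qed
  have 4: "additive (\<lambda>y. sd (butlast ys @ [y]))"
    by (rule sd.additive_last) (use ys in simp)
  show "additive (\<lambda>x. left_defect (us @ x # ws) ys)"
    unfolding left_defect_def
    by (intro additive_diff additive_add additive_sum_fun 1 additive_comp[OF 3 2] additive_comp[OF 4 1]) auto
qed

lemma left_defect_additive_right:
  assumes xs: "length xs = n - 1"
  shows "additive_in n (left_defect xs)"
proof (rule additive_inI)
  fix us ws :: "('a \<times> 'v) list" assume len: "Suc (length us + length ws) = n"
  define y where "y x = us @ x # ws" for x
  have sd_xs: "additive (\<lambda>a. sd (xs @ [a]))" by (rule sd.additive_last[OF xs])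
  have 1: "additive (\<lambda>x. sd (xs @ [sd (y x)]))"
    unfolding y_def by (rule additive_comp[OF sd_xs additive_inD[OF sd_additive_in len]])
  have csd_xs: "additive (\<lambda>a. csd (xs @ [a]))"
    using additive_inD[OF sd.cm_additive, of xs "[]"] xs n by simp
  have 2: "additive (\<lambda>x. sd ((y x)[i := csd (xs @ [y x ! i])]))" if "i < n - 1" for i
  proof -
    have "i < n" using that by simp
    then consider "i < length us" | "i = length us" | j where "i = Suc (length us + j)" "j < length ws"
      using len less_iff_Suc_add[of "length us" i] by force
    then show ?thesis
    proof cases
      case 1
      then show ?thesis
        using additive_inD[OF sd_additive_in, of "us[i := csd (xs @ [us ! i])]" ws] len
        by (simp add: y_def list_update_append nth_append)
    next
      case 2
      then show ?thesis
        using additive_comp[OF additive_inD[OF sd_additive_in len] csd_xs] by (simp add: y_def)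
    next
      case 3
      then show ?thesis
        using additive_inD[OF sd_additive_in, of us "ws[j := csd (xs @ [ws ! j])]"] len
        by (simp add: y_def list_update_append nth_append)
    qed
  qed
  have 3: "additive (\<lambda>x. sd (butlast (y x) @ [sd (xs @ [last (y x)])]))"
  proof (cases ws rule: rev_cases)
    case Nil
    then show ?thesis
      using additive_comp[OF sd.additive_last sd_xs, of us] len by (simp add: y_def)
  next
    case (snoc ws' a)
    then show ?thesis
      using additive_inD[OF sd_additive_in, of us "ws' @ [sd (xs @ [a])]"] len
      by (simp add: y_def butlast_append)
  qed
  show "additive (\<lambda>x. left_defect xs (us @ x # ws))"
    unfolding left_defect_def y_def[symmetric]
    by (intro additive_diff additive_add additive_sum_fun 1 2 3) auto
qed

lemma right_defect_additive_left:
  assumes ys: "length ys = n - 1"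
  shows "additive_in n (\<lambda>xs. right_defect xs ys)"
proof (rule additive_inI)
  fix us ws :: "('a \<times> 'v) list" assume len: "Suc (length us + length ws) = n"
  have 1: "additive (\<lambda>x. sd (x # ys))" by (rule sd.additive_first[OF ys])
  have "additive_in n (skew n (\<lambda>L a. sd (L @ [sd (a # ys)])))"
    by (intro additive_in_skew sd.additive_in_snoc additive_comp[OF sd.additive_last 1])
  from additive_inD[OF this len]
  show "additive (\<lambda>x. right_defect (us @ x # ws) ys)"
    unfolding right_defect_def sum_sg_eq_skew[where H = "\<lambda>L a. sd (L @ [sd (a # ys)])"]
    by (intro additive_diff additive_sg_fun additive_comp[OF 1 additive_inD[OF sd.cm_additive len]])
qed

lemma right_defect_additive_right:
  assumes xs: "length xs = n"
  shows "additive_in (n - 1) (right_defect xs)"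
proof (rule additive_inI)
  fix us ws :: "('a \<times> 'v) list" assume len: "Suc (length us + length ws) = n - 1"
  have 1: "additive (\<lambda>x. sd (a # us @ x # ws))" for a
    using additive_inD[OF sd_additive_in, of "a # us" ws] len by simp
  have 2: "additive (\<lambda>x. sd (omit i xs @ [x]))" if "i < n" for i
    by (rule sd.additive_last) (use xs that in \<open>simp add: length_omit\<close>)
  show "additive (\<lambda>x. right_defect xs (us @ x # ws))"
    unfolding right_defect_def
    by (intro additive_diff additive_sum_fun additive_sg_fun 1 additive_comp[OF 2 1]) auto
qed

text \<open>Two passes from pure to arbitrary lists: additivity in \<open>ys\<close> for a fixed
  pure \<open>xs\<close>, then additivity in \<open>xs\<close> for the arbitrary
  \<open>ys\<close>.\<close>

sublocale sd: pre_lie n sd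
proof
  fix xs ys :: "('a \<times> 'v) list" assume len: "length xs = n - 1" "length ys = n"
  have "left_defect xs ys = 0" if xs: "length xs = n - 1" "list_all pure xs" for xs
    using additive_in_eq_0_of_pure[OF left_defect_additive_right[OF xs(1)] left_defect_eq_0_of_pure[OF xs] len(2)] .
  then have "left_defect xs ys = 0"
    using additive_in_eq_0_of_pure[OF left_defect_additive_left[OF len(2)] _ len(1)] by blast
  then show "sd (xs @ [sd ys]) = (\<Sum>i<n - 1. sd (ys[i := csd (xs @ [ys ! i])]))
      + sd (butlast ys @ [sd (xs @ [last ys])])"
    by (simp add: left_defect_def)
next
  fix xs ys :: "('a \<times> 'v) list" assume len: "length xs = n" "length ys = n - 1"
  have "right_defect xs ys = 0" if xs: "length xs = n" "list_all pure xs" for xs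
    using additive_in_eq_0_of_pure[OF right_defect_additive_right[OF xs(1)] right_defect_eq_0_of_pure[OF xs] len(2)] .
  then have "right_defect xs ys = 0"
    using additive_in_eq_0_of_pure[OF right_defect_additive_left[OF len(2)] _ len(1)] by blast
  then show "sd (csd xs # ys) = (\<Sum>i<n. sg (n - Suc i) (sd (omit i xs @ [sd (xs ! i # ys)])))"
    by (simp add: right_defect_def)
qed

end

section \<open>O-operators without carriers\<close>

context pre_lie_rep
begin

text \<open>The fundamental identity of the semidirect product with \<open>(0, w)\<close> as the
  last entry of the inner list. The index \<open>n - 1\<close> on its right-hand side gives the term
  with the two operators exchanged.\<close>

lemma mu_commutator:
  assumes "length xs = n - 1" "length ys = n - 1"
  shows "mu xs (mu ys w) = (\<Sum>i<n - 1. mu (ys[i := cm n br (xs @ [ys ! i])]) w) + mu ys (mu xs w)"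
proof -
  define zs where "zs = map embed ys @ [(0, w)]"
  have zs: "length zs = n" using assms n by (simp add: zs_def)
  have "csd (zs[i := csd (map embed xs @ [zs ! i])]) = (0, mu (ys[i := cm n br (xs @ [ys ! i])]) w)"
    if "i < n - 1" for i
    using csd_embed[of "xs @ [ys ! i]"] csd_last[of "ys[i := cm n br (xs @ [ys ! i])]" w] that assms n
    by (simp add: zs_def nth_append list_update_append map_update)
  moreover have "csd (zs[n - 1 := csd (map embed xs @ [zs ! (n - 1)])]) = (0, mu ys (mu xs w))"
    using csd_last assms by (simp add: zs_def nth_append list_update_append)
  moreover have "csd (map embed xs @ [csd zs]) =
      (\<Sum>i<n. csd (zs[i := csd (map embed xs @ [zs ! i])]))"
    by (rule sd.fundamental_identity) (use assms zs in auto)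
  moreover have "csd (map embed xs @ [csd zs]) = (0, mu xs (mu ys w))"
    using csd_last assms by (simp add: zs_def)
  moreover have "{..<n} = insert (n - 1) {..<n - 1}" using n by auto
  ultimately show ?thesis by (simp add: prod_eq_iff snd_sum add.commute)
qed

text \<open>The fundamental identity with \<open>(0, v)\<close> in the first slot of the outer
  commutator and an inner list from the first factor. Both sides carry the same overall minus sign.
  Together with \<open>mu_commutator\<close> this makes \<open>mu\<close> a representation of the
  commutator algebra.\<close>

lemma mu_cm:
  assumes "length xs = n" "length ys = n - 2"
  shows "mu (cm n br xs # ys) v = (\<Sum>i<n. sg (n - Suc i) (mu (omit i xs) (mu (xs ! i # ys) v)))"
proof -
  have *: "csd (((0, v) # map embed ys) @ [embed a]) = (0, - mu (a # ys) v)" for a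
  proof -
    have "csd ([] @ (0, v) # map embed ys @ [embed a]) = (0, sg (n - 1) (mu (ys @ [a]) v))"
      using csd_mid[of "[]" "ys @ [a]" v] assms n by (simp add: Suc_diff_le)
    moreover have "mu (a # ys) v = sg (n - 2) (mu (ys @ [a]) v)"
      using alternating_move[OF mu_additive_in mu_alternating, of "[]" ys "[]" a v] assms n
      by simp
    moreover have "sg (n - 1) y = - sg (n - 2) y" for y :: 'v
      using n by (auto simp: sg_def)
    ultimately show ?thesis by simp
  qed
  have upd: "csd ((map embed xs)[i := (0, u)]) = (0, sg (n - Suc i) (mu (omit i xs) u))" if "i < n" for i u
    using csd_mid[of "take i xs" "drop (Suc i) xs" u] that assms n
    by (simp add: upd_conv_take_nth_drop take_map drop_map omit_def)
  have "csd (((0, v) # map embed ys) @ [csd (map embed xs)]) =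
      (\<Sum>i<n. csd ((map embed xs)[i := csd (((0, v) # map embed ys) @ [map embed xs ! i])]))"
    by (rule sd.fundamental_identity) (use assms n in auto)
  also have "\<dots> = (\<Sum>i<n. (0, - sg (n - Suc i) (mu (omit i xs) (mu (xs ! i # ys) v))))"
  proof (rule sum.cong[OF refl])
    fix i assume "i \<in> {..<n}"
    then have i: "i < n" by simp
    then have nth: "map embed xs ! i = embed (xs ! i)" using assms by simp
    have "length (omit i xs) = n - 1" using i assms by (simp add: length_omit)
    then show "csd ((map embed xs)[i := csd (((0, v) # map embed ys) @ [map embed xs ! i])]) =
        (0, - sg (n - Suc i) (mu (omit i xs) (mu (xs ! i # ys) v)))"
      unfolding nth * upd[OF i] by (simp add: additive.minus[OF mu_additive] sg_minus)
  qed
  finally show ?thesis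
    unfolding csd_embed[OF assms(1)] * by (simp add: prod_eq_iff snd_sum sum_negf)
qed

text \<open>The commutator of the semidirect product is the n-Lie semidirect product formed with
  \<open>mu\<close> alone. Both sides are additive in every slot, so pure lists suffice. On the
  graph of an O-operator it compares the horizontal with the vertical commutator.\<close>

lemma snd_csd:
  assumes "length zs = n"
  shows "snd (csd zs) = (\<Sum>i<n. sg (n - Suc i) (mu (map fst (omit i zs)) (snd (zs ! i))))"
proof -
  define H where "H L z = mu (map fst L) (snd z)" for L :: "('a \<times> 'v) list" and z :: "'a \<times> 'v"
  define F where "F zs = snd (csd zs) - sg (n - 1) (skew n H zs)" for zs
  have skew_add: "additive_in n (skew n H)"
    unfolding H_def by (intro additive_in_skew additive_in_map_fst mu_additive_in additive_comp[OF mu_additive])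
      (auto simp: additive_def)
  have add: "additive_in n F"
  proof (rule additive_inI)
    fix us ws :: "('a \<times> 'v) list" assume len: "Suc (length us + length ws) = n"
    show "additive (\<lambda>x. F (us @ x # ws))"
      unfolding F_def
      by (rule additive_diff[OF additive_snd[OF additive_inD[OF sd.cm_additive len]]
            additive_sg_fun[OF additive_inD[OF skew_add len]]])
  qed
  have skew: "sg (n - 1) (skew n H zs) = (\<Sum>i<n. sg (n - Suc i) (mu (map fst (omit i zs)) (snd (zs ! i))))" for zs
    unfolding sum_sg_eq_skew[symmetric] by (simp add: H_def)
  then have F: "F zs = snd (csd zs) - (\<Sum>i<n. sg (n - Suc i) (mu (map fst (omit i zs)) (snd (zs ! i))))" for zs
    by (simp only: F_def)
  have "F zs = 0" if zs: "length zs = n" "list_all pure zs" for zs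
  proof -
    consider "vdeg zs \<ge> 2" | "vdeg zs = 0" | "vdeg zs = 1" by linarith
    then show ?thesis
    proof cases
      case 1
      have "mu (map fst (omit i zs)) (snd (zs ! i)) = 0" if "i < n" for i
      proof -
        have "vdeg (omit i zs) \<ge> 1" using vdeg_omit[of i zs] that zs 1 by (auto split: if_splits)
        then show ?thesis
          using additive_in_zero[OF mu_additive_in, of "map fst (omit i zs)"] vdeg_pos[of "omit i zs"] that zs
          by (simp add: length_omit)
      qed
      moreover have "csd zs = 0" using graded_csd zs 1 by (auto simp only: graded_def)
      ultimately show ?thesis by (simp add: F)
    next
      case 2
      then have *: "zs = map embed (map fst zs)" using zs vdeg_eq_0 by blast
      have snd0: "snd (zs ! i) = 0" if "i < n" for i
        using that zs arg_cong[OF *, of "\<lambda>L. snd (L ! i)"] by simp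
      have "mu (map fst (omit i zs)) (snd (zs ! i)) = 0" if "i < n" for i
        using that zs additive.zero[OF mu_additive, of "map fst (omit i zs)"]
        by (simp add: snd0 length_omit)
      moreover have "snd (csd zs) = 0" using csd_embed[of "map fst zs"] zs * by simp
      ultimately show ?thesis by (simp add: F)
    next
      case 3
      then obtain us v ws where *: "zs = map embed us @ (0, v) # map embed ws" using vdeg_eq_1 zs by blast
      have len: "length us + length ws = n - 1" using * zs by simp
      have k: "length us < n" using len n by simp
      have "mu (map fst (omit (skip (length us) i) zs)) (snd (zs ! skip (length us) i)) = 0" if "i < n - 1" for i
      proof -
        have "zs ! skip (length us) i = embed ((us @ ws) ! i)"
          using omit_skip_middle(2)[of i "map embed us" "map embed ws" "(0, v)"] that len
          by (simp add: * nth_append)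
        moreover have "skip (length us) i < n" using that by (auto simp: skip_def)
        ultimately show ?thesis
          using additive.zero[OF mu_additive] zs by (simp add: length_omit)
      qed
      then have "(\<Sum>i<n. sg (n - Suc i) (mu (map fst (omit i zs)) (snd (zs ! i)))) =
          sg (n - Suc (length us)) (mu (us @ ws) v)"
        unfolding sum_split_skip[OF k] by (simp add: * omit_append omit_Cons nth_append)
      moreover have "n - Suc (length us) = length ws" using len by simp
      ultimately show ?thesis using csd_mid[OF len, of v] unfolding F by (simp add: *)
    qed
  qed
  then have "F zs = 0" using additive_in_eq_0_of_pure[OF add _ assms] by blast
  then show ?thesis by (simp add: F)
qed

end

text \<open>Here \<open>h\<close> is the horizontal bracket written out by the representation, and
  \<open>m\<close> is the vertical bracket in the closed form that \<open>vV_snoc\<close> later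
  justifies.\<close>

locale o_operator = pre_lie_rep n br s l r mu for n and br :: "'a::ab_group_add list \<Rightarrow> 'a"
    and s :: "'k::field_char_0 \<Rightarrow> 'v::ab_group_add \<Rightarrow> 'v" and l r mu +
  fixes T :: "'v \<Rightarrow> 'a" and h m :: "'v list \<Rightarrow> 'v"
  assumes h_def: "h us = l (map T (butlast us)) (last us) + (\<Sum>i<n - 1. sg i (r (map T (omit i us)) (us ! i)))"
    and m_def: "m us = mu (map T (butlast us)) (last us)"
    and T_additive: "additive T"
    and br_T: "length us = n \<Longrightarrow> br (map T us) = T (h us)"
begin

definition graph :: "'v \<Rightarrow> 'a \<times> 'v" where
  "graph u = (T u, u)"

lemma fst_graph [simp]: "fst (graph u) = T u" and snd_graph [simp]: "snd (graph u) = u"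
  by (simp_all add: graph_def)

lemma map_fst_graph [simp]: "map (fst \<circ> graph) us = map T us"
  by simp

lemma graph_sg: "graph (sg k u) = sg k (graph u)"
  by (simp add: prod_eq_iff fst_sg snd_sg additive_sg[OF T_additive])

lemma graph_sum: "graph (sum f I) = (\<Sum>i\<in>I. graph (f i))"
  by (simp add: prod_eq_iff fst_sum snd_sum additive.sum[OF T_additive])

lemma graph_add: "graph (u + v) = graph u + graph v"
  by (simp add: prod_eq_iff additive.add[OF T_additive])

lemma sd_graph:
  assumes "length us = n" shows "sd (map graph us) = graph (h us)"
proof -
  have "us \<noteq> []" using assms n by auto
  then show ?thesis
    using assms by (simp add: prod_eq_iff br_T) (simp add: sd_def h_def br_T map_omit last_map flip: map_butlast)
qed

lemma csd_graph:
  assumes "length us = n" shows "csd (map graph us) = graph (cm n h us)"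
proof -
  have "sd (omit i (map graph us) @ [map graph us ! i]) = graph (h (omit i us @ [us ! i]))" if "i < n" for i
    using sd_graph[of "omit i us @ [us ! i]"] that assms by (simp add: map_omit length_omit)
  then show ?thesis by (simp add: cm_def graph_sum graph_sg)
qed

lemma T_cm: "length us = n \<Longrightarrow> T (cm n h us) = cm n br (map T us)"
  using arg_cong[OF csd_graph, of us fst] fst_csd[of "map graph us"] by simp

text \<open>The second component of the commutator on the graph is read in two ways: by closedness
  of the graph as the commutator of \<open>h\<close>, and by \<open>snd_csd\<close> as a signed sum
  of values of \<open>mu\<close>, which is the commutator of \<open>m\<close>.\<close>

lemma cm_h_eq_cm_m:
  assumes "length us = n" shows "cm n h us = cm n m us"
proof -
  have "cm n h us = snd (csd (map graph us))" using assms by (simp add: csd_graph)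
  also have "\<dots> = (\<Sum>i<n. sg (n - Suc i) (mu (map fst (omit i (map graph us))) (snd (map graph us ! i))))"
    by (rule snd_csd) (use assms in simp)
  also have "\<dots> = cm n m us"
    unfolding cm_def m_def using assms by (auto simp: map_omit intro!: sum.cong)
  finally show ?thesis .
qed

text \<open>The map \<open>graph\<close> intertwines \<open>h\<close> with \<open>sd\<close> and the
  commutators as well, and it has \<open>snd\<close> as a left inverse; so each identity for
  \<open>h\<close> is the second component of one for \<open>sd\<close>.\<close>

lemma pre_lie_h: "pre_lie n h"
proof
  show "additive_in n h"
  proof (rule additive_inI)
    fix us ws :: "'v list" assume len: "Suc (length us + length ws) = n"
    have "additive (\<lambda>x. snd (sd (map graph us @ graph x # map graph ws)))"
      using additive_comp[OF additive_snd[OF additive_inD[OF sd_additive_in, of "map graph us" "map graph ws"]], of graph]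
        len by (simp add: additive_def[of graph] graph_add)
    moreover have "h (us @ x # ws) = snd (sd (map graph us @ graph x # map graph ws))" for x
      using sd_graph[of "us @ x # ws"] len by simp
    ultimately show "additive (\<lambda>x. h (us @ x # ws))" by simp
  qed
  show "alternating (n - 1) n h"
  proof (rule alternatingI)
    fix us vs ws :: "'v list" and a
    assume len: "length us + length vs + 2 \<le> n - 1" "length us + length vs + length ws + 2 = n"
    have "sd (map graph (us @ a # vs @ a # ws)) = 0"
      by (rule alternatingD[OF sd_alternating, of _ "length us" "Suc (length us + length vs)"])
         (use len n in \<open>auto simp: nth_append\<close>)
    then show "h (us @ a # vs @ a # ws) = 0"
      using sd_graph[of "us @ a # vs @ a # ws"] len by (simp add: prod_eq_iff)
  qed simp
next
  fix xs ys :: "'v list" assume len: "length xs = n - 1" "length ys = n"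
  have "ys \<noteq> []" using len n by auto
  have 1: "sd (map graph xs @ [sd (map graph ys)]) = graph (h (xs @ [h ys]))"
    using sd_graph[of "xs @ [h ys]"] sd_graph[of ys] len n by simp
  have 2: "sd ((map graph ys)[i := csd (map graph xs @ [map graph ys ! i])]) =
      graph (h (ys[i := cm n h (xs @ [ys ! i])]))" if "i < n - 1" for i
    using sd_graph[of "ys[i := cm n h (xs @ [ys ! i])]"] csd_graph[of "xs @ [ys ! i]"] that len n
    by (simp add: map_update)
  have 3: "sd (butlast (map graph ys) @ [sd (map graph xs @ [last (map graph ys)])]) =
      graph (h (butlast ys @ [h (xs @ [last ys])]))"
    using sd_graph[of "butlast ys @ [h (xs @ [last ys])]"] sd_graph[of "xs @ [last ys]"] len n \<open>ys \<noteq> []\<close>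
    by (simp add: last_map map_butlast)
  have "graph (h (xs @ [h ys])) = (\<Sum>i<n - 1. graph (h (ys[i := cm n h (xs @ [ys ! i])])))
      + graph (h (butlast ys @ [h (xs @ [last ys])]))"
    using sd.left[of "map graph xs" "map graph ys"] len unfolding 1 3 using 2 by simp
  from arg_cong[OF this, of snd]
  show "h (xs @ [h ys]) = (\<Sum>i<n - 1. h (ys[i := cm n h (xs @ [ys ! i])]))
      + h (butlast ys @ [h (xs @ [last ys])])"
    by (simp add: snd_sum)
next
  fix xs ys :: "'v list" assume len: "length xs = n" "length ys = n - 1"
  have 1: "sd (csd (map graph xs) # map graph ys) = graph (h (cm n h xs # ys))"
    using sd_graph[of "cm n h xs # ys"] csd_graph[of xs] len n by simp
  have 2: "sd (omit i (map graph xs) @ [sd (map graph xs ! i # map graph ys)]) =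
      graph (h (omit i xs @ [h (xs ! i # ys)]))" if "i < n" for i
    using sd_graph[of "omit i xs @ [h (xs ! i # ys)]"] sd_graph[of "xs ! i # ys"] that len n
    by (simp add: map_omit length_omit)
  have "graph (h (cm n h xs # ys)) = (\<Sum>i<n. sg (n - Suc i) (graph (h (omit i xs @ [h (xs ! i # ys)]))))"
    using sd.right[of "map graph xs" "map graph ys"] len unfolding 1 using 2 by simp
  from arg_cong[OF this, of snd]
  show "h (cm n h xs # ys) = (\<Sum>i<n. sg (n - Suc i) (h (omit i xs @ [h (xs ! i # ys)])))"
    by (simp add: snd_sum snd_sg)
qed (rule n)

lemma m_snoc: "m (us @ [u]) = mu (map T us) u"
  by (simp add: m_def)

text \<open>The commutator of \<open>m\<close> is that of \<open>h\<close>, so \<open>T\<close>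
  takes it to the commutator of \<open>br\<close>. Hence the two identities for \<open>m\<close> are
  \<open>mu_commutator\<close> and \<open>mu_cm\<close> at elements \<open>T u\<close>.\<close>

lemma pre_lie_m: "pre_lie n m"
proof
  show "additive_in n m"
  proof (rule additive_inI)
    fix us ws :: "'v list" assume len: "Suc (length us + length ws) = n"
    show "additive (\<lambda>x. m (us @ x # ws))"
    proof (cases ws rule: rev_cases)
      case Nil
      then show ?thesis using mu_additive[of "map T us"] len by (simp add: m_snoc)
    next
      case (snoc ws' w)
      have "additive (\<lambda>x. mu (map T us @ T x # map T ws') w)"
        using additive_comp[OF additive_inD[OF mu_additive_in, of "map T us" "map T ws'"] T_additive] snoc len
        by simp
      then show ?thesis using m_snoc[of "us @ x # ws'" w for x] by (simp add: snoc)
    qed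
  qed
  show "alternating (n - 1) n m"
  proof (rule alternatingI)
    fix us vs ws :: "'v list" and a
    assume len: "length us + length vs + 2 \<le> n - 1" "length us + length vs + length ws + 2 = n"
    then obtain ws' w where ws: "ws = ws' @ [w]" by (cases ws rule: rev_cases) auto
    have "mu (map T (us @ a # vs @ a # ws')) w = 0"
      by (rule alternatingD[OF mu_alternating, of _ "length us" "Suc (length us + length vs)"])
         (use len ws n in \<open>auto simp: nth_append\<close>)
    then show "m (us @ a # vs @ a # ws) = 0"
      using m_snoc[of "us @ a # vs @ a # ws'" w] by (simp add: ws)
  qed simp
next
  fix xs ys :: "'v list" assume len: "length xs = n - 1" "length ys = n"
  obtain ys' y where ys: "ys = ys' @ [y]" using len n by (cases ys rule: rev_cases) auto
  have ys': "length ys' = n - 1" using len ys by simp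
  have "m (ys[i := cm n m (xs @ [ys ! i])]) =
      mu ((map T ys')[i := cm n br (map T xs @ [map T ys' ! i])]) y" if "i < n - 1" for i
    using that ys' len n T_cm[of "xs @ [ys' ! i]"] cm_h_eq_cm_m[of "xs @ [ys' ! i]"]
    by (simp add: ys list_update_append nth_append m_snoc map_update)
  then show "m (xs @ [m ys]) = (\<Sum>i<n - 1. m (ys[i := cm n m (xs @ [ys ! i])]))
      + m (butlast ys @ [m (xs @ [last ys])])"
    using mu_commutator[of "map T xs" "map T ys'" y] len ys' by (simp add: ys m_snoc)
next
  fix xs ys :: "'v list" assume len: "length xs = n" "length ys = n - 1"
  obtain ys' y where ys: "ys = ys' @ [y]" using len n by (cases ys rule: rev_cases) auto
  have 1: "m (cm n m xs # ys) = mu (cm n br (map T xs) # map T ys') y"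
    using T_cm[OF len(1)] cm_h_eq_cm_m[OF len(1)] m_snoc[of "cm n m xs # ys'" y] by (simp add: ys)
  have 2: "m (omit i xs @ [m (xs ! i # ys)]) = mu (omit i (map T xs)) (mu (map T xs ! i # map T ys') y)"
    if "i < n" for i
    using that len m_snoc[of "xs ! i # ys'" y] by (simp add: ys m_snoc map_omit)
  have "length (map T xs) = n" "length (map T ys') = n - 2" using len ys by simp_all
  from mu_cm[OF this, of y]
  show "m (cm n m xs # ys) = (\<Sum>i<n. sg (n - Suc i) (m (omit i xs @ [m (xs ! i # ys)])))"
    using 2 by (simp add: 1)
qed (rule n)

end

section \<open>Carriers\<close>

lemma vecs_snoc: "xs \<in> vecs (n - 1) A \<Longrightarrow> x \<in> A \<Longrightarrow> n \<ge> 2 \<Longrightarrow> xs @ [x] \<in> vecs n A"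
  and vecs_Cons: "xs \<in> vecs (n - 1) A \<Longrightarrow> x \<in> A \<Longrightarrow> n \<ge> 2 \<Longrightarrow> x # xs \<in> vecs n A"
  by (auto simp: vecs_def)

lemma vecs_update: "ys \<in> vecs k A \<Longrightarrow> a \<in> A \<Longrightarrow> ys[i := a] \<in> vecs k A"
  by (simp add: vecs_def set_update_subsetI)

lemma vecs_omit: "xs \<in> vecs k A \<Longrightarrow> i < k \<Longrightarrow> omit i xs \<in> vecs (k - 1) A"
  using set_omit_subset[of i xs] by (auto simp: vecs_def length_omit)

lemma vecs_nth: "xs \<in> vecs k A \<Longrightarrow> i < k \<Longrightarrow> xs ! i \<in> A"
  by (auto simp: vecs_def)

lemma vecs_map: "xs \<in> vecs k A \<Longrightarrow> (\<And>x. x \<in> A \<Longrightarrow> f x \<in> B) \<Longrightarrow> map f xs \<in> vecs k B"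
  by (auto simp: vecs_def)

lemma vecs_omit_snoc: "xs \<in> vecs n A \<Longrightarrow> i < n \<Longrightarrow> n \<ge> 2 \<Longrightarrow> omit i xs @ [xs ! i] \<in> vecs n A"
  and vecs_nth_omit: "xs \<in> vecs n A \<Longrightarrow> i < n \<Longrightarrow> n \<ge> 2 \<Longrightarrow> xs ! i # omit i xs \<in> vecs n A"
  by (rule vecs_snoc vecs_Cons; simp only: vecs_omit vecs_nth)+

lemma vecs_snocE:
  assumes "xs \<in> vecs n A" "n \<ge> 1"
  obtains ys y where "xs = ys @ [y]" "ys \<in> vecs (n - 1) A" "y \<in> A"
  using assms by (cases xs rule: rev_cases) (auto simp: vecs_def)

lemma (in vector_space) scale_minus_one_power: "scale ((- 1) ^ k) x = sg k x"
  by (cases "even k") (simp_all add: sg_def)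

text \<open>List updates are replaced by a splitting at the slot, as in \<open>additive_in\<close>.
  An element of \<open>A\<close> is required to fill the free slot and obtain a list of full
  length.\<close>

lemma multilinear_map_append_iff:
  "multilinear_map k sA A sB B f \<longleftrightarrow> (\<forall>xs\<in>vecs k A. f xs \<in> B) \<and>
    (\<forall>us ws. us @ ws \<in> vecs (k - 1) A \<and> k > 0 \<and> A \<noteq> {} \<longrightarrow> linear_map sA A sB B (\<lambda>x. f (us @ x # ws)))"
proof -
  have 1: "linear_map sA A sB B (\<lambda>x. f (us @ x # ws))"
    if lin: "\<forall>xs\<in>vecs k A. \<forall>i<k. linear_map sA A sB B (\<lambda>x. f (xs[i := x]))"
      and us: "us @ ws \<in> vecs (k - 1) A" "k > 0" "A \<noteq> {}" for us ws
  proof -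
    obtain a where a: "a \<in> A" using us by auto
    have "us @ a # ws \<in> vecs k A" "length us < k" using us a by (auto simp: vecs_def)
    with lin have "linear_map sA A sB B (\<lambda>x. f ((us @ a # ws)[length us := x]))" by blast
    then show ?thesis by (simp add: list_update_append)
  qed
  have 2: "linear_map sA A sB B (\<lambda>x. f (xs[i := x]))"
    if lin: "\<forall>us ws. us @ ws \<in> vecs (k - 1) A \<and> k > 0 \<and> A \<noteq> {} \<longrightarrow> linear_map sA A sB B (\<lambda>x. f (us @ x # ws))"
      and xs: "xs \<in> vecs k A" "i < k" for xs i
  proof -
    have "take i xs @ drop (Suc i) xs \<in> vecs (k - 1) A"
      using vecs_omit[OF xs] by (simp add: omit_def)
    moreover have "A \<noteq> {}" using xs vecs_nth by fastforce
    ultimately have "linear_map sA A sB B (\<lambda>x. f (take i xs @ x # drop (Suc i) xs))" using lin xs by auto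
    then show ?thesis using xs by (simp add: upd_conv_take_nth_drop vecs_def)
  qed
  show ?thesis unfolding multilinear_map_def using 1 2 by blast
qed

lemma multilinear_map_slot:
  assumes "multilinear_map k sA A sB B f" "us @ ws \<in> vecs (k - 1) A" "k > 0"
  shows "linear_map sA A sB B (\<lambda>x. f (us @ x # ws))"
proof (cases "A = {}")
  case False
  then show ?thesis using assms unfolding multilinear_map_append_iff by blast
qed (simp add: linear_map_def)

lemma multilinear_mapI:
  assumes "\<And>xs. xs \<in> vecs k A \<Longrightarrow> f xs \<in> B"
    and "\<And>us ws. us @ ws \<in> vecs (k - 1) A \<Longrightarrow> k > 0 \<Longrightarrow> linear_map sA A sB B (\<lambda>x. f (us @ x # ws))"
  shows "multilinear_map k sA A sB B f"
  unfolding multilinear_map_append_iff using assms by blast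

section \<open>Passage between carriers and whole types\<close>

lemma subspace_projection:
  fixes s :: "'k::field \<Rightarrow> 'a::ab_group_add \<Rightarrow> 'a"
  assumes "vector_space s" "module.subspace s A"
  obtains proj where "module_hom s s proj" "\<And>x. proj x \<in> A" "\<And>x. x \<in> A \<Longrightarrow> proj x = x"
proof -
  interpret vector_space_pair s s using assms(1) by (simp add: vector_space_pair_def)
  have "Vector_Spaces.linear s s (\<lambda>x. x)" using assms(1) by (simp add: Vector_Spaces.linear_iff)
  then obtain proj where "range proj \<subseteq> A" "Vector_Spaces.linear s s proj" "\<forall>x\<in>A. proj x = x"
    \<comment> \<open>A left inverse of the inclusion of the subspace, extended to the whole
      space.\<close>
    using linear_exists_left_inverse_on[of "\<lambda>x. x" A] assms by auto
  then show ?thesis using that[of proj] by (auto simp: module_hom_iff_linear)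
qed

lemma module_hom_additive: "module_hom s s' f \<Longrightarrow> additive f"
  by (simp add: additive_def module_hom.add)

lemma linear_map_additive_proj:
  fixes proj :: "'a::ab_group_add \<Rightarrow> 'a"
  assumes "linear_map sA A sB B f" "additive proj" "\<And>x. proj x \<in> A"
  shows "additive (\<lambda>x. f (proj x))"
  using assms by (simp add: linear_map_def additive_def)

lemma multilinear_map_additive_in_proj:
  fixes proj :: "'a::ab_group_add \<Rightarrow> 'a"
  assumes "multilinear_map k sA A sB B f" "additive proj" "\<And>x. proj x \<in> A"
  shows "additive_in k (\<lambda>xs. f (map proj xs))"
proof (rule additive_inI)
  fix us ws :: "'a list" assume "Suc (length us + length ws) = k"
  then have "map proj us @ map proj ws \<in> vecs (k - 1) A" "k > 0" using assms(3) by (auto simp: vecs_def)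
  from linear_map_additive_proj[OF multilinear_map_slot[OF assms(1) this] assms(2,3)]
  show "additive (\<lambda>x. f (map proj (us @ x # ws)))" by simp
qed

lemma alternating_proj:
  fixes proj :: "'a \<Rightarrow> 'a"
  assumes "alternating_in {..<m} k A f" "m \<le> k" "\<And>x. proj x \<in> A"
  shows "alternating m k (\<lambda>xs. f (map proj xs))"
  unfolding alternating_in_def
proof (intro ballI impI)
  fix xs :: "'a list" and i j
  assume *: "xs \<in> vecs k UNIV" "i \<in> {..<m}" "j \<in> {..<m}" "i \<noteq> j \<and> xs ! i = xs ! j"
  have "map proj xs \<in> vecs k A" using vecs_map[OF *(1)] assms(3) by blast
  moreover have "map proj xs ! i = map proj xs ! j" using * assms(2) by (auto simp: vecs_def)
  ultimately show "f (map proj xs) = 0" using assms(1) * unfolding alternating_in_def by blast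
qed

lemma commutator_mem:
  assumes "vector_space s" "module.subspace s A" "\<And>xs. xs \<in> vecs n A \<Longrightarrow> br xs \<in> A"
    and "xs \<in> vecs n A" "n \<ge> 2"
  shows "commutator n s br xs \<in> A"
proof -
  interpret vector_space s by fact
  show ?thesis
    unfolding commutator_def using assms
    by (intro subspace_sum subspace_scale) (auto intro: vecs_omit_snoc)
qed

lemma commutator_eq_cm:
  assumes "vector_space s"
  shows "commutator n s br xs = cm n br xs"
  by (simp add: commutator_def cm_def vector_space.scale_minus_one_power[OF assms])

lemma cm_cong:
  assumes "\<And>xs. xs \<in> vecs n A \<Longrightarrow> f xs = g xs" "xs \<in> vecs n A" "n \<ge> 2"
  shows "cm n f xs = cm n g xs"
  unfolding cm_def by (rule sum.cong) (use assms in \<open>simp_all add: vecs_omit_snoc\<close>)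

lemma cm_proj:
  "length xs = n \<Longrightarrow> cm n (\<lambda>xs. f (map proj xs)) xs = cm n f (map proj xs)"
  by (simp add: cm_def map_omit)

text \<open>All values of \<open>br\<close> and of its commutator at projected arguments lie in
  \<open>A\<close>, where \<open>proj\<close> is the identity. So projecting again inside nested
  brackets changes nothing.\<close>

lemma pre_lie_proj:
  fixes proj :: "'a::ab_group_add \<Rightarrow> 'a"
  assumes "n \<ge> 2" and alg: "n_pre_lie_algebra n s A br"
    and proj: "additive proj" "\<And>x. proj x \<in> A" "\<And>x. x \<in> A \<Longrightarrow> proj x = x"
  shows "pre_lie n (\<lambda>xs. br (map proj xs))"
proof -
  have vs: "vector_space s" and sub: "module.subspace s A"
    using alg by (auto simp: n_pre_lie_algebra_def fd_space_def)
  have br: "br xs \<in> A" if "xs \<in> vecs n A" for xs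
    using that alg by (auto simp: n_pre_lie_algebra_def multilinear_map_def)
  have cm: "cm n br xs \<in> A" if "xs \<in> vecs n A" for xs
    using commutator_mem[OF vs sub br that \<open>n \<ge> 2\<close>] by (simp add: commutator_eq_cm[OF vs])
  have vecs: "map proj xs \<in> vecs k A" if "length xs = k" for xs k
    using that proj by (auto simp: vecs_def)
  show ?thesis
  proof
    show "additive_in n (\<lambda>xs. br (map proj xs))" "alternating (n - 1) n (\<lambda>xs. br (map proj xs))"
      using alg proj by (auto simp: n_pre_lie_algebra_def
          intro!: multilinear_map_additive_in_proj alternating_proj)
  next
    fix xs ys :: "'a list" assume len: "length xs = n - 1" "length ys = n"
    let ?X = "map proj xs" and ?Y = "map proj ys"
    have X: "?X \<in> vecs (n - 1) A" and Y: "?Y \<in> vecs n A" using len by (blast intro: vecs)+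
    have ys: "ys \<noteq> []" using len \<open>n \<ge> 2\<close> by auto
    have "br (?X @ [br ?Y]) = (\<Sum>i<n - 1. br (?Y[i := cm n br (?X @ [?Y ! i])]))
        + br (butlast ?Y @ [br (?X @ [last ?Y])])"
      using alg X Y by (simp add: n_pre_lie_algebra_def commutator_eq_cm[OF vs])
    moreover have "?Y[i := cm n br (?X @ [?Y ! i])] =
        map proj (ys[i := cm n (\<lambda>xs. br (map proj xs)) (xs @ [ys ! i])])" if "i < n - 1" for i
      using that len \<open>n \<ge> 2\<close> proj(3)[OF cm[OF vecs_snoc[OF X]]] vecs_nth[OF Y, of i]
      by (simp add: map_update cm_proj)
    moreover have "br (?X @ [last ?Y]) \<in> A"
      using ys by (intro br vecs_snoc[OF X] \<open>n \<ge> 2\<close>) (simp add: last_map proj)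
    ultimately show "br (map proj (xs @ [br ?Y])) =
        (\<Sum>i<n - 1. br (map proj (ys[i := cm n (\<lambda>xs. br (map proj xs)) (xs @ [ys ! i])])))
        + br (map proj (butlast ys @ [br (map proj (xs @ [last ys]))]))"
      using ys by (simp add: proj(3) br[OF Y] map_butlast last_map)
  next
    fix xs ys :: "'a list" assume len: "length xs = n" "length ys = n - 1"
    let ?X = "map proj xs" and ?Y = "map proj ys"
    have X: "?X \<in> vecs n A" and Y: "?Y \<in> vecs (n - 1) A" using len by (blast intro: vecs)+
    have "br (cm n br ?X # ?Y) = (\<Sum>i<n. sg (n - Suc i) (br (omit i ?X @ [br (?X ! i # ?Y)])))"
      using alg X Y by (simp add: n_pre_lie_algebra_def commutator_eq_cm[OF vs]
          vector_space.scale_minus_one_power[OF vs])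
    moreover have "br (proj (xs ! i) # ?Y) \<in> A" for i
      by (intro br vecs_Cons[OF Y] \<open>n \<ge> 2\<close> proj)
    ultimately show "br (map proj (cm n (\<lambda>xs. br (map proj xs)) xs # ys)) =
        (\<Sum>i<n. sg (n - Suc i) (br (map proj (omit i xs @ [br (map proj (xs ! i # ys))]))))"
      using len by (simp add: cm_proj proj(3) cm[OF X] map_omit)
  qed (rule \<open>n \<ge> 2\<close>)
qed

text \<open>The way back from total brackets: multilinearity of \<open>g\<close> into
  \<open>V\<close> keeps every nested argument in \<open>V\<close>, where \<open>f\<close> and
  \<open>g\<close> agree.\<close>

lemma n_pre_lie_algebra_of_pre_lie:
  assumes "pre_lie n f" "fd_space s V" "multilinear_map n s V s V g"
    and eq: "\<And>us. us \<in> vecs n V \<Longrightarrow> g us = f us"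
  shows "n_pre_lie_algebra n s V g"
proof -
  interpret pre_lie n f by fact
  have vs: "vector_space s" and sub: "module.subspace s V"
    using assms(2) by (auto simp: fd_space_def)
  have g: "g us \<in> V" if "us \<in> vecs n V" for us
    using that assms(3) by (auto simp: multilinear_map_def)
  have f: "f us \<in> V" if "us \<in> vecs n V" for us using g that eq by simp
  have cm: "commutator n s g us = cm n f us" if "us \<in> vecs n V" for us
    unfolding commutator_eq_cm[OF vs] using cm_cong eq that n by blast
  have cmV: "cm n f us \<in> V" if "us \<in> vecs n V" for us
    using commutator_mem[OF vs sub f that n] by (simp add: commutator_eq_cm[OF vs])
  have "alternating_in {..<n - 1} n V g"
    using br_alternating eq by (auto simp: alternating_in_def vecs_def)
  moreover have "g (xs @ [g ys]) = (\<Sum>i<n - 1. g (ys[i := commutator n s g (xs @ [ys ! i])]))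
      + g (butlast ys @ [g (xs @ [last ys])])" if xs: "xs \<in> vecs (n - 1) V" and ys: "ys \<in> vecs n V" for xs ys
  proof -
    obtain ys' y where y: "ys = ys' @ [y]" "ys' \<in> vecs (n - 1) V" "y \<in> V"
      using vecs_snocE[OF ys] n by auto
    have 1: "g (ys[i := commutator n s g (xs @ [ys ! i])]) = f (ys[i := cm n f (xs @ [ys ! i])])" if "i < n - 1" for i
    proof -
      have i: "xs @ [ys ! i] \<in> vecs n V" using that n by (intro vecs_snoc[OF xs] vecs_nth[OF ys]) auto
      show ?thesis unfolding cm[OF i] by (intro eq vecs_update[OF ys] cmV i)
    qed
    have 2: "xs @ [y] \<in> vecs n V" using vecs_snoc[OF xs] y n by blast
    have "g (xs @ [g ys]) = f (xs @ [f ys])"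
      using eq[OF ys] eq[OF vecs_snoc[OF xs f[OF ys] n]] by simp
    moreover have "g (ys' @ [g (xs @ [y])]) = f (ys' @ [f (xs @ [y])])"
      using eq[OF 2] eq[OF vecs_snoc[OF y(2) f[OF 2] n]] by simp
    ultimately show ?thesis
      using left[of xs ys] xs ys 1 by (simp add: vecs_def y)
  qed
  moreover have "g (commutator n s g xs # ys) =
      (\<Sum>i<n. s ((-1) ^ (n - Suc i)) (g (omit i xs @ [g (xs ! i # ys)])))"
    if xs: "xs \<in> vecs n V" and ys: "ys \<in> vecs (n - 1) V" for xs ys
  proof -
    have "g (omit i xs @ [g (xs ! i # ys)]) = f (omit i xs @ [f (xs ! i # ys)])" if "i < n" for i
    proof -
      have i: "xs ! i # ys \<in> vecs n V" using that n by (intro vecs_Cons[OF ys] vecs_nth[OF xs]) auto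
      show ?thesis
        unfolding eq[OF i] by (intro eq vecs_snoc[OF vecs_omit[OF xs that]] f[OF i] n)
    qed
    moreover have "g (commutator n s g xs # ys) = f (cm n f xs # ys)"
      unfolding cm[OF xs] by (intro eq vecs_Cons[OF ys] cmV[OF xs] n)
    ultimately show ?thesis
      using right[of xs ys] xs ys by (simp add: vecs_def vector_space.scale_minus_one_power[OF vs])
  qed
  ultimately show ?thesis using assms by (simp add: n_pre_lie_algebra_def)
qed

section \<open>The operations on the domain of an O-operator\<close>

lemma linear_map_comp:
  "linear_map sA A sB B f \<Longrightarrow> linear_map sB B sC C g \<Longrightarrow> linear_map sA A sC C (\<lambda>x. g (f x))"
  by (simp add: linear_map_def)

lemma linear_map_add:
  assumes "vector_space sB" "module.subspace sB B" "linear_map sA A sB B f" "linear_map sA A sB B g"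
  shows "linear_map sA A sB B (\<lambda>x. f x + g x)"
proof -
  interpret vector_space sB by fact
  show ?thesis using assms(2-4) by (auto simp: linear_map_def subspace_add scale_right_distrib)
qed

lemma linear_map_scale:
  assumes "vector_space sB" "module.subspace sB B" "linear_map sA A sB B f"
  shows "linear_map sA A sB B (\<lambda>x. sB c (f x))"
proof -
  interpret vector_space sB by fact
  show ?thesis
    using assms(2,3) by (auto simp: linear_map_def subspace_scale scale_right_distrib mult.commute)
qed

lemma linear_map_sum:
  assumes "vector_space sB" "module.subspace sB B" "finite I"
    and "\<And>i. i \<in> I \<Longrightarrow> linear_map sA A sB B (f i)"
  shows "linear_map sA A sB B (\<lambda>x. \<Sum>i\<in>I. f i x)"
  using assms(3,4)
proof (induction I rule: finite_induct)
  case empty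
  interpret vector_space sB by fact
  show ?case using assms(2) by (simp add: linear_map_def subspace_0)
next
  case (insert i I)
  then have "linear_map sA A sB B (\<lambda>x. f i x + (\<Sum>i\<in>I. f i x))"
    by (intro linear_map_add[OF assms(1,2)]) simp_all
  then show ?case using insert.hyps by simp
qed

lemma less_lengthE:
  assumes "i < Suc (length us + length ws)"
  obtains "i < length us" | "i = length us" | j where "i = Suc (length us + j)" "j < length ws"
  using assms less_iff_Suc_add[of "length us" i] by force

text \<open>Each summand permutes the arguments, so the free argument again fills a single slot of
  \<open>ne\<close>; which one depends on whether \<open>i\<close> lies before, at or after
  it.\<close>

lemma multilinear_map_hor:
  assumes vs: "vector_space s" and sub: "module.subspace s V" and "n \<ge> 2"
    and nw: "multilinear_map n s V s V nw" and ne: "multilinear_map n s V s V ne"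
  shows "multilinear_map n s V s V (hor n s nw ne)"
proof (rule multilinear_mapI)
  interpret vector_space s by fact
  fix xs assume xs: "xs \<in> vecs n V"
  have "xs ! i # omit i xs \<in> vecs n V" if "i < n - 1" for i
    by (rule vecs_nth_omit[OF xs]) (use that \<open>n \<ge> 2\<close> in auto)
  then show "hor n s nw ne xs \<in> V"
    unfolding hor_def using sub nw ne xs
    by (intro subspace_add subspace_sum subspace_scale) (auto simp: multilinear_map_def)
next
  fix us ws assume uw: "us @ ws \<in> vecs (n - 1) V"
  then have len: "Suc (length us + length ws) = n" using \<open>n \<ge> 2\<close> by (auto simp: vecs_def)
  have "linear_map s V s V (\<lambda>x. ne ((us @ x # ws) ! i # omit i (us @ x # ws)))" if "i < n - 1" for i
  proof -
    have "i < Suc (length us + length ws)" using that len by simp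
    then show ?thesis
    proof (cases rule: less_lengthE)
      case 1
      then have "(us ! i # omit i us) @ ws \<in> vecs (n - 1) V"
        using uw set_omit_subset[of i us] by (auto simp: vecs_def length_omit)
      from multilinear_map_slot[OF ne this] show ?thesis
        using len 1 by (simp add: omit_append nth_append)
    next
      case 2
      then show ?thesis
        using multilinear_map_slot[OF ne, of "[]" "us @ ws"] uw len by (simp add: omit_append omit_Cons)
    next
      case (3 j)
      then have "(ws ! j # us) @ omit j ws \<in> vecs (n - 1) V"
        using uw set_omit_subset[of j ws] by (auto simp: vecs_def length_omit)
      from multilinear_map_slot[OF ne this] show ?thesis
        using len 3 by (simp add: omit_append omit_Cons nth_append)
    qed
  qed
  then show "linear_map s V s V (\<lambda>x. hor n s nw ne (us @ x # ws))"
    unfolding hor_def using multilinear_map_slot[OF nw uw] \<open>n \<ge> 2\<close>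
    by (intro linear_map_add[OF vs sub] linear_map_sum[OF vs sub] linear_map_scale[OF vs sub]) auto
qed

lemma multilinear_map_ver:
  assumes vs: "vector_space s" and sub: "module.subspace s V" and "n \<ge> 2"
    and nw: "multilinear_map n s V s V nw" and ne: "multilinear_map n s V s V ne"
  shows "multilinear_map n s V s V (ver n s nw ne)"
proof (rule multilinear_mapI)
  interpret vector_space s by fact
  fix xs assume "xs \<in> vecs n V"
  then obtain ys y where xs: "xs = ys @ [y]" "ys \<in> vecs (n - 1) V" "y \<in> V"
    by (rule vecs_snocE) (use \<open>n \<ge> 2\<close> in auto)
  have len: "length ys = n - 1" using xs by (simp add: vecs_def)
  have "y # omit i ys @ [ys ! i] \<in> vecs n V" if "i < n - 1" for i
  proof -
    have "omit i ys @ [ys ! i] \<in> vecs (n - 1) V"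
      using vecs_nth[OF xs(2) that] vecs_omit[OF xs(2) that] that by (simp add: vecs_def)
    from vecs_Cons[OF this xs(3) \<open>n \<ge> 2\<close>] show ?thesis .
  qed
  then have "ne (last xs # omit i (butlast xs) @ [xs ! i]) \<in> V" if "i < n - 1" for i
    using that ne len by (simp add: xs nth_append multilinear_map_def)
  moreover have "nw xs \<in> V" using nw \<open>xs \<in> vecs n V\<close> by (simp add: multilinear_map_def)
  ultimately show "ver n s nw ne xs \<in> V"
    unfolding ver_def using sub by (intro subspace_add subspace_sum subspace_scale) auto
next
  fix us ws assume uw: "us @ ws \<in> vecs (n - 1) V"
  then have len: "Suc (length us + length ws) = n" using \<open>n \<ge> 2\<close> by (auto simp: vecs_def)
  have "linear_map s V s V (\<lambda>x. ne (last (us @ x # ws) # omit i (butlast (us @ x # ws)) @ [(us @ x # ws) ! i]))"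
    if "i < n - 1" for i
  proof (cases ws rule: rev_cases)
    case Nil
    have us: "us \<in> vecs (n - 1) V" using uw Nil by simp
    have "omit i us @ [us ! i] \<in> vecs (n - 1) V"
      using that vecs_nth[OF us that] vecs_omit[OF us that] by (auto simp: vecs_def)
    then show ?thesis
      using multilinear_map_slot[OF ne, of "[]" "omit i us @ [us ! i]"] that len
      by (auto simp: Nil nth_append)
  next
    case (snoc ws' w)
    have bl: "butlast (us @ x # ws) = us @ x # ws'" for x by (simp add: snoc butlast_append)
    have "i < Suc (length us + length ws')" using that len snoc by simp
    then show ?thesis
    proof (cases rule: less_lengthE)
      case 1
      then have "(w # omit i us) @ ws' @ [us ! i] \<in> vecs (n - 1) V"
        using uw set_omit_subset[of i us] by (auto simp: vecs_def length_omit snoc)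
      from multilinear_map_slot[OF ne this] show ?thesis unfolding bl
        using len 1 by (simp add: snoc omit_append nth_append)
    next
      case 2
      then show ?thesis unfolding bl
        using multilinear_map_slot[OF ne, of "w # us @ ws'" "[]"] uw len
        by (simp add: snoc omit_append omit_Cons vecs_def)
    next
      case (3 j)
      then have "(w # us) @ omit j ws' @ [ws' ! j] \<in> vecs (n - 1) V"
        using uw set_omit_subset[of j ws'] by (auto simp: vecs_def length_omit snoc)
      from multilinear_map_slot[OF ne this] show ?thesis unfolding bl
        using len 3 by (simp add: snoc omit_append omit_Cons nth_append)
    qed
  qed
  then show "linear_map s V s V (\<lambda>x. ver n s nw ne (us @ x # ws))"
    unfolding ver_def using multilinear_map_slot[OF nw uw] \<open>n \<ge> 2\<close>
    by (intro linear_map_add[OF vs sub] linear_map_sum[OF vs sub] linear_map_scale[OF vs sub]) auto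
qed

locale o_operator_setup =
  fixes n :: nat
    and sA :: "'k::field_char_0 \<Rightarrow> 'a::ab_group_add \<Rightarrow> 'a" and A :: "'a set"
    and br :: "'a list \<Rightarrow> 'a"
    and sV :: "'k \<Rightarrow> 'v::ab_group_add \<Rightarrow> 'v" and V :: "'v set"
    and l r :: "'a list \<Rightarrow> 'v \<Rightarrow> 'v"
    and T :: "'v \<Rightarrow> 'a"
    and nw ne :: "'v list \<Rightarrow> 'v"
  assumes n: "n \<ge> 2"
    and alg: "n_pre_lie_algebra n sA A br"
    and rep: "n_pre_lie_rep n sA A br sV V l r"
    and oper: "O_operator n sA A br sV V l r T"
    and nw: "us \<in> vecs n V \<Longrightarrow> nw us = l (map T (butlast us)) (last us)"
    and ne: "us \<in> vecs n V \<Longrightarrow> ne us = r (map T (tl us)) (hd us)"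
begin

lemma vsA: "vector_space sA" and subA: "module.subspace sA A"
  and vsV: "vector_space sV" and subV: "module.subspace sV V" and fdV: "fd_space sV V"
  using alg rep by (auto simp: n_pre_lie_algebra_def n_pre_lie_rep_def fd_space_def)

sublocale A: vector_space sA by (rule vsA)
sublocale V: vector_space sV by (rule vsV)

abbreviation "cA \<equiv> commutator n sA br"
abbreviation "hV \<equiv> hor n sV nw ne"
abbreviation "vV \<equiv> ver n sV nw ne"
abbreviation "cV \<equiv> commutator n sV hV"
abbreviation "mu \<equiv> rep_mu n sV l r"

lemma T_linear: "linear_map sV V sA A T"
  using oper by (simp add: O_operator_def)

lemma T_mem: "v \<in> V \<Longrightarrow> T v \<in> A"
  and T_add: "v \<in> V \<Longrightarrow> w \<in> V \<Longrightarrow> T (v + w) = T v + T w"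
  and T_scale: "v \<in> V \<Longrightarrow> T (sV c v) = sA c (T v)"
  using T_linear by (auto simp: linear_map_def)

lemma T_sum: "finite I \<Longrightarrow> (\<And>i. i \<in> I \<Longrightarrow> f i \<in> V) \<Longrightarrow> T (\<Sum>i\<in>I. f i) = (\<Sum>i\<in>I. T (f i))"
proof (induction I rule: finite_induct)
  case empty
  show ?case using T_scale[of 0 0] subV by (simp add: V.subspace_0)
next
  case (insert i I)
  then show ?case using T_add subV by (simp add: V.subspace_sum)
qed

lemma T_vecs: "us \<in> vecs k V \<Longrightarrow> map T us \<in> vecs k A"
  by (rule vecs_map[OF _ T_mem])

lemma br_mem: "xs \<in> vecs n A \<Longrightarrow> br xs \<in> A"
  using alg by (simp add: n_pre_lie_algebra_def multilinear_map_def)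

lemma cA_mem: "xs \<in> vecs n A \<Longrightarrow> cA xs \<in> A"
  using commutator_mem[of sA A n br] vsA subA br_mem n by blast

lemma gl: "gl_map {..<n - 1} (n - 1) sA A sV V l" "gl_map {..<n - 2} (n - 1) sA A sV V r"
  using rep by (simp_all add: n_pre_lie_rep_def n_lie_rep_def)

lemma l_mem: "xs \<in> vecs (n - 1) A \<Longrightarrow> v \<in> V \<Longrightarrow> l xs v \<in> V"
  and r_mem: "xs \<in> vecs (n - 1) A \<Longrightarrow> v \<in> V \<Longrightarrow> r xs v \<in> V"
  using gl by (auto simp: gl_map_def linear_map_def)

lemma vecs_omit_snoc': "xs \<in> vecs (n - 1) A \<Longrightarrow> i < n - 1 \<Longrightarrow> omit i xs @ [xs ! i] \<in> vecs (n - 1) A"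
  using vecs_nth[of xs "n - 1" A i] vecs_omit[of xs "n - 1" A i] by (auto simp: vecs_def)

lemma mu_mem: "xs \<in> vecs (n - 1) A \<Longrightarrow> v \<in> V \<Longrightarrow> mu xs v \<in> V"
  unfolding rep_mu_def using subV
  by (intro V.subspace_add V.subspace_sum V.subspace_scale l_mem r_mem vecs_omit_snoc') auto

lemma nw_snoc: "us \<in> vecs (n - 1) V \<Longrightarrow> u \<in> V \<Longrightarrow> nw (us @ [u]) = l (map T us) u"
  using nw[OF vecs_snoc[OF _ _ n]] by simp

lemma ne_Cons: "us \<in> vecs (n - 1) V \<Longrightarrow> u \<in> V \<Longrightarrow> ne (u # us) = r (map T us) u"
  using ne[OF vecs_Cons[OF _ _ n]] by simp

lemma nw_multilinear: "multilinear_map n sV V sV V nw"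
proof (rule multilinear_mapI)
  fix us assume "us \<in> vecs n V"
  then obtain us' u where "us = us' @ [u]" "us' \<in> vecs (n - 1) V" "u \<in> V"
    by (rule vecs_snocE) (use n in auto)
  then show "nw us \<in> V" by (simp add: nw_snoc l_mem T_vecs)
next
  fix us ws assume uw: "us @ ws \<in> vecs (n - 1) V"
  then have len: "Suc (length us + length ws) = n" using n by (auto simp: vecs_def)
  show "linear_map sV V sV V (\<lambda>x. nw (us @ x # ws))"
  proof (cases ws rule: rev_cases)
    case Nil
    then have "linear_map sV V sV V (l (map T us))"
      using gl uw T_vecs by (simp add: gl_map_def)
    moreover have "nw (us @ [x]) = l (map T us) x" if "x \<in> V" for x
      using uw that by (intro nw_snoc) (simp add: Nil)
    ultimately show ?thesis using subV
      by (simp add: Nil linear_map_def V.subspace_add V.subspace_scale)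
  next
    case (snoc ws' w)
    have w: "w \<in> V" "map T us @ map T ws' \<in> vecs (n - 1 - 1) A" "n - 1 > 0"
      using uw n T_vecs[of "us @ ws'"] by (auto simp: snoc vecs_def)
    have "multilinear_map (n - 1) sA A sV V (\<lambda>xs. l xs w)"
      using gl w by (simp add: gl_map_def)
    from linear_map_comp[OF T_linear multilinear_map_slot[OF this w(2,3)]]
    have "linear_map sV V sV V (\<lambda>x. l (map T us @ T x # map T ws') w)" .
    moreover have "nw (us @ x # ws) = l (map T us @ T x # map T ws') w" if "x \<in> V" for x
      using uw that w nw_snoc[of "us @ x # ws'" w] by (simp add: snoc vecs_def)
    ultimately show ?thesis using subV
      by (simp add: linear_map_def V.subspace_add V.subspace_scale)
  qed
qed

lemma ne_multilinear: "multilinear_map n sV V sV V ne"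
proof (rule multilinear_mapI)
  fix us assume "us \<in> vecs n V"
  then have "us = hd us # tl us" "tl us \<in> vecs (n - 1) V" "hd us \<in> V"
    using n by (cases us; auto simp: vecs_def)+
  then show "ne us \<in> V" using ne_Cons r_mem T_vecs by metis
next
  fix us ws assume uw: "us @ ws \<in> vecs (n - 1) V"
  show "linear_map sV V sV V (\<lambda>x. ne (us @ x # ws))"
  proof (cases us)
    case Nil
    then have "linear_map sV V sV V (r (map T ws))"
      using gl uw T_vecs by (simp add: gl_map_def)
    moreover have "ne (x # ws) = r (map T ws) x" if "x \<in> V" for x
      using uw that by (intro ne_Cons) (simp_all add: Nil)
    ultimately show ?thesis using subV
      by (simp add: Nil linear_map_def V.subspace_add V.subspace_scale)
  next
    case (Cons u us')
    have u: "u \<in> V" "map T us' @ map T ws \<in> vecs (n - 1 - 1) A" "n - 1 > 0"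
      using uw n T_vecs[of "us' @ ws"] by (auto simp: Cons vecs_def)
    have "multilinear_map (n - 1) sA A sV V (\<lambda>xs. r xs u)"
      using gl u by (simp add: gl_map_def)
    from linear_map_comp[OF T_linear multilinear_map_slot[OF this u(2,3)]]
    have "linear_map sV V sV V (\<lambda>x. r (map T us' @ T x # map T ws) u)" .
    moreover have "ne (us @ x # ws) = r (map T us' @ T x # map T ws) u" if "x \<in> V" for x
      using uw that u ne_Cons[of "us' @ x # ws" u] by (simp add: Cons vecs_def)
    ultimately show ?thesis using subV
      by (simp add: linear_map_def V.subspace_add V.subspace_scale)
  qed
qed

lemma nw_alternating: "alternating_in {..<n - 1} n V nw"
  unfolding alternating_in_def
proof (intro ballI impI)
  fix us i j assume us: "us \<in> vecs n V" and ij: "i \<in> {..<n - 1}" "j \<in> {..<n - 1}" "i \<noteq> j \<and> us ! i = us ! j"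
  obtain us' u where *: "us = us' @ [u]" "us' \<in> vecs (n - 1) V" "u \<in> V"
    using us by (rule vecs_snocE) (use n in auto)
  have "map T us' ! i = map T us' ! j" using ij * by (auto simp: vecs_def nth_append)
  moreover have "alternating_in {..<n - 1} (n - 1) A (\<lambda>xs. l xs u)" using gl * by (simp add: gl_map_def)
  ultimately have "l (map T us') u = 0"
    using ij T_vecs[OF *(2)] unfolding alternating_in_def by blast
  then show "nw us = 0" using * by (simp add: nw_snoc)
qed

lemma ne_alternating: "alternating_in {1..<n - 1} n V ne"
  unfolding alternating_in_def
proof (intro ballI impI)
  fix us i j assume us: "us \<in> vecs n V" and ij: "i \<in> {1..<n - 1}" "j \<in> {1..<n - 1}" "i \<noteq> j \<and> us ! i = us ! j"
  obtain u us' where *: "us = u # us'" "us' \<in> vecs (n - 1) V" "u \<in> V"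
    using us n by (cases us) (auto simp: vecs_def)
  have "map T us' ! (i - 1) = map T us' ! (j - 1)" "i - 1 \<noteq> j - 1" "i - 1 \<in> {..<n - 2}" "j - 1 \<in> {..<n - 2}"
    using ij * by (auto simp: vecs_def nth_Cons')
  moreover have "alternating_in {..<n - 2} (n - 1) A (\<lambda>xs. r xs u)" using gl * by (simp add: gl_map_def)
  ultimately have "r (map T us') u = 0"
    using T_vecs[OF *(2)] unfolding alternating_in_def by blast
  then show "ne us = 0" using * by (simp add: ne_Cons)
qed

lemmas hV_multilinear = multilinear_map_hor[OF vsV subV n nw_multilinear ne_multilinear]
lemmas vV_multilinear = multilinear_map_ver[OF vsV subV n nw_multilinear ne_multilinear]

lemma nw_mem: "us \<in> vecs n V \<Longrightarrow> nw us \<in> V"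
  and ne_mem: "us \<in> vecs n V \<Longrightarrow> ne us \<in> V"
  and hV_mem: "us \<in> vecs n V \<Longrightarrow> hV us \<in> V"
  using nw_multilinear ne_multilinear hV_multilinear
  by (simp_all add: multilinear_map_def)

lemma cV_mem: "us \<in> vecs n V \<Longrightarrow> cV us \<in> V"
  using commutator_mem[of sV V n hV] vsV subV hV_mem n by blast

lemma hV_eq:
  assumes "us \<in> vecs n V"
  shows "hV us = l (map T (butlast us)) (last us) + (\<Sum>i<n - 1. sV ((-1) ^ i) (r (map T (omit i us)) (us ! i)))"
  unfolding hor_def nw[OF assms]
  using ne_Cons[OF vecs_omit[OF assms] vecs_nth[OF assms]] by simp

text \<open>The horizontal bracket is exactly the argument of \<open>T\<close> on the right-hand
  side of the O-operator equation.\<close>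

lemma T_hV: "us \<in> vecs n V \<Longrightarrow> T (hV us) = br (map T us)"
  using oper by (simp add: hV_eq O_operator_def)

lemma T_cV:
  assumes "us \<in> vecs n V" shows "T (cV us) = cA (map T us)"
proof -
  have i: "omit i us @ [us ! i] \<in> vecs n V" if "i < n" for i
    using vecs_omit_snoc[OF assms that n] .
  have "T (cV us) = (\<Sum>i<n. T (sV ((-1) ^ (n - Suc i)) (hV (omit i us @ [us ! i]))))"
    unfolding commutator_def using subV by (intro T_sum V.subspace_scale hV_mem i) auto
  also have "\<dots> = cA (map T us)"
    unfolding commutator_def using i assms
    by (intro sum.cong) (auto simp: T_scale hV_mem T_hV map_omit vecs_def)
  finally show ?thesis .
qed

lemma vV_snoc:
  assumes "us \<in> vecs (n - 1) V" "u \<in> V"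
  shows "vV (us @ [u]) = mu (map T us) u"
proof -
  have len: "length us = n - 1" using assms by (simp add: vecs_def)
  have "ne (u # omit i us @ [us ! i]) = r (omit i (map T us) @ [map T us ! i]) u" if "i < n - 1" for i
  proof -
    have "omit i us @ [us ! i] \<in> vecs (n - 1) V"
      using vecs_nth[OF assms(1) that] vecs_omit[OF assms(1) that] that by (auto simp: vecs_def)
    from ne_Cons[OF this assms(2)] show ?thesis using that len by (simp add: map_omit)
  qed
  then show ?thesis
    unfolding ver_def rep_mu_def nw_snoc[OF assms] using len by (simp add: nth_append)
qed

end

section \<open>The conditions on the representation and the dendriform axioms\<close>

context o_operator_setup
begin

lemma
  assumes "ys \<in> vecs (n - 2) A" "v \<in> V" "xs \<in> vecs n A"
  shows l_cA: "l (cA xs # ys) v =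
      (\<Sum>i<n. sV ((- 1) ^ (n - Suc i)) (l (omit i xs) (l (xs ! i # ys) v)))"
    and r_cA: "r (cA xs # ys) v =
      (\<Sum>i<n. sV ((- 1) ^ (n - Suc i)) (l (omit i xs) (r (xs ! i # ys) v)))"
  using rep assms unfolding n_pre_lie_rep_def n_lie_rep_def by blast+

lemma
  assumes "xs \<in> vecs (n - 1) A" "ys \<in> vecs (n - 1) A" "v \<in> V"
  shows l_l: "l xs (l ys v) - l ys (l xs v) = (\<Sum>i<n - 1. l (ys[i := cA (xs @ [ys ! i])]) v)"
    and l_r: "l xs (r ys v) = r ys (mu xs v) + (\<Sum>i<n - 2. r (ys[i := cA (xs @ [ys ! i])]) v)
        + r (butlast ys @ [br (xs @ [last ys])]) v"
    and r_mu: "r ys (mu xs v) = l xs (r ys v)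
        + (\<Sum>i<n - 1. sV ((- 1) ^ Suc i) (r (omit i xs @ [br (xs ! i # ys)]) v))"
  using rep assms unfolding n_pre_lie_rep_def n_lie_rep_def by blast+

lemma r_br:
  assumes "xs \<in> vecs (n - 2) A" "ys \<in> vecs n A" "v \<in> V"
  shows "r (xs @ [br ys]) v = l (butlast ys) (r (xs @ [last ys]) v)
      + (\<Sum>i<n - 1. sV ((- 1) ^ i) (r (omit i ys) (mu (xs @ [ys ! i]) v)))"
  using rep assms unfolding n_pre_lie_rep_def by blast

text \<open>
  Composing all maps with projections onto \<open>A\<close> and \<open>V\<close> makes the conditions hold for arbitrary lists.
\<close>

lemma total:
  obtains f g where "pre_lie n f" "pre_lie n g"
    "\<And>us. us \<in> vecs n V \<Longrightarrow> f us = hV us" "\<And>us. us \<in> vecs n V \<Longrightarrow> g us = vV us"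
    "\<And>us. us \<in> vecs n V \<Longrightarrow> cm n f us = cm n g us"
proof -
  obtain pA where pA: "module_hom sA sA pA" "\<And>x. pA x \<in> A" "\<And>x. x \<in> A \<Longrightarrow> pA x = x"
    using subspace_projection[OF vsA subA] by blast
  obtain pV where pV: "module_hom sV sV pV" "\<And>x. pV x \<in> V" "\<And>x. x \<in> V \<Longrightarrow> pV x = x"
    using subspace_projection[OF vsV subV] by blast
  note addA = module_hom_additive[OF pA(1)] and addV = module_hom_additive[OF pV(1)]
  \<comment> \<open>The total versions, with arguments projected before use. \<open>mt\<close> and
    \<open>ht\<close> are formed from them by the formulas of the locales and turn out to be
    \<open>mu\<close> and \<open>hV\<close> at projected arguments.\<close>
  define brt where "brt xs = br (map pA xs)" for xs
  define lt where "lt xs v = l (map pA xs) (pV v)" for xs v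
  define rt where "rt xs v = r (map pA xs) (pV v)" for xs v
  define mt where "mt xs v = lt xs v + (\<Sum>i<n - 1. sg (Suc i) (rt (omit i xs @ [xs ! i]) v))" for xs v
  define Tt where "Tt v = T (pV v)" for v
  define ht where "ht us = lt (map Tt (butlast us)) (last us)
      + (\<Sum>i<n - 1. sg i (rt (map Tt (omit i us)) (us ! i)))" for us
  define vt where "vt us = mt (map Tt (butlast us)) (last us)" for us
  have vecs: "map pA xs \<in> vecs k A" if "length xs = k" for xs k
    using that pA by (auto simp: vecs_def)
  have vecsV: "map pV xs \<in> vecs k V" if "length xs = k" for xs k
    using that pV by (auto simp: vecs_def)
  have mt: "mt xs v = mu (map pA xs) (pV v)" if "length xs = n - 1" for xs v
    using that by (simp add: mt_def lt_def rt_def rep_mu_def map_omit V.scale_minus_one_power)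
  have cm: "cm n brt xs = cA (map pA xs)" if "length xs = n" for xs
    using that by (simp add: brt_def[abs_def] cm_proj commutator_eq_cm[OF vsA])
  have pA_br: "pA (br xs) = br xs" "pA (cA xs) = cA xs" if "xs \<in> vecs n A" for xs
    using that by (simp_all add: pA(3) br_mem cA_mem)
  have pV_lr: "pV (l xs v) = l xs v" "pV (r xs v) = r xs v" "pV (mu xs v) = mu xs v"
    if "xs \<in> vecs (n - 1) A" "v \<in> V" for xs v
    using that by (simp_all add: pV(3) l_mem r_mem mu_mem)
  have upd: "map pA (ys[i := cm n brt (xs @ [ys ! i])]) =
      (map pA ys)[i := cA (map pA xs @ [map pA ys ! i])]"
    if "length xs = n - 1" "i < length ys" for xs ys i
  proof -
    have "map pA (xs @ [ys ! i]) \<in> vecs n A" using that n by (intro vecs) simp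
    then show ?thesis using that n by (simp add: map_update cm pA_br)
  qed
  interpret pre_lie n brt
    unfolding brt_def[abs_def] by (rule pre_lie_proj[OF n alg addA pA(2,3)])
  interpret t: pre_lie_rep n brt sV lt rt mt
  proof (intro pre_lie_rep.intro pre_lie_rep_axioms.intro)
    show "pre_lie n brt" by unfold_locales
    show "vector_space sV" by (rule vsV)
    show "additive_in (n - 1) (\<lambda>xs. lt xs v)" "additive_in (n - 1) (\<lambda>xs. rt xs v)" for v
      unfolding lt_def rt_def using gl pV(2)
      by (auto simp: gl_map_def intro!: multilinear_map_additive_in_proj[OF _ addA pA(2)])
    show "alternating (n - 1) (n - 1) (\<lambda>xs. lt xs v)" "alternating (n - 2) (n - 1) (\<lambda>xs. rt xs v)" for v
      unfolding lt_def rt_def using gl pV(2)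
      by (auto simp: gl_map_def intro!: alternating_proj[OF _ _ pA(2)])
    show "additive (lt xs)" "additive (rt xs)" if "length xs = n - 1" for xs
      unfolding lt_def[abs_def] rt_def[abs_def] using gl vecs[OF that]
      by (auto simp: gl_map_def intro!: linear_map_additive_proj[OF _ addV pV(2)])
  next
    fix xs ys :: "'a list" and v :: 'v assume len: "length xs = n" "length ys = n - 2"
    have X: "map pA xs \<in> vecs n A" and Y: "map pA ys \<in> vecs (n - 2) A"
      and W: "pV v \<in> V" by (rule vecs[OF len(1)] vecs[OF len(2)] pV(2))+
    have Y': "a # map pA ys \<in> vecs (n - 1) A" if "a \<in> A" for a
      using Y that n by (auto simp: vecs_def)
    have c: "map pA (cm n brt xs # ys) = cA (map pA xs) # map pA ys"
      using len X by (simp add: cm pA_br)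
    have "lt (omit i xs) (lt (xs ! i # ys) v) = l (omit i (map pA xs)) (l (map pA xs ! i # map pA ys) (pV v))"
      if "i < n" for i
      using that len Y'[OF pA(2), of "xs ! i"] W by (simp add: lt_def pV_lr map_omit)
    then show "lt (cm n brt xs # ys) v = (\<Sum>i<n. sg (n - Suc i) (lt (omit i xs) (lt (xs ! i # ys) v)))"
      unfolding lt_def[of "cm n brt xs # ys"] c by (simp add: l_cA[OF Y W X] V.scale_minus_one_power)
    have "lt (omit i xs) (rt (xs ! i # ys) v) = l (omit i (map pA xs)) (r (map pA xs ! i # map pA ys) (pV v))"
      if "i < n" for i
      using that len Y'[OF pA(2), of "xs ! i"] W by (simp add: lt_def rt_def pV_lr map_omit)
    then show "rt (cm n brt xs # ys) v = (\<Sum>i<n. sg (n - Suc i) (lt (omit i xs) (rt (xs ! i # ys) v)))"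
      unfolding rt_def[of "cm n brt xs # ys"] c by (simp add: r_cA[OF Y W X] V.scale_minus_one_power)
  next
    fix xs ys :: "'a list" and v :: 'v assume len: "length xs = n - 1" "length ys = n - 1"
    let ?X = "map pA xs" and ?Y = "map pA ys" and ?w = "pV v"
    have X: "?X \<in> vecs (n - 1) A" and Y: "?Y \<in> vecs (n - 1) A"
      and W: "?w \<in> V" by (rule vecs[OF len(1)] vecs[OF len(2)] pV(2))+
    have ys: "ys \<noteq> []" using len n by auto
    have "l ?X (l ?Y ?w) - l ?Y (l ?X ?w) = (\<Sum>i<n - 1. l (?Y[i := cA (?X @ [?Y ! i])]) ?w)"
      by (rule l_l[OF X Y W])
    then show "lt xs (lt ys v) - lt ys (lt xs v) = (\<Sum>i<n - 1. lt (ys[i := cm n brt (xs @ [ys ! i])]) v)"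
      using len X Y W by (simp add: lt_def pV_lr upd)
    have "l ?X (r ?Y ?w) = r ?Y (mu ?X ?w) + (\<Sum>i<n - 2. r (?Y[i := cA (?X @ [?Y ! i])]) ?w)
        + r (butlast ?Y @ [br (?X @ [last ?Y])]) ?w"
      by (rule l_r[OF X Y W])
    moreover have "pA (br (?X @ [last ?Y])) = br (?X @ [last ?Y])"
      using ys by (intro pA_br vecs_snoc[OF X] n) (simp add: last_map pA)
    ultimately show "lt xs (rt ys v) = rt ys (mt xs v)
        + (\<Sum>i<n - 2. rt (ys[i := cm n brt (xs @ [ys ! i])]) v) + rt (butlast ys @ [brt (xs @ [last ys])]) v"
      using len X Y W ys by (simp add: lt_def rt_def brt_def mt pV_lr upd map_butlast last_map)
    have "r ?Y (mu ?X ?w) = l ?X (r ?Y ?w)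
        + (\<Sum>i<n - 1. sg (Suc i) (r (omit i ?X @ [br (?X ! i # ?Y)]) ?w))"
      using r_mu[OF X Y W] by (simp only: V.scale_minus_one_power)
    moreover have "pA (br (pA a # ?Y)) = br (pA a # ?Y)" for a
      by (intro pA_br vecs_Cons[OF Y] n pA)
    ultimately show "rt ys (mt xs v) = lt xs (rt ys v)
        + (\<Sum>i<n - 1. sg (Suc i) (rt (omit i xs @ [brt (xs ! i # ys)]) v))"
      using len X Y W by (simp add: lt_def rt_def brt_def mt pV_lr map_omit del: sg_Suc)
  next
    fix xs ys :: "'a list" and v :: 'v assume len: "length xs = n - 2" "length ys = n"
    let ?X = "map pA xs" and ?Y = "map pA ys" and ?w = "pV v"
    have X: "?X \<in> vecs (n - 2) A" and Y: "?Y \<in> vecs n A" and W: "?w \<in> V"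
      by (rule vecs[OF len(1)] vecs[OF len(2)] pV(2))+
    have ys: "ys \<noteq> []" using len n by auto
    have X': "?X @ [a] \<in> vecs (n - 1) A" if "a \<in> A" for a
      using X that n by (auto simp: vecs_def)
    have "r (?X @ [br ?Y]) ?w = l (butlast ?Y) (r (?X @ [last ?Y]) ?w)
        + (\<Sum>i<n - 1. sg i (r (omit i ?Y) (mu (?X @ [?Y ! i]) ?w)))"
      using r_br[OF X Y W] by (simp only: V.scale_minus_one_power)
    moreover have "mt (xs @ [ys ! i]) v = mu (?X @ [?Y ! i]) ?w" if "i < n - 1" for i
      using that len n by (subst mt) auto
    moreover have "pV (mu (?X @ [?Y ! i]) ?w) = mu (?X @ [?Y ! i]) ?w" if "i < n - 1" for i
      using that len by (intro pV_lr X' W) (simp add: pA)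
    moreover have "pV (r (?X @ [pA (last ys)]) ?w) = r (?X @ [pA (last ys)]) ?w"
      by (intro pV_lr X' W pA)
    ultimately show "rt (xs @ [brt ys]) v = lt (butlast ys) (rt (xs @ [last ys]) v)
        + (\<Sum>i<n - 1. sg i (rt (omit i ys) (mt (xs @ [ys ! i]) v)))"
      using len Y ys by (simp add: lt_def rt_def brt_def pA_br map_omit map_butlast last_map)
  qed (simp add: mt_def)
  have Tt: "map pA (map Tt us) = map T (map pV us)" for us
    by (simp add: Tt_def pA(3) T_mem pV(2))
  have ht: "ht us = hV (map pV us)" if "length us = n" for us
  proof -
    have "us \<noteq> []" using that n by auto
    then show ?thesis
      using that unfolding hV_eq[OF vecsV[OF that]] ht_def lt_def rt_def Tt
      by (simp add: map_butlast last_map map_omit V.scale_minus_one_power)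
  qed
  interpret t: o_operator n brt sV lt rt mt Tt ht vt
  proof (intro o_operator.intro o_operator_axioms.intro)
    show "pre_lie_rep n brt sV lt rt mt" by (rule t.pre_lie_rep_axioms)
    show "additive Tt"
      using linear_map_additive_proj[OF T_linear addV pV(2)] by (simp add: Tt_def[abs_def])
    show "brt (map Tt us) = Tt (ht us)" if "length us = n" for us
      using T_hV[OF vecsV[OF that]] hV_mem[OF vecsV[OF that]] unfolding brt_def Tt
      by (simp add: Tt_def ht[OF that] pV(3))
  qed (simp_all add: ht_def vt_def)
  have id: "map pV us = us" if "us \<in> vecs k V" for us k
    using that pV(3) by (auto simp: vecs_def intro!: map_idI)
  show ?thesis
  proof
    show "pre_lie n ht" "pre_lie n vt" by (rule t.pre_lie_h t.pre_lie_m)+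
    fix us assume us: "us \<in> vecs n V"
    then have len: "length us = n" by (simp add: vecs_def)
    show "ht us = hV us" using ht[OF len] id[OF us] by simp
    show "cm n ht us = cm n vt us" by (rule t.cm_h_eq_cm_m[OF len])
    obtain us' u where *: "us = us' @ [u]" "us' \<in> vecs (n - 1) V" "u \<in> V"
      using us by (rule vecs_snocE) (use n in auto)
    have "vt us = mt (map Tt us') u" by (simp add: vt_def *)
    also have "\<dots> = mu (map pA (map Tt us')) (pV u)" using * by (intro mt) (simp add: vecs_def)
    also have "\<dots> = vV us" unfolding Tt id[OF *(2)] using * by (simp add: vV_snoc pV(3))
    finally show "vt us = vV us" .
  qed
qed

lemma hor_pre_lie: "n_pre_lie_algebra n sV V hV"
  and ver_pre_lie: "n_pre_lie_algebra n sV V vV"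
  and commutator_hor_eq_ver: "us \<in> vecs n V \<Longrightarrow> cV us = commutator n sV vV us"
proof -
  obtain f g where fg: "pre_lie n f" "pre_lie n g"
    "\<And>us. us \<in> vecs n V \<Longrightarrow> f us = hV us" "\<And>us. us \<in> vecs n V \<Longrightarrow> g us = vV us"
    "\<And>us. us \<in> vecs n V \<Longrightarrow> cm n f us = cm n g us"
    using total by blast
  show "n_pre_lie_algebra n sV V hV" "n_pre_lie_algebra n sV V vV"
    using n_pre_lie_algebra_of_pre_lie[OF fg(1) fdV hV_multilinear] fg(3)
      n_pre_lie_algebra_of_pre_lie[OF fg(2) fdV vV_multilinear] fg(4) by simp_all
  assume us: "us \<in> vecs n V"
  have "cm n hV us = cm n f us" "cm n vV us = cm n g us"
    using fg(3,4) us n by (auto intro!: cm_cong[of n V])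
  then show "cV us = commutator n sV vV us"
    using fg(5)[OF us] by (simp add: commutator_eq_cm[OF vsV])
qed

lemma T_update_cV:
  assumes "xs \<in> vecs (n - 1) V" "ys \<in> vecs k V" "i < k"
  shows "map T (ys[i := cV (xs @ [ys ! i])]) = (map T ys)[i := cA (map T xs @ [map T ys ! i])]"
  using T_cV[OF vecs_snoc[OF assms(1) vecs_nth[OF assms(2,3)] n]] assms
  by (simp add: map_update vecs_def)

lemma T_hV_snoc:
  assumes "xs \<in> vecs (n - 1) V" "y \<in> V"
  shows "T (hV (xs @ [y])) = br (map T xs @ [T y])"
  using T_hV[OF vecs_snoc[OF assms n]] by simp

lemma T_hV_Cons:
  assumes "xs \<in> vecs (n - 1) V" "y \<in> V"
  shows "T (hV (y # xs)) = br (T y # map T xs)"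
  using T_hV[OF vecs_Cons[OF assms n]] by simp

text \<open>In order, the six axioms are \<open>l_l\<close>, \<open>l_cA\<close>,
  \<open>l_r\<close>, \<open>r_cA\<close>, \<open>r_br\<close> and \<open>r_mu\<close>. The
  translation rests on three rules: \<open>T\<close> takes \<open>hV\<close> to \<open>br\<close>
  and \<open>cV\<close> to \<open>cA\<close>, and \<open>vV\<close> is \<open>mu\<close> applied to
  the last argument. The sign of the fifth axiom is the one in \<open>r_br\<close>, so
  \<open>n\<close> may be even or odd here.\<close>

lemma dendriform: "n_L_dendriform_algebra n sV V nw ne"
  unfolding n_L_dendriform_algebra_def
proof (intro conjI ballI)
  show "fd_space sV V" "multilinear_map n sV V sV V nw" "multilinear_map n sV V sV V ne"
    "alternating_in {..<n - 1} n V nw" "alternating_in {1..<n - 1} n V ne"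
    by (rule fdV nw_multilinear ne_multilinear nw_alternating ne_alternating)+
  show "cV xs = commutator n sV vV xs" if "xs \<in> vecs n V" for xs
    by (rule commutator_hor_eq_ver[OF that])
next
  fix xs ys assume xs: "xs \<in> vecs (n - 1) V" and ysV: "ys \<in> vecs n V"
  obtain ys' y where ys: "ys = ys' @ [y]" "ys' \<in> vecs (n - 1) V" "y \<in> V"
    using ysV by (rule vecs_snocE) (use n in auto)
  have len: "length ys' = n - 1" using ys by (simp add: vecs_def)
  have "nw (ys[i := cV (xs @ [ys ! i])]) = l ((map T ys')[i := cA (map T xs @ [map T ys' ! i])]) y" if "i < n - 1" for i
  proof -
    have "cV (xs @ [ys' ! i]) \<in> V" by (intro cV_mem vecs_snoc[OF xs] vecs_nth[OF ys(2) that] n)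
    then show ?thesis
      using that len nw_snoc[OF vecs_update[OF ys(2)] ys(3)] T_update_cV[OF xs ys(2) that]
      by (simp add: ys nth_append list_update_append)
  qed
  moreover have "l (map T xs) (l (map T ys') y) - l (map T ys') (l (map T xs) y) =
      (\<Sum>i<n - 1. l ((map T ys')[i := cA (map T xs @ [map T ys' ! i])]) y)"
    by (rule l_l[OF T_vecs[OF xs] T_vecs[OF ys(2)] ys(3)])
  ultimately show "nw (xs @ [nw ys]) - nw (butlast ys @ [nw (xs @ [last ys])]) =
      (\<Sum>i<n - 1. nw (ys[i := cV (xs @ [ys ! i])]))"
    using ys xs by (simp add: nw_snoc l_mem T_vecs)
next
  fix xs ys assume xs: "xs \<in> vecs n V" and "ys \<in> vecs (n - 1) V"
  then obtain ys' y where ys: "ys = ys' @ [y]" "ys' \<in> vecs (n - 2) V" "y \<in> V"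
    using n by (cases ys rule: rev_cases) (auto simp: vecs_def)
  have Cons: "a # ys' \<in> vecs (n - 1) V" if "a \<in> V" for a using ys that n by (auto simp: vecs_def)
  have "nw (omit i xs @ [nw (xs ! i # ys)]) = l (omit i (map T xs)) (l (map T xs ! i # map T ys') y)" if "i < n" for i
  proof -
    have c: "xs ! i # ys' \<in> vecs (n - 1) V" by (rule Cons[OF vecs_nth[OF xs that]])
    have "nw (xs ! i # ys) = l (T (xs ! i) # map T ys') y" using nw_snoc[OF c ys(3)] by (simp add: ys)
    moreover have "l (T (xs ! i) # map T ys') y \<in> V" using l_mem[OF T_vecs[OF c] ys(3)] by simp
    ultimately show ?thesis
      using nw_snoc[OF vecs_omit[OF xs that]] that xs by (simp add: map_omit vecs_def)
  qed
  moreover have "nw (cV xs # ys) = l (cA (map T xs) # map T ys') y"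
    using nw_snoc[OF Cons[OF cV_mem[OF xs]] ys(3)] by (simp add: ys T_cV[OF xs])
  moreover have "l (cA (map T xs) # map T ys') y =
      (\<Sum>i<n. sV ((- 1) ^ (n - Suc i)) (l (omit i (map T xs)) (l (map T xs ! i # map T ys') y)))"
    by (rule l_cA[OF T_vecs[OF ys(2)] ys(3) T_vecs[OF xs]])
  ultimately show "nw (cV xs # ys) =
      (\<Sum>i<n. sV ((- 1) ^ (n - Suc i)) (nw (omit i xs @ [nw (xs ! i # ys)])))"
    by simp
next
  fix xs ys z assume xs: "xs \<in> vecs (n - 1) V" and ys: "ys \<in> vecs (n - 1) V" and z: "z \<in> V"
  have "l (map T xs) (r (map T ys) z) = r (map T ys) (mu (map T xs) z)
      + (\<Sum>i<n - 2. r ((map T ys)[i := cA (map T xs @ [map T ys ! i])]) z)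
      + r (butlast (map T ys) @ [br (map T xs @ [last (map T ys)])]) z"
    by (rule l_r[OF T_vecs[OF xs] T_vecs[OF ys] z])
  moreover have "ne (z # ys[i := cV (xs @ [ys ! i])]) = r ((map T ys)[i := cA (map T xs @ [map T ys ! i])]) z"
    if "i < n - 2" for i
  proof -
    have i: "i < n - 1" using that by simp
    have "cV (xs @ [ys ! i]) \<in> V" by (intro cV_mem vecs_snoc[OF xs] vecs_nth[OF ys i] n)
    then show ?thesis
      using ne_Cons[OF vecs_update[OF ys] z] T_update_cV[OF xs ys i] by simp
  qed
  moreover have "ne (z # butlast ys @ [hV (xs @ [last ys])]) =
      r (butlast (map T ys) @ [br (map T xs @ [last (map T ys)])]) z"
  proof -
    obtain ys' y where y: "ys = ys' @ [y]" using ys n by (cases ys rule: rev_cases) (auto simp: vecs_def)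
    have "y \<in> V" using ys y by (auto simp: vecs_def)
    moreover from this have "ys' @ [hV (xs @ [y])] \<in> vecs (n - 1) V"
      using ys y hV_mem[OF vecs_snoc[OF xs _ n]] by (auto simp: vecs_def)
    ultimately show ?thesis
      using ne_Cons[OF _ z] T_hV_snoc[OF xs] by (simp add: y)
  qed
  moreover have "nw (xs @ [ne (z # ys)]) = l (map T xs) (r (map T ys) z)"
    using xs ys z by (simp add: ne_Cons nw_snoc r_mem T_vecs)
  moreover have "ne (vV (xs @ [z]) # ys) = r (map T ys) (mu (map T xs) z)"
    using xs ys z by (simp add: ne_Cons vV_snoc mu_mem T_vecs)
  ultimately show "nw (xs @ [ne (z # ys)]) - ne (z # butlast ys @ [hV (xs @ [last ys])]) =
      ne (vV (xs @ [z]) # ys) + (\<Sum>i<n - 2. ne (z # ys[i := cV (xs @ [ys ! i])]))"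
    by simp
next
  fix xs ys z assume xs: "xs \<in> vecs n V" and ys: "ys \<in> vecs (n - 2) V" and z: "z \<in> V"
  have Cons: "a # ys \<in> vecs (n - 1) V" if "a \<in> V" for a using ys that n by (auto simp: vecs_def)
  have "nw (omit i xs @ [ne (z # xs ! i # ys)]) = l (omit i (map T xs)) (r (map T xs ! i # map T ys) z)" if "i < n" for i
  proof -
    have c: "xs ! i # ys \<in> vecs (n - 1) V" by (rule Cons[OF vecs_nth[OF xs that]])
    have "ne (z # xs ! i # ys) = r (T (xs ! i) # map T ys) z" using ne_Cons[OF c z] by simp
    moreover have "r (T (xs ! i) # map T ys) z \<in> V" using r_mem[OF T_vecs[OF c] z] by simp
    ultimately show ?thesis
      using nw_snoc[OF vecs_omit[OF xs that]] that xs by (simp add: map_omit vecs_def)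
  qed
  moreover have "ne (z # cV xs # ys) = r (cA (map T xs) # map T ys) z"
    using ne_Cons[OF Cons[OF cV_mem[OF xs]] z] by (simp add: T_cV[OF xs])
  moreover have "r (cA (map T xs) # map T ys) z =
      (\<Sum>i<n. sV ((- 1) ^ (n - Suc i)) (l (omit i (map T xs)) (r (map T xs ! i # map T ys) z)))"
    by (rule r_cA[OF T_vecs[OF ys] z T_vecs[OF xs]])
  ultimately show "ne (z # cV xs # ys) =
      (\<Sum>i<n. sV ((- 1) ^ (n - Suc i)) (nw (omit i xs @ [ne (z # xs ! i # ys)])))"
    by simp
next
  fix xs ys z assume xs: "xs \<in> vecs (n - 2) V" and ys: "ys \<in> vecs n V" and z: "z \<in> V"
  obtain ys' y where y: "ys = ys' @ [y]" "ys' \<in> vecs (n - 1) V" "y \<in> V"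
    using ys by (rule vecs_snocE) (use n in auto)
  have snoc: "xs @ [a] \<in> vecs (n - 1) V" if "a \<in> V" for a using xs that n by (auto simp: vecs_def)
  have "r (map T xs @ [br (map T ys)]) z = l (butlast (map T ys)) (r (map T xs @ [last (map T ys)]) z)
      + (\<Sum>i<n - 1. sV ((- 1) ^ i) (r (omit i (map T ys)) (mu (map T xs @ [map T ys ! i]) z)))"
    by (rule r_br[OF T_vecs[OF xs] T_vecs[OF ys] z])
  moreover have "ne (vV (xs @ [ys ! i, z]) # omit i ys) = r (omit i (map T ys)) (mu (map T xs @ [map T ys ! i]) z)"
    if "i < n - 1" for i
  proof -
    have i: "i < n" using that by simp
    note c = snoc[OF vecs_nth[OF ys i]]
    have "vV (xs @ [ys ! i, z]) = mu (map T xs @ [map T ys ! i]) z"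
      using vV_snoc[OF c z] i ys by (simp add: vecs_def)
    moreover have "mu (map T xs @ [map T ys ! i]) z \<in> V"
      using mu_mem[OF T_vecs[OF c] z] i ys by (simp add: vecs_def)
    ultimately show ?thesis using ne_Cons[OF vecs_omit[OF ys i]] by (simp add: map_omit)
  qed
  moreover have "ne (z # xs @ [hV ys]) = r (map T xs @ [br (map T ys)]) z"
    using ne_Cons[OF snoc[OF hV_mem[OF ys]] z] T_hV[OF ys] by simp
  moreover have "nw (butlast ys @ [ne (z # xs @ [last ys])]) =
      l (butlast (map T ys)) (r (map T xs @ [last (map T ys)]) z)"
    using ne_Cons[OF snoc[OF y(3)] z] r_mem[OF T_vecs[OF snoc[OF y(3)]] z] nw_snoc[OF y(2)]
    by (simp add: y)
  ultimately show "ne (z # xs @ [hV ys]) - nw (butlast ys @ [ne (z # xs @ [last ys])]) =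
      (\<Sum>i<n - 1. sV ((- 1) ^ i) (ne (vV (xs @ [ys ! i, z]) # omit i ys)))"
    by simp
next
  fix xs ys z assume xs: "xs \<in> vecs (n - 1) V" and ys: "ys \<in> vecs (n - 1) V" and z: "z \<in> V"
  have "r (map T ys) (mu (map T xs) z) = l (map T xs) (r (map T ys) z)
      + (\<Sum>i<n - 1. sV ((- 1) ^ Suc i) (r (omit i (map T xs) @ [br (map T xs ! i # map T ys)]) z))"
    by (rule r_mu[OF T_vecs[OF xs] T_vecs[OF ys] z])
  moreover have "ne (z # omit i xs @ [hV (xs ! i # ys)]) = r (omit i (map T xs) @ [br (map T xs ! i # map T ys)]) z"
    if "i < n - 1" for i
  proof -
    note xi = vecs_nth[OF xs that]
    have "omit i xs @ [hV (xs ! i # ys)] \<in> vecs (n - 1) V"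
      using vecs_omit[OF xs that] hV_mem[OF vecs_Cons[OF ys xi n]] that by (auto simp: vecs_def)
    then show ?thesis
      using ne_Cons[OF _ z] T_hV_Cons[OF ys xi] that xs by (simp add: map_omit vecs_def)
  qed
  moreover have "nw (xs @ [ne (z # ys)]) = l (map T xs) (r (map T ys) z)"
    using xs ys z by (simp add: ne_Cons nw_snoc r_mem T_vecs)
  moreover have "ne (vV (xs @ [z]) # ys) = r (map T ys) (mu (map T xs) z)"
    using xs ys z by (simp add: ne_Cons vV_snoc mu_mem T_vecs)
  ultimately show "ne (vV (xs @ [z]) # ys) - nw (xs @ [ne (z # ys)]) =
      (\<Sum>i<n - 1. sV ((- 1) ^ Suc i) (ne (z # omit i xs @ [hV (xs ! i # ys)])))"
    by simp
qed

end

section \<open>Images of L-dendriform algebras\<close>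

lemma linear_map_0:
  assumes "vector_space sA" "module.subspace sA A" "linear_map sA A sB B f"
  shows "f 0 = 0"
proof -
  interpret vector_space sA by fact
  have "0 \<in> A" using assms(2) by (rule subspace_0)
  then have "f (0 + 0) = f 0 + f 0" using assms(3) unfolding linear_map_def by blast
  then show ?thesis by simp
qed

lemma multilinear_map_zero:
  assumes "vector_space sA" "module.subspace sA A" "multilinear_map k sA A sB B f"
    and "xs \<in> vecs k A" "0 \<in> set xs"
  shows "f xs = 0"
proof -
  obtain us ws where xs: "xs = us @ 0 # ws" using split_list[OF assms(5)] by blast
  have "us @ ws \<in> vecs (k - 1) A" "k > 0" using assms(4) by (auto simp: xs vecs_def)
  from linear_map_0[OF assms(1,2) multilinear_map_slot[OF assms(3) this]]
  show ?thesis by (simp add: xs)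
qed

lemma vecs_imageE:
  assumes "xs \<in> vecs k (T ` V)"
  obtains us where "us \<in> vecs k V" "xs = map T us"
proof
  have inv: "inv_into V T x \<in> V" "T (inv_into V T x) = x" if "x \<in> T ` V" for x
    using that by (auto simp: inv_into_into f_inv_into_f)
  show "map (inv_into V T) xs \<in> vecs k V" using assms inv by (auto simp: vecs_def)
  show "xs = map T (map (inv_into V T) xs)"
    using assms inv by (auto simp: vecs_def intro!: map_idI[symmetric])
qed

lemma fd_space_image:
  assumes "module_hom sV sA T" "vector_space sA" "fd_space sV V"
  shows "fd_space sA (T ` V)"
proof -
  interpret module_hom sV sA T by fact
  obtain B where "finite B" "B \<subseteq> V" "m1.span B = V" using assms(3) by (auto simp: fd_space_def)
  then have "finite (T ` B)" "T ` B \<subseteq> T ` V" "m2.span (T ` B) = T ` V" by (auto simp: span_image)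
  moreover have "m2.subspace (T ` V)" using assms(3) by (simp add: fd_space_def subspace_image)
  ultimately show ?thesis using assms(2) unfolding fd_space_def by blast
qed

text \<open>Preimages of the fixed arguments are chosen once and split at the free slot; linearity
  is then the image of linearity over \<open>V\<close>.\<close>

lemma multilinear_map_image:
  assumes "module_hom sV sA T" and sub: "module.subspace sV V" and f: "multilinear_map k sV V sV V f"
    and f': "\<And>us. us \<in> vecs k V \<Longrightarrow> f' (map T us) = T (f us)"
  shows "multilinear_map k sA (T ` V) sA (T ` V) f'"
proof (rule multilinear_mapI)
  fix xs assume "xs \<in> vecs k (T ` V)"
  then obtain us where "us \<in> vecs k V" "xs = map T us" by (rule vecs_imageE)
  then show "f' xs \<in> T ` V" using f f' by (auto simp: multilinear_map_def)
next
  interpret module_hom sV sA T by fact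
  fix us ws assume usws: "us @ ws \<in> vecs (k - 1) (T ` V)" and k: "k > 0"
  obtain zs where zs: "zs \<in> vecs (k - 1) V" "us @ ws = map T zs" using usws by (rule vecs_imageE)
  define u w where "u = take (length us) zs" and "w = drop (length us) zs"
  have us: "us = map T u" "ws = map T w"
    using arg_cong[OF zs(2), of "take (length us)"] arg_cong[OF zs(2), of "drop (length us)"]
    by (simp_all add: u_def w_def take_map drop_map)
  have uw: "u @ w \<in> vecs (k - 1) V" using zs by (simp add: u_def w_def)
  have eq: "f' (us @ T x # ws) = T (f (u @ x # w))" if "x \<in> V" for x
    using f'[of "u @ x # w"] uw that k by (auto simp: us vecs_def)
  have lin: "linear_map sV V sV V (\<lambda>x. f (u @ x # w))" by (rule multilinear_map_slot[OF f uw k])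
  show "linear_map sA (T ` V) sA (T ` V) (\<lambda>x. f' (us @ x # ws))"
    unfolding linear_map_def
  proof (intro conjI ballI allI)
    fix x y c assume "x \<in> T ` V" "y \<in> T ` V"
    then obtain a b where ab: "a \<in> V" "b \<in> V" "x = T a" "y = T b" by auto
    have V: "a + b \<in> V" "sV c a \<in> V" using ab sub by (simp_all add: m1.subspace_add m1.subspace_scale)
    show "f' (us @ (x + y) # ws) = f' (us @ x # ws) + f' (us @ y # ws)"
      using eq[OF V(1)] eq ab lin by (simp add: add linear_map_def)
  next
    fix x c assume "x \<in> T ` V"
    then obtain a where a: "a \<in> V" "x = T a" by auto
    have V: "sV c a \<in> V" using a sub by (simp add: m1.subspace_scale)
    show "f' (us @ sA c x # ws) = sA c (f' (us @ x # ws))"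
      using eq[OF V(1)] eq a lin by (simp add: scale linear_map_def)
    show "f' (us @ x # ws) \<in> T ` V" using eq a lin by (auto simp: linear_map_def)
  qed
qed

lemma alternating_in_image:
  assumes "alternating_in P k V f" "P \<subseteq> {..<k}"
    and f': "\<And>us. us \<in> vecs k V \<Longrightarrow> f' (map T us) = T (f us)" and "T 0 = 0"
  shows "alternating_in P k (T ` V) f'"
  unfolding alternating_in_def
proof (intro ballI impI)
  fix xs i j assume xs: "xs \<in> vecs k (T ` V)" and ij: "i \<in> P" "j \<in> P" "i \<noteq> j \<and> xs ! i = xs ! j"
  \<comment> \<open>Choosing preimages by a function gives equal entries the same preimage, so
    \<open>us\<close> repeats an entry as well.\<close>
  define us where "us = map (inv_into V T) xs"
  have inv: "inv_into V T x \<in> V" "T (inv_into V T x) = x" if "x \<in> T ` V" for x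
    using that by (auto simp: inv_into_into f_inv_into_f)
  have us: "us \<in> vecs k V" "xs = map T us"
    using xs inv by (auto simp: us_def vecs_def intro!: map_idI[symmetric])
  have "i < length xs" "j < length xs" using ij xs assms(2) by (auto simp: vecs_def)
  then have "us ! i = us ! j" using ij by (simp add: us_def)
  then have "f us = 0" using assms(1) us(1) ij unfolding alternating_in_def by blast
  then show "f' xs = 0" using f'[OF us(1)] us(2) assms(4) by simp
qed

text \<open>The derived brackets \<open>H\<close>, \<open>W\<close> and \<open>C\<close> commute
  with \<open>T\<close> along with the operations, so each axiom on the image is \<open>T\<close>
  applied to the axiom over \<open>V\<close>. \<open>T\<close> is linear on the whole type here,
  which lets it pass through sums and signs without membership conditions.\<close>

lemma n_L_dendriform_algebra_image:
  assumes n: "n \<ge> 2" and D: "n_L_dendriform_algebra n sV V nw ne"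
    and hom: "module_hom sV sA T" and vsA: "vector_space sA"
    and nw': "\<And>us. us \<in> vecs n V \<Longrightarrow> nw' (map T us) = T (nw us)"
    and ne': "\<And>us. us \<in> vecs n V \<Longrightarrow> ne' (map T us) = T (ne us)"
  shows "n_L_dendriform_algebra n sA (T ` V) nw' ne'"
proof -
  interpret module_hom sV sA T by (rule hom)
  define H where "H = hor n sV nw ne"
  define W where "W = ver n sV nw ne"
  define C where "C = commutator n sV H"
  define H' where "H' = hor n sA nw' ne'"
  define W' where "W' = ver n sA nw' ne'"
  define C' where "C' = commutator n sA H'"
  note D' = D[unfolded n_L_dendriform_algebra_def, folded H_def, folded W_def, folded C_def]
  have fd: "fd_space sV V" and nw: "multilinear_map n sV V sV V nw" and ne: "multilinear_map n sV V sV V ne"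
    using D' by blast+
  have vsV: "vector_space sV" and subV: "m1.subspace V" using fd by (auto simp: fd_space_def)
  have H: "multilinear_map n sV V sV V H" and W: "multilinear_map n sV V sV V W"
    unfolding H_def W_def by (rule multilinear_map_hor multilinear_map_ver; fact)+
  have mem: "nw us \<in> V" "ne us \<in> V" "H us \<in> V" "W us \<in> V" if "us \<in> vecs n V" for us
    using that nw ne H W by (simp_all add: multilinear_map_def)
  have C_mem: "C us \<in> V" if "us \<in> vecs n V" for us
    unfolding C_def using commutator_mem[of sV V n H] vsV subV mem that n by blast
  have H': "H' (map T us) = T (H us)" if us: "us \<in> vecs n V" for us
  proof -
    have "ne' (map T us ! i # omit i (map T us)) = T (ne (us ! i # omit i us))" if "i < n - 1" for i
      using ne'[OF vecs_nth_omit[OF us _ n], of i] that us by (simp add: map_omit vecs_def)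
    then show ?thesis by (simp add: H'_def H_def hor_def nw'[OF us] add sum scale)
  qed
  have W': "W' (map T us) = T (W us)" if us: "us \<in> vecs n V" for us
  proof -
    obtain vs v where v: "us = vs @ [v]" "vs \<in> vecs (n - 1) V" "v \<in> V"
      using us by (rule vecs_snocE) (use n in auto)
    have len: "length vs = n - 1" using v by (simp add: vecs_def)
    have "ne' (T v # omit i (map T vs) @ [map T vs ! i]) = T (ne (v # omit i vs @ [vs ! i]))" if "i < n - 1" for i
    proof -
      have "omit i vs @ [vs ! i] \<in> vecs (n - 1) V"
        using vecs_nth[OF v(2) that] vecs_omit[OF v(2) that] that by (simp add: vecs_def)
      from ne'[OF vecs_Cons[OF this v(3) n]] show ?thesis using that len by (simp add: map_omit)
    qed
    then show ?thesis
      using nw'[OF us] len by (simp add: W'_def W_def ver_def v nth_append add sum scale neg)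
  qed
  have C': "C' (map T us) = T (C us)" if us: "us \<in> vecs n V" for us
  proof -
    have "H' (omit i (map T us) @ [map T us ! i]) = T (H (omit i us @ [us ! i]))" if "i < n" for i
      using H'[OF vecs_omit_snoc[OF us that n]] that us by (simp add: map_omit vecs_def)
    then show ?thesis by (simp add: C'_def C_def commutator_def sum scale)
  qed
  have snoc: "nw' (map T us @ [T v]) = T (nw (us @ [v]))" "H' (map T us @ [T v]) = T (H (us @ [v]))"
    "W' (map T us @ [T v]) = T (W (us @ [v]))" "C' (map T us @ [T v]) = T (C (us @ [v]))"
    and snoc_mem: "us @ [v] \<in> vecs n V"
    if "us \<in> vecs (n - 1) V" "v \<in> V" for us v
    using nw' H' W' C' vecs_snoc[OF that n] by (metis map_append list.map)+
  have Cons: "nw' (T v # map T us) = T (nw (v # us))" "ne' (T v # map T us) = T (ne (v # us))"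
      "H' (T v # map T us) = T (H (v # us))" and Cons_mem: "v # us \<in> vecs n V"
    if "us \<in> vecs (n - 1) V" "v \<in> V" for us v
    using nw' ne' H' vecs_Cons[OF that n] by (metis list.map(2))+
  have C_upd: "(map T ys)[i := C' (map T xs @ [map T ys ! i])] = map T (ys[i := C (xs @ [ys ! i])])"
    and C_upd_mem: "ys[i := C (xs @ [ys ! i])] \<in> vecs k V"
    if xs: "xs \<in> vecs (n - 1) V" and ys: "ys \<in> vecs k V" "i < k" for xs ys i k
  proof -
    show "(map T ys)[i := C' (map T xs @ [map T ys ! i])] = map T (ys[i := C (xs @ [ys ! i])])"
      using snoc(4)[OF xs vecs_nth[OF ys]] ys by (simp add: map_update vecs_def)
    show "ys[i := C (xs @ [ys ! i])] \<in> vecs k V"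
      by (intro vecs_update ys C_mem snoc_mem xs vecs_nth[OF ys])
  qed
  have omit_mem: "omit i xs @ [v] \<in> vecs k V" if "xs \<in> vecs k V" "i < k" "v \<in> V" for xs i v k
    using vecs_omit[OF that(1,2)] that by (auto simp: vecs_def)
  show ?thesis
    unfolding n_L_dendriform_algebra_def H'_def[symmetric] W'_def[symmetric] C'_def[symmetric]
  proof (intro conjI ballI)
    show "fd_space sA (T ` V)" by (rule fd_space_image[OF hom vsA fd])
    show "multilinear_map n sA (T ` V) sA (T ` V) nw'" "multilinear_map n sA (T ` V) sA (T ` V) ne'"
      using multilinear_map_image[OF hom subV nw nw'] multilinear_map_image[OF hom subV ne ne'] by auto
    show "alternating_in {..<n - 1} n (T ` V) nw'"
      by (rule alternating_in_image[where f = nw and T = T]) (use D' nw' zero in auto)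
    show "alternating_in {1..<n - 1} n (T ` V) ne'"
      by (rule alternating_in_image[where f = ne and T = T]) (use D' ne' zero in auto)
    fix xs assume "xs \<in> vecs n (T ` V)"
    then obtain us where us: "us \<in> vecs n V" "xs = map T us" by (rule vecs_imageE)
    have "W' (omit i (map T us) @ [map T us ! i]) = T (W (omit i us @ [us ! i]))" if "i < n" for i
      using W'[OF vecs_omit_snoc[OF us(1) that n]] that us by (simp add: map_omit vecs_def)
    then have "commutator n sA W' xs = T (commutator n sV W us)"
      by (simp add: us commutator_def sum scale)
    moreover have "C us = commutator n sV W us" using D' us by blast
    ultimately show "C' xs = commutator n sA W' xs" using C' us by simp
  next
    fix xs ys assume "xs \<in> vecs (n - 1) (T ` V)" "ys \<in> vecs n (T ` V)"
    then obtain us vs where us: "us \<in> vecs (n - 1) V" "xs = map T us" and vs: "vs \<in> vecs n V" "ys = map T vs"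
      by (metis vecs_imageE)
    obtain vs' v where v: "vs = vs' @ [v]" "vs' \<in> vecs (n - 1) V" "v \<in> V"
      using vs(1) by (rule vecs_snocE) (use n in auto)
    have "nw (us @ [nw vs]) - nw (butlast vs @ [nw (us @ [last vs])]) =
        (\<Sum>i<n - 1. nw (vs[i := C (us @ [vs ! i])]))"
      using D' us(1) vs(1) by blast
    from arg_cong[OF this, of T]
    have "T (nw (us @ [nw vs])) - T (nw (vs' @ [nw (us @ [v])])) =
        (\<Sum>i<n - 1. T (nw (vs[i := C (us @ [vs ! i])])))"
      by (simp add: diff sum v)
    moreover have "nw' (ys[i := C' (xs @ [ys ! i])]) = T (nw (vs[i := C (us @ [vs ! i])]))" if "i < n - 1" for i
    proof -
      have i: "i < n" using that by simp
      show ?thesis unfolding us(2) vs(2) C_upd[OF us(1) vs(1) i] by (rule nw'[OF C_upd_mem[OF us(1) vs(1) i]])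
    qed
    moreover have "nw' (xs @ [nw' ys]) = T (nw (us @ [nw vs]))"
      unfolding us(2) vs(2) nw'[OF vs(1)] by (rule snoc(1)[OF us(1) mem(1)[OF vs(1)]])
    moreover have "nw' (butlast ys @ [nw' (xs @ [last ys])]) = T (nw (vs' @ [nw (us @ [v])]))"
      using snoc(1)[OF us(1) v(3)] snoc(1)[OF v(2) mem(1)[OF snoc_mem[OF us(1) v(3)]]] by (simp add: us vs v)
    ultimately show "nw' (xs @ [nw' ys]) - nw' (butlast ys @ [nw' (xs @ [last ys])]) =
        (\<Sum>i<n - 1. nw' (ys[i := C' (xs @ [ys ! i])]))"
      by simp
  next
    fix xs ys assume "xs \<in> vecs n (T ` V)" "ys \<in> vecs (n - 1) (T ` V)"
    then obtain us vs where us: "us \<in> vecs n V" "xs = map T us" and vs: "vs \<in> vecs (n - 1) V" "ys = map T vs"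
      by (metis vecs_imageE)
    have "nw (C us # vs) = (\<Sum>i<n. sV ((-1) ^ (n - Suc i)) (nw (omit i us @ [nw (us ! i # vs)])))"
      using D' us(1) vs(1) by blast
    from arg_cong[OF this, of T]
    have "T (nw (C us # vs)) = (\<Sum>i<n. sA ((-1) ^ (n - Suc i)) (T (nw (omit i us @ [nw (us ! i # vs)]))))"
      by (simp add: scale sum)
    moreover have "nw' (omit i xs @ [nw' (xs ! i # ys)]) = T (nw (omit i us @ [nw (us ! i # vs)]))" if "i < n" for i
      using snoc(1)[OF vecs_omit[OF us(1) that] mem(1)[OF Cons_mem[OF vs(1) vecs_nth[OF us(1) that]]]]
        Cons(1)[OF vs(1) vecs_nth[OF us(1) that]] that us vs
      by (simp add: map_omit vecs_def)
    moreover have "nw' (C' xs # ys) = T (nw (C us # vs))"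
      using Cons(1)[OF vs(1) C_mem[OF us(1)]] C'[OF us(1)] by (simp add: us vs)
    ultimately show "nw' (C' xs # ys) = (\<Sum>i<n. sA ((-1) ^ (n - Suc i)) (nw' (omit i xs @ [nw' (xs ! i # ys)])))"
      by simp
  next
    fix xs ys z assume "xs \<in> vecs (n - 1) (T ` V)" "ys \<in> vecs (n - 1) (T ` V)" "z \<in> T ` V"
    then obtain us vs w where us: "us \<in> vecs (n - 1) V" "xs = map T us"
      and vs: "vs \<in> vecs (n - 1) V" "ys = map T vs" and w: "w \<in> V" "z = T w"
      by (metis vecs_imageE imageE)
    have "nw (us @ [ne (w # vs)]) - ne (w # butlast vs @ [H (us @ [last vs])]) =
        ne (W (us @ [w]) # vs) + (\<Sum>i<n - 2. ne (w # vs[i := C (us @ [vs ! i])]))"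
      using D' us(1) vs(1) w(1) by blast
    from arg_cong[OF this, of T]
    have "T (nw (us @ [ne (w # vs)])) - T (ne (w # butlast vs @ [H (us @ [last vs])])) =
        T (ne (W (us @ [w]) # vs)) + (\<Sum>i<n - 2. T (ne (w # vs[i := C (us @ [vs ! i])])))"
      by (simp add: diff sum add)
    moreover have "ne' (z # ys[i := C' (xs @ [ys ! i])]) = T (ne (w # vs[i := C (us @ [vs ! i])]))" if "i < n - 2" for i
    proof -
      have i: "i < n - 1" using that by simp
      show ?thesis unfolding us(2) vs(2) w(2) C_upd[OF us(1) vs(1) i]
        by (rule Cons(2)[OF C_upd_mem[OF us(1) vs(1) i] w(1)])
    qed
    moreover have "nw' (xs @ [ne' (z # ys)]) = T (nw (us @ [ne (w # vs)]))"
      unfolding us(2) vs(2) w(2) Cons(2)[OF vs(1) w(1)]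
      by (rule snoc(1)[OF us(1) mem(2)[OF Cons_mem[OF vs(1) w(1)]]])
    moreover have "ne' (W' (xs @ [z]) # ys) = T (ne (W (us @ [w]) # vs))"
      unfolding us(2) vs(2) w(2) snoc(3)[OF us(1) w(1)]
      by (rule Cons(2)[OF vs(1) mem(4)[OF snoc_mem[OF us(1) w(1)]]])
    moreover have "ne' (z # butlast ys @ [H' (xs @ [last ys])]) = T (ne (w # butlast vs @ [H (us @ [last vs])]))"
    proof -
      obtain vs' v where v: "vs = vs' @ [v]" "vs' \<in> vecs (n - 1 - 1) V" "v \<in> V"
        using vs(1) by (rule vecs_snocE) (use n in auto)
      have "vs' @ [H (us @ [v])] \<in> vecs (n - 1) V"
        using vs(1) v mem(3)[OF snoc_mem[OF us(1) v(3)]] by (simp add: vecs_def)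
      from Cons(2)[OF this w(1)] show ?thesis
        using snoc(2)[OF us(1) v(3)] by (simp add: us vs w v)
    qed
    ultimately show "nw' (xs @ [ne' (z # ys)]) - ne' (z # butlast ys @ [H' (xs @ [last ys])]) =
        ne' (W' (xs @ [z]) # ys) + (\<Sum>i<n - 2. ne' (z # ys[i := C' (xs @ [ys ! i])]))"
      by simp
  next
    fix xs ys z assume "xs \<in> vecs n (T ` V)" "ys \<in> vecs (n - 2) (T ` V)" "z \<in> T ` V"
    then obtain us vs w where us: "us \<in> vecs n V" "xs = map T us"
      and vs: "vs \<in> vecs (n - 2) V" "ys = map T vs" and w: "w \<in> V" "z = T w"
      by (metis vecs_imageE imageE)
    have vs': "a # vs \<in> vecs (n - 1) V" if "a \<in> V" for a using vs that n by (auto simp: vecs_def)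
    have "ne (w # C us # vs) = (\<Sum>i<n. sV ((-1) ^ (n - Suc i)) (nw (omit i us @ [ne (w # us ! i # vs)])))"
      using D' us(1) vs(1) w(1) by blast
    from arg_cong[OF this, of T]
    have "T (ne (w # C us # vs)) = (\<Sum>i<n. sA ((-1) ^ (n - Suc i)) (T (nw (omit i us @ [ne (w # us ! i # vs)]))))"
      by (simp add: scale sum)
    moreover have "nw' (omit i xs @ [ne' (z # xs ! i # ys)]) = T (nw (omit i us @ [ne (w # us ! i # vs)]))" if "i < n" for i
      using snoc(1)[OF vecs_omit[OF us(1) that] mem(2)[OF Cons_mem[OF vs'[OF vecs_nth[OF us(1) that]] w(1)]]]
        Cons(2)[OF vs'[OF vecs_nth[OF us(1) that]] w(1)] that us vs w
      by (simp add: map_omit vecs_def)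
    moreover have "ne' (z # C' xs # ys) = T (ne (w # C us # vs))"
      using Cons(2)[OF vs'[OF C_mem[OF us(1)]] w(1)] C'[OF us(1)] by (simp add: us vs w)
    ultimately show "ne' (z # C' xs # ys) =
        (\<Sum>i<n. sA ((-1) ^ (n - Suc i)) (nw' (omit i xs @ [ne' (z # xs ! i # ys)])))"
      by simp
  next
    fix xs ys z assume "xs \<in> vecs (n - 2) (T ` V)" "ys \<in> vecs n (T ` V)" "z \<in> T ` V"
    then obtain us vs w where us: "us \<in> vecs (n - 2) V" "xs = map T us"
      and vs: "vs \<in> vecs n V" "ys = map T vs" and w: "w \<in> V" "z = T w"
      by (metis vecs_imageE imageE)
    have us': "us @ [a] \<in> vecs (n - 1) V" if "a \<in> V" for a using us that n by (auto simp: vecs_def)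
    obtain vs' v where v: "vs = vs' @ [v]" "vs' \<in> vecs (n - 1) V" "v \<in> V"
      using vs(1) by (rule vecs_snocE) (use n in auto)
    have "ne (w # us @ [H vs]) - nw (butlast vs @ [ne (w # us @ [last vs])]) =
        (\<Sum>i<n - 1. sV ((-1) ^ i) (ne (W (us @ [vs ! i, w]) # omit i vs)))"
      using D' us(1) vs(1) w(1) by blast
    from arg_cong[OF this, of T]
    have "T (ne (w # us @ [H vs])) - T (nw (vs' @ [ne (w # us @ [v])])) =
        (\<Sum>i<n - 1. sA ((-1) ^ i) (T (ne (W (us @ [vs ! i, w]) # omit i vs))))"
      by (simp add: diff scale sum v)
    moreover have "ne' (W' (xs @ [ys ! i, z]) # omit i ys) = T (ne (W (us @ [vs ! i, w]) # omit i vs))" if "i < n - 1" for i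
    proof -
      have i: "i < n" using that by simp
      note m = us'[OF vecs_nth[OF vs(1) i]]
      show ?thesis
        using snoc(3)[OF m w(1)] Cons(2)[OF vecs_omit[OF vs(1) i] mem(4)[OF snoc_mem[OF m w(1)]]] i us vs w
        by (simp add: map_omit vecs_def)
    qed
    moreover have "ne' (z # xs @ [H' ys]) = T (ne (w # us @ [H vs]))"
      using Cons(2)[OF us'[OF mem(3)[OF vs(1)]] w(1)] H'[OF vs(1)] by (simp add: us vs w)
    moreover have "nw' (butlast ys @ [ne' (z # xs @ [last ys])]) = T (nw (vs' @ [ne (w # us @ [v])]))"
      using Cons(2)[OF us'[OF v(3)] w(1)] snoc(1)[OF v(2) mem(2)[OF Cons_mem[OF us'[OF v(3)] w(1)]]]
      by (simp add: us vs w v)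
    ultimately show "ne' (z # xs @ [H' ys]) - nw' (butlast ys @ [ne' (z # xs @ [last ys])]) =
        (\<Sum>i<n - 1. sA ((-1) ^ i) (ne' (W' (xs @ [ys ! i, z]) # omit i ys)))"
      by simp
  next
    fix xs ys z assume "xs \<in> vecs (n - 1) (T ` V)" "ys \<in> vecs (n - 1) (T ` V)" "z \<in> T ` V"
    then obtain us vs w where us: "us \<in> vecs (n - 1) V" "xs = map T us"
      and vs: "vs \<in> vecs (n - 1) V" "ys = map T vs" and w: "w \<in> V" "z = T w"
      by (metis vecs_imageE imageE)
    have "ne (W (us @ [w]) # vs) - nw (us @ [ne (w # vs)]) =
        (\<Sum>i<n - 1. sV ((-1) ^ Suc i) (ne (w # omit i us @ [H (us ! i # vs)])))"
      using D' us(1) vs(1) w(1) by blast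
    from arg_cong[OF this, of T]
    have "T (ne (W (us @ [w]) # vs)) - T (nw (us @ [ne (w # vs)])) =
        (\<Sum>i<n - 1. sA ((-1) ^ Suc i) (T (ne (w # omit i us @ [H (us ! i # vs)]))))"
      by (simp only: diff sum scale)
    moreover have "ne' (z # omit i xs @ [H' (xs ! i # ys)]) = T (ne (w # omit i us @ [H (us ! i # vs)]))" if "i < n - 1" for i
    proof -
      note m = vecs_nth[OF us(1) that]
      show ?thesis
        using Cons(2)[OF omit_mem[OF us(1) that mem(3)[OF Cons_mem[OF vs(1) m]]] w(1)]
          Cons(3)[OF vs(1) m] that us vs w
        by (simp add: map_omit vecs_def)
    qed
    moreover have "nw' (xs @ [ne' (z # ys)]) = T (nw (us @ [ne (w # vs)]))"
      unfolding us(2) vs(2) w(2) Cons(2)[OF vs(1) w(1)]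
      by (rule snoc(1)[OF us(1) mem(2)[OF Cons_mem[OF vs(1) w(1)]]])
    moreover have "ne' (W' (xs @ [z]) # ys) = T (ne (W (us @ [w]) # vs))"
      unfolding us(2) vs(2) w(2) snoc(3)[OF us(1) w(1)]
      by (rule Cons(2)[OF vs(1) mem(4)[OF snoc_mem[OF us(1) w(1)]]])
    ultimately show "ne' (W' (xs @ [z]) # ys) - nw' (xs @ [ne' (z # ys)]) =
        (\<Sum>i<n - 1. sA ((-1) ^ Suc i) (ne' (z # omit i xs @ [H' (xs ! i # ys)])))"
      by simp
  qed
qed

section \<open>Independence of preimages and the operations on the image of T\<close>

context o_operator_setup
begin

lemma br_zero: "xs \<in> vecs n A \<Longrightarrow> 0 \<in> set xs \<Longrightarrow> br xs = 0"
  using multilinear_map_zero[OF vsA subA] alg by (auto simp: n_pre_lie_algebra_def)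

lemma l_zero: "xs \<in> vecs (n - 1) A \<Longrightarrow> v \<in> V \<Longrightarrow> 0 \<in> set xs \<Longrightarrow> l xs v = 0"
  and r_zero: "xs \<in> vecs (n - 1) A \<Longrightarrow> v \<in> V \<Longrightarrow> 0 \<in> set xs \<Longrightarrow> r xs v = 0"
  using gl by (auto simp: gl_map_def intro: multilinear_map_zero[OF vsA subA])

text \<open>
  In \<open>T {u\<^sub>1, \<dots>, u\<^sub>n}\<^sup>h = {T u\<^sub>1, \<dots>, T u\<^sub>n}\<close> an argument in the kernel of \<open>T\<close> leaves only the
  summand in which that argument is not hit by \<open>T\<close>.
\<close>

lemma T_l_kernel:
  assumes us: "us \<in> vecs (n - 1) V" and w: "w \<in> V" "T w = 0"
  shows "T (l (map T us) w) = 0"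
proof -
  have mem: "us @ [w] \<in> vecs n V" by (rule vecs_snoc[OF us w(1) n])
  have "r (map T (omit i (us @ [w]))) ((us @ [w]) ! i) = 0" if "i < n - 1" for i
  proof -
    have "i < n" using that by simp
    moreover have "0 \<in> set (map T (omit i (us @ [w])))" using that us w by (auto simp: omit_append vecs_def)
    ultimately show ?thesis by (intro r_zero T_vecs vecs_omit[OF mem] vecs_nth[OF mem])
  qed
  then have "hV (us @ [w]) = l (map T us) w" by (simp add: hV_eq[OF mem])
  moreover have "T (hV (us @ [w])) = 0"
    unfolding T_hV[OF mem] using br_zero[OF T_vecs[OF mem]] w by simp
  ultimately show ?thesis by simp
qed

lemma T_r_kernel:
  assumes us: "us \<in> vecs (n - 1) V" and w: "w \<in> V" "T w = 0"
  shows "T (r (map T us) w) = 0"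
proof -
  have mem: "w # us \<in> vecs n V" by (rule vecs_Cons[OF us w(1) n])
  obtain us' u where u: "us = us' @ [u]" "us' \<in> vecs (n - 1 - 1) V" "u \<in> V"
    using us by (rule vecs_snocE) (use n in auto)
  \<comment> \<open>The sum is split at position 0, the place of \<open>w\<close>: that term is the
    value of \<open>r\<close>, and every later one has \<open>T w = 0\<close> among its
    arguments.\<close>
  obtain m where m: "n - 1 = Suc m" using n by (cases "n - 1") auto
  have "l (map T (butlast (w # us))) (last (w # us)) = 0"
    using us u w T_vecs[of "w # us'" "n - 1"] n by (intro l_zero) (auto simp: vecs_def)
  moreover have "r (map T (omit (Suc i) (w # us))) ((w # us) ! Suc i) = 0" if "i < m" for i
  proof -
    have "Suc i < n" using that m by simp
    moreover have "0 \<in> set (map T (omit (Suc i) (w # us)))" using w by (simp add: omit_Cons)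
    ultimately show ?thesis by (intro r_zero T_vecs vecs_omit[OF mem] vecs_nth[OF mem])
  qed
  ultimately have "hV (w # us) = r (map T us) w"
    unfolding hV_eq[OF mem] m sum.lessThan_Suc_shift by (simp add: omit_Cons del: nth_Cons_Suc)
  moreover have "T (hV (w # us)) = 0"
    unfolding T_hV[OF mem] using br_zero[OF T_vecs[OF mem]] w by simp
  ultimately show ?thesis by simp
qed

text \<open>Meant for the one slot of \<open>nw\<close> or \<open>ne\<close> whose argument is not
  passed through \<open>T\<close>: two preimages differ by the kernel vector
  \<open>u - v\<close>.\<close>

lemma T_cong_of_kernel:
  assumes f: "linear_map sV V sV V f" and kernel: "\<And>w. w \<in> V \<Longrightarrow> T w = 0 \<Longrightarrow> T (f w) = 0"
    and uv: "u \<in> V" "v \<in> V" "T u = T v"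
  shows "T (f u) = T (f v)"
proof -
  have d: "u - v \<in> V" using uv subV by (simp add: V.subspace_diff)
  have "f (u - v) \<in> V" "f v \<in> V" and "f (u - v + v) = f (u - v) + f v"
    using f d uv(2) unfolding linear_map_def by blast+
  then have "T (f u) = T (f (u - v)) + T (f v)" using T_add by simp
  moreover have "T (u - v) = 0" using T_add[OF d uv(2)] uv(3) by simp
  ultimately show ?thesis using kernel[OF d] by simp
qed

text \<open>Equal images make the operators \<open>l (map T us')\<close> and
  \<open>l (map T vs')\<close> the same, so the two values differ only through the last
  argument.\<close>

lemma T_nw_cong:
  assumes us: "us \<in> vecs n V" and vs: "vs \<in> vecs n V" and eq: "map T us = map T vs"
  shows "T (nw us) = T (nw vs)"
proof -
  obtain us' u where u: "us = us' @ [u]" "us' \<in> vecs (n - 1) V" "u \<in> V"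
    using us by (rule vecs_snocE) (use n in auto)
  obtain vs' v where v: "vs = vs' @ [v]" "vs' \<in> vecs (n - 1) V" "v \<in> V"
    using vs by (rule vecs_snocE) (use n in auto)
  have T: "map T us' = map T vs'" "T u = T v" using eq u v by auto
  have "linear_map sV V sV V (l (map T us'))" using gl T_vecs[OF u(2)] by (simp add: gl_map_def)
  from T_cong_of_kernel[OF this T_l_kernel[OF u(2)] u(3) v(3) T(2)]
  show ?thesis using u v T(1) by (simp add: nw_snoc)
qed

lemma T_ne_cong:
  assumes us: "us \<in> vecs n V" and vs: "vs \<in> vecs n V" and eq: "map T us = map T vs"
  shows "T (ne us) = T (ne vs)"
proof -
  obtain u us' where u: "us = u # us'" "us' \<in> vecs (n - 1) V" "u \<in> V"
    using us n by (cases us) (auto simp: vecs_def)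
  obtain v vs' where v: "vs = v # vs'" "vs' \<in> vecs (n - 1) V" "v \<in> V"
    using vs n by (cases vs) (auto simp: vecs_def)
  have T: "map T us' = map T vs'" "T u = T v" using eq u v by auto
  have "linear_map sV V sV V (r (map T us'))" using gl T_vecs[OF u(2)] by (simp add: gl_map_def)
  from T_cong_of_kernel[OF this T_r_kernel[OF u(2)] u(3) v(3) T(2)]
  show ?thesis using u v T(1) by (simp add: ne_Cons)
qed

lemma image_dendriform:
  "\<exists>nw' ne'. n_L_dendriform_algebra n sA (T ` V) nw' ne' \<and>
     (\<forall>us\<in>vecs n V. nw' (map T us) = T (nw us) \<and> ne' (map T us) = T (ne us))"
proof -
  obtain pV where pV: "module_hom sV sV pV" "\<And>x. pV x \<in> V" "\<And>x. x \<in> V \<Longrightarrow> pV x = x"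
    using subspace_projection[OF vsV subV] by blast
  interpret p: module_hom sV sV pV by (rule pV(1))
  \<comment> \<open>\<open>T\<close> is linear on \<open>V\<close> only; after the projection it is
    linear on the whole type, with the same image of \<open>V\<close>.\<close>
  define Tt where "Tt v = T (pV v)" for v
  have hom: "module_hom sV sA Tt"
    by unfold_locales (simp_all add: Tt_def p.add p.scale T_add T_scale pV(2))
  have Tt: "Tt v = T v" if "v \<in> V" for v using that by (simp add: Tt_def pV(3))
  have image: "Tt ` V = T ` V" using Tt by (auto intro: rev_image_eqI)
  have map: "map Tt us = map T us" if "us \<in> vecs k V" for us k using that Tt by (auto simp: vecs_def)
  \<comment> \<open>An arbitrary choice of preimages; \<open>T_nw_cong\<close> and
    \<open>T_ne_cong\<close> show that the induced operations take the prescribed value at every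
    other choice.\<close>
  define lift where "lift = map (inv_into V T)"
  have lift: "lift (map T us) \<in> vecs n V" "map T (lift (map T us)) = map T us" if "us \<in> vecs n V" for us
  proof -
    have "inv_into V T (T u) \<in> V" "T (inv_into V T (T u)) = T u" if "u \<in> V" for u
      using that by (auto simp: inv_into_into f_inv_into_f)
    then show "lift (map T us) \<in> vecs n V" "map T (lift (map T us)) = map T us"
      using that by (auto simp: lift_def vecs_def)
  qed
  define nw' ne' where "nw' xs = T (nw (lift xs))" and "ne' xs = T (ne (lift xs))" for xs
  have nw': "nw' (map T us) = T (nw us)" and ne': "ne' (map T us) = T (ne us)" if "us \<in> vecs n V" for us
    unfolding nw'_def ne'_def using T_nw_cong T_ne_cong lift[OF that] that by blast+
  have "n_L_dendriform_algebra n sA (Tt ` V) nw' ne'"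
    by (rule n_L_dendriform_algebra_image[OF n dendriform hom vsA])
       (simp_all add: map nw' ne' Tt nw_mem ne_mem)
  then show ?thesis using nw' ne' unfolding image by blast
qed

end

theorem theorem5p4:
  fixes n :: nat
    and sA :: "'k::field_char_0 \<Rightarrow> 'a::ab_group_add \<Rightarrow> 'a" and A :: "'a set"
    and br :: "'a list \<Rightarrow> 'a"
    and sV :: "'k \<Rightarrow> 'v::ab_group_add \<Rightarrow> 'v" and V :: "'v set"
    and l r :: "'a list \<Rightarrow> 'v \<Rightarrow> 'v"
    and T :: "'v \<Rightarrow> 'a"
    and nw ne :: "'v list \<Rightarrow> 'v"
  assumes "n \<ge> 2"
    and "n_pre_lie_algebra n sA A br"
    and "n_pre_lie_rep n sA A br sV V l r"
    and "O_operator n sA A br sV V l r T"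
    and nw: "\<And>us. us \<in> vecs n V \<Longrightarrow> nw us = l (map T (butlast us)) (last us)"
    and ne: "\<And>us. us \<in> vecs n V \<Longrightarrow> ne us = r (map T (tl us)) (hd us)"
  shows "n_L_dendriform_algebra n sV V nw ne \<and>
    n_pre_lie_algebra n sV V (hor n sV nw ne) \<and>
    n_pre_lie_algebra n sV V (ver n sV nw ne) \<and>
    n_pre_lie_hom n sV V (hor n sV nw ne) sA A br T \<and>
    n_pre_lie_subalgebra n sA A br (T ` V) \<and>
    (\<exists>nw' ne'. n_L_dendriform_algebra n sA (T ` V) nw' ne' \<and>
       (\<forall>us\<in>vecs n V. nw' (map T us) = T (nw us) \<and> ne' (map T us) = T (ne us)))"
proof -
  interpret o_operator_setup n sA A br sV V l r T nw ne
    using assms by unfold_locales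
  have "n_pre_lie_hom n sV V (hor n sV nw ne) sA A br T"
    using T_linear T_hV by (simp add: n_pre_lie_hom_def)
  moreover have "n_pre_lie_subalgebra n sA A br (T ` V)"
    unfolding n_pre_lie_subalgebra_def
  proof (intro conjI ballI)
    show "module.subspace sA (T ` V)"
      using image_dendriform by (auto simp: n_L_dendriform_algebra_def fd_space_def)
    show "T ` V \<subseteq> A" using T_mem by blast
    fix xs assume "xs \<in> vecs n (T ` V)"
    then obtain us where "us \<in> vecs n V" "xs = map T us" by (rule vecs_imageE)
    then show "br xs \<in> T ` V" using T_hV hV_mem by (metis imageI)
  qed
  ultimately show ?thesis
    using dendriform hor_pre_lie ver_pre_lie image_dendriform by blast
qed

end
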